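(* There exist functions $r_{u,v}=r_{u,v}(\mathbf{z})$ ($u,v\in W$), polynomials in $q$ whose coefficients are rational functions of $\mathbf{z}\in\hat T(\mathbb{C})$, such that $r_{u,u}=1$, $r_{u,v}=0$ unless $u\leqslant v$, and the following hold. (1) $r_{u,v}(\mathbf{z})\to R_{u,v}$ if $\mathbf{z}\to\infty$ in such a direction that $\mathbf{z}^\alpha\to\infty$ for all positive roots $\alpha\in\Phi^+$. (2) They may be calculated by the following recursion. Let $s=s_\alpha$ be a simple reflection, corresponding to the simple root $\alpha$, such that $sv<v$. If $su<u$, then $$r_{u,v}(\mathbf{z})=\frac{1-q}{1-\mathbf{z}^{-v^{-1}\alpha}}\,r_{u,sv}(\mathbf{z})+r_{su,sv}(\mathbf{z}).$$ If $su>u$, then $$r_{u,v}(\mathbf{z})=(1-q)\frac{\mathbf{z}^{-v^{-1}\alpha}}{1-\mathbf{z}^{-v^{-1}\alpha}}\,r_{u,sv}(\mathbf{z})+q\,r_{su,sv}(\mathbf{z}).$$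
   Context: Let $\hat T(\mathbb{C})$ be a maximal torus in a complex reductive group, $\Phi$ the root system in the character lattice $X^*(\hat T)$, $\Phi^+$ a choice of positive roots, and $W$ the Weyl group with its simple reflections $s_\alpha$ ($\alpha$ simple), length function $l$ and Bruhat order $\leqslant$. For $\mathbf{z}\in\hat T(\mathbb{C})$ and $\lambda\in X^*(\hat T)$, $\mathbf{z}^\lambda$ is the value of $\lambda$ at $\mathbf{z}$. Let $q$ be an indeterminate and $q_w=q^{l(w)}$. $R_{u,v}\in\mathbb{Z}[q]$ are the Kazhdan-Lusztig R-polynomials: in the Iwahori Hecke algebra of $W$ with basis $T_w$ (with $T_wT_{w'}=T_{ww'}$ if $l(ww')=l(w)+l(w')$ and $T_s^2=(q-1)T_s+q$), $T_{v^{-1}}^{-1}=\sum_{u\leqslant v}\overline{R_{u,v}}\,q_u^{-1}T_u$, where the bar replaces $q$ by $q^{-1}$; $R_{u,v}=0$ unless $u\leqslant v$. *)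

theory Defs
  imports Complex_Main "HOL-Computational_Algebra.Polynomial" "HOL-Library.Poly_Mapping"
begin

section \<open>Integer multiples in an abelian group\<close>

definition zmul :: "int \<Rightarrow> 'x::ab_group_add \<Rightarrow> 'x" where
  "zmul n x = (\<Sum>i<nat n. x) - (\<Sum>i<nat (- n). x)"

lemma zmul_diff: "zmul (int a - int b) x = (\<Sum>i<a. x) - (\<Sum>i<b. x)"
proof -
  have split: "(\<Sum>i<m + n. x) = (\<Sum>i<m. x) + (\<Sum>i<n. x)" for m n :: nat
    by (induction n) (simp_all add: algebra_simps)
  show ?thesis
  proof (cases "b \<le> a")
    case True
    then obtain k where "a = b + k" using le_Suc_ex by blast
    then show ?thesis by (simp add: zmul_def split)
  next
    case False
    then obtain k where "b = a + k" using le_Suc_ex nat_le_linear by blast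
    then show ?thesis by (simp add: zmul_def split)
  qed
qed

lemma module_zmul: "module (zmul :: int \<Rightarrow> 'x::ab_group_add \<Rightarrow> 'x)"
proof
  fix a b :: int and x y :: 'x
  have z0: "zmul 0 u = 0" for u :: 'x
    by (simp add: zmul_def)
  show one: "zmul 1 x = x"
    by (simp add: zmul_def)
  show "zmul a (x + y) = zmul a x + zmul a y"
    by (simp add: zmul_def sum.distrib)
  have add: "zmul (c + d) u = zmul c u + zmul d u" for c d and u :: 'x
  proof -
    obtain m n where c: "c = int m - int n" using int_diff_cases by blast
    obtain k l where d: "d = int k - int l" using int_diff_cases by blast
    have split: "(\<Sum>i<m + n. u) = (\<Sum>i<m. u) + (\<Sum>i<n. u)" for m n :: nat
      by (induction n) (simp_all add: algebra_simps)
    have "c + d = int (m + k) - int (n + l)" using c d by simp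
    then have "zmul (c + d) u = (\<Sum>i<m + k. u) - (\<Sum>i<n + l. u)" by (simp only: zmul_diff)
    then show ?thesis unfolding c d zmul_diff split by simp
  qed
  then show "zmul (a + b) x = zmul a x + zmul b x" .
  have minus: "zmul (- c) u = - zmul c u" for c and u :: 'x
    by (simp add: zmul_def)
  show "zmul a (zmul b x) = zmul (a * b) x"
  proof (induction a rule: int_induct[where k = 0])
    case base
    then show ?case by (simp add: z0)
  next
    case (step1 i)
    then show ?case
      using one by (simp add: add distrib_right) (simp add: zmul_def)
  next
    case (step2 i)
    have "zmul (i - 1) u = zmul i u - u" for u :: 'x
      using add[of i "-1" u] minus[of 1 u] by (simp add: zmul_def)
    moreover have "zmul ((i - 1) * b) x = zmul (i * b) x - zmul b x"
      using add[of "i * b" "- b" x] minus[of b x] by (simp add: left_diff_distrib)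
    ultimately show ?case using step2 by simp
  qed
qed


section \<open>Root data, tori and Weyl groups\<close>

text \<open>The type \<open>'x\<close> is the character lattice of the torus.  The cocharacter lattice is its dual
  \<open>Hom('x, \<int>)\<close>, so a coroot is an additive function \<open>'x \<Rightarrow> int\<close> and \<open>coroot D \<alpha> x\<close> is the pairing
  of \<open>x\<close> with the coroot of \<open>\<alpha>\<close>.\<close>

record 'x root_datum =
  roots :: "'x set"
  coroot :: "'x \<Rightarrow> 'x \<Rightarrow> int"
  pos :: "'x set"

definition root_refl :: "('x::ab_group_add, 'm) root_datum_scheme \<Rightarrow> 'x \<Rightarrow> 'x \<Rightarrow> 'x" where
  "root_refl D \<alpha> x = x - zmul (coroot D \<alpha> x) \<alpha>"

text \<open>Reduced root data with a choice of positive roots; reduced root data are exactly the root data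
  of complex reductive groups with a maximal torus.\<close>

locale based_root_datum =
  fixes D :: "'x::ab_group_add root_datum"
  assumes lattice: "\<exists>B. finite B \<and> \<not> module.dependent zmul B \<and> module.span zmul B = (UNIV :: 'x set)"
    and finite_roots: "finite (roots D)"
    and coroot_additive: "\<alpha> \<in> roots D \<Longrightarrow> Modules.additive (coroot D \<alpha>)"
    and coroot_self: "\<alpha> \<in> roots D \<Longrightarrow> coroot D \<alpha> \<alpha> = 2"
    and coroot_inj: "inj_on (coroot D) (roots D)"
    and refl_root: "\<alpha> \<in> roots D \<Longrightarrow> \<beta> \<in> roots D \<Longrightarrow> root_refl D \<alpha> \<beta> \<in> roots D"
    and refl_coroot: "\<alpha> \<in> roots D \<Longrightarrow> \<beta> \<in> roots D \<Longrightarrow>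
      (\<lambda>x. coroot D \<beta> x - coroot D \<beta> \<alpha> * coroot D \<alpha> x) \<in> coroot D ` roots D"
    and reduced: "\<alpha> \<in> roots D \<Longrightarrow> \<alpha> + \<alpha> \<notin> roots D"
    and positive: "\<exists>f :: 'x \<Rightarrow> real. Modules.additive f \<and> (\<forall>\<alpha>\<in>roots D. f \<alpha> \<noteq> 0) \<and>
      pos D = {\<alpha> \<in> roots D. f \<alpha> > 0}"

definition simple_roots :: "('x::ab_group_add, 'm) root_datum_scheme \<Rightarrow> 'x set" where
  "simple_roots D = {\<alpha> \<in> pos D. \<not> (\<exists>\<beta>\<in>pos D. \<exists>\<gamma>\<in>pos D. \<alpha> = \<beta> + \<gamma>)}"

inductive_set weyl :: "('x::ab_group_add, 'm) root_datum_scheme \<Rightarrow> ('x \<Rightarrow> 'x) set"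
  for D :: "('x, 'm) root_datum_scheme" where
  weyl_id: "id \<in> weyl D"
| weyl_refl: "\<alpha> \<in> roots D \<Longrightarrow> w \<in> weyl D \<Longrightarrow> root_refl D \<alpha> \<circ> w \<in> weyl D"

definition weyl_length :: "('x::ab_group_add, 'm) root_datum_scheme \<Rightarrow> ('x \<Rightarrow> 'x) \<Rightarrow> nat" where
  "weyl_length D w = (LEAST k. \<exists>as. length as = k \<and> set as \<subseteq> simple_roots D \<and>
     w = foldr (\<lambda>\<alpha> g. root_refl D \<alpha> \<circ> g) as id)"

definition bruhat_le :: "('x::ab_group_add, 'm) root_datum_scheme \<Rightarrow> ('x \<Rightarrow> 'x) \<Rightarrow> ('x \<Rightarrow> 'x) \<Rightarrow> bool" where
  "bruhat_le D = (\<lambda>u v. (\<exists>\<alpha>\<in>roots D. v = root_refl D \<alpha> \<circ> u) \<and> weyl_length D u < weyl_length D v)\<^sup>*\<^sup>*"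

definition bruhat_less :: "('x::ab_group_add, 'm) root_datum_scheme \<Rightarrow> ('x \<Rightarrow> 'x) \<Rightarrow> ('x \<Rightarrow> 'x) \<Rightarrow> bool" where
  "bruhat_less D u v \<longleftrightarrow> bruhat_le D u v \<and> u \<noteq> v"

text \<open>The complex points of the torus with character lattice \<open>'x\<close> are the homomorphisms from
  \<open>'x\<close> to the nonzero complex numbers; the value of the character \<open>x\<close> at the point \<open>z\<close> is \<open>z x\<close>.\<close>

definition torus :: "('x::ab_group_add \<Rightarrow> complex) set" where
  "torus = {z. (\<forall>x. z x \<noteq> 0) \<and> (\<forall>x y. z (x + y) = z x * z y)}"

definition torus_reg :: "('x::ab_group_add, 'm) root_datum_scheme \<Rightarrow> ('x \<Rightarrow> complex) set" where
  "torus_reg D = {z \<in> torus. \<forall>\<alpha>\<in>roots D. z \<alpha> \<noteq> 1}"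

text \<open>The filter of points \<open>z\<close> of the torus going to infinity in such a way that the values of all
  positive roots at \<open>z\<close> go to infinity.\<close>

definition torus_at_infinity :: "('x::ab_group_add, 'm) root_datum_scheme \<Rightarrow> ('x \<Rightarrow> complex) filter" where
  "torus_at_infinity D =
     inf (principal torus) (INF \<alpha>\<in>pos D. filtercomap (\<lambda>z. z \<alpha>) at_infinity)"

text \<open>The regular functions on the torus are the elements of the group algebra of \<open>'x\<close>.\<close>

definition torus_eval :: "('x::ab_group_add \<Rightarrow>\<^sub>0 complex) \<Rightarrow> ('x \<Rightarrow> complex) \<Rightarrow> complex" where
  "torus_eval P z = (\<Sum>x\<in>Poly_Mapping.keys P. Poly_Mapping.lookup P x * z x)"

text \<open>A rational function on the torus is handled as an honest function on \<open>torus_reg D\<close>, the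
  complement of the hypersurfaces where some root takes the value 1; it must have no poles there.
  Since \<open>torus_reg D\<close> is Zariski dense, identities on it are identities of rational functions.\<close>

definition rational_on :: "('x::ab_group_add, 'm) root_datum_scheme \<Rightarrow> (('x \<Rightarrow> complex) \<Rightarrow> complex) \<Rightarrow> bool" where
  "rational_on D f \<longleftrightarrow> (\<exists>P Q. \<forall>z\<in>torus_reg D. torus_eval Q z \<noteq> 0 \<and> f z = torus_eval P z / torus_eval Q z)"

text \<open>Polynomials in \<open>q\<close> with rational functions as coefficients; the degree bound is uniform in \<open>z\<close>.\<close>

definition rational_poly_on ::
    "('x::ab_group_add, 'm) root_datum_scheme \<Rightarrow> (('x \<Rightarrow> complex) \<Rightarrow> complex poly) \<Rightarrow> bool" where
  "rational_poly_on D f \<longleftrightarrow>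
     (\<exists>N. \<forall>z\<in>torus_reg D. degree (f z) \<le> N) \<and> (\<forall>i. rational_on D (\<lambda>z. coeff (f z) i))"


section \<open>The Iwahori Hecke algebra and the R-polynomials\<close>

text \<open>\<open>\<int>[q, q\<^sup>-\<^sup>1]\<close> is the group ring of \<open>\<int>\<close>; \<open>qpow n\<close> is the \<open>n\<close>-th power of \<open>q\<close>,
  and \<open>bar p\<close> is the polynomial \<open>p\<close> evaluated at \<open>q\<^sup>-\<^sup>1\<close>.\<close>

type_synonym laurent = "int \<Rightarrow>\<^sub>0 int"

definition qpow :: "int \<Rightarrow> laurent" where
  "qpow n = Poly_Mapping.single n 1"

definition bar :: "int poly \<Rightarrow> laurent" where
  "bar p = (\<Sum>i\<le>degree p. of_int (coeff p i) * qpow (- int i))"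

text \<open>An associative \<open>\<int>[q, q\<^sup>-\<^sup>1]\<close>-algebra, free as a module with basis \<open>T w\<close>, \<open>w\<close> in the Weyl group;
  the relations determine it up to unique isomorphism, with unit \<open>T id\<close>.\<close>

locale iwahori_hecke_algebra = based_root_datum D + module scale
  for D :: "'x::ab_group_add root_datum"
    and scale :: "laurent \<Rightarrow> 'h::ring_1 \<Rightarrow> 'h" +
  fixes T :: "('x \<Rightarrow> 'x) \<Rightarrow> 'h"
  assumes scale_mult_left: "scale c a * b = scale c (a * b)"
    and scale_mult_right: "a * scale c b = scale c (a * b)"
    and T_inj: "inj_on T (weyl D)"
    and T_independent: "independent (T ` weyl D)"
    and T_span: "span (T ` weyl D) = UNIV"
    and T_mult: "w \<in> weyl D \<Longrightarrow> w' \<in> weyl D \<Longrightarrow>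
      weyl_length D (w \<circ> w') = weyl_length D w + weyl_length D w' \<Longrightarrow> T w * T w' = T (w \<circ> w')"
    and T_quadratic: "\<alpha> \<in> simple_roots D \<Longrightarrow>
      T (root_refl D \<alpha>) * T (root_refl D \<alpha>) = scale (qpow 1 - 1) (T (root_refl D \<alpha>)) + scale (qpow 1) 1"

definition two_sided_inverse :: "'h::ring_1 \<Rightarrow> 'h \<Rightarrow> bool" where
  "two_sided_inverse a b \<longleftrightarrow> a * b = 1 \<and> b * a = 1"

text \<open>The inverse of \<open>T (inv v)\<close> exists and is unique, and so are its coordinates in the basis \<open>T u\<close>, so this
  determines \<open>R u v\<close> for all \<open>u\<close>, \<open>v\<close> in the Weyl group.\<close>

definition R_polynomials ::
    "('x::ab_group_add, 'm) root_datum_scheme \<Rightarrow> (laurent \<Rightarrow> 'h::ring_1 \<Rightarrow> 'h) \<Rightarrow> (('x \<Rightarrow> 'x) \<Rightarrow> 'h) \<Rightarrow>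
     (('x \<Rightarrow> 'x) \<Rightarrow> ('x \<Rightarrow> 'x) \<Rightarrow> int poly) \<Rightarrow> bool" where
  "R_polynomials D scale T R \<longleftrightarrow>
     (\<forall>u\<in>weyl D. \<forall>v\<in>weyl D. \<not> bruhat_le D u v \<longrightarrow> R u v = 0) \<and>
     (\<forall>v\<in>weyl D. two_sided_inverse (T (inv v))
        (\<Sum>u\<in>{u \<in> weyl D. bruhat_le D u v}.
           scale (bar (R u v) * qpow (- int (weyl_length D u))) (T u)))"

end

theory Submission
  imports Defs
begin

text \<open>For a reduced word \<open>s\<^sub>1 \<dots> s\<^sub>k\<close> of \<open>v\<close> the recursion says that \<open>r(\<cdot>, v)\<close> is the product of the
  operators \<open>N\<^sub>s + (1 - q) / (1 - z\<^sup>\<beta>)\<close> applied to the indicator function of the identity, where \<open>N\<^sub>s\<close>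
  describes left multiplication by \<open>T\<^sub>s\<^sup>-\<^sup>1\<close> in the Hecke algebra and \<open>\<beta>\<close> runs through the inversions
  of \<open>v\<close>. These operators satisfy the Yang--Baxter equations of the rank two root systems, because
  the scalars \<open>a\<^sub>\<beta> = (1 - q) / (1 - z\<^sup>\<beta>)\<close> satisfy
  \<open>a\<^sub>\<beta> a\<^sub>\<gamma> = a\<^sub>\<beta>\<^sub>+\<^sub>\<gamma> (a\<^sub>\<beta> + a\<^sub>\<gamma> - (1 - q))\<close>; so, as in Matsumoto's theorem, the product does not depend on
  the reduced word. As \<open>z\<close> tends to infinity the scalars tend to \<open>0\<close>, and what remains is
  the inverse of \<open>T(v\<^sup>-\<^sup>1)\<close>, whose coordinates are the R-polynomials.\<close>

text \<open>The two cases of the recursion become one operator because (1-q) x / (1-x) = (q-1) +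
  (1-q) / (1-x): the q-1 belongs to multiplication by T_s^{-1}, and the remaining scalar no longer
  depends on u. The root attached to a letter is -v^{-1} \<alpha>, positive exactly because sv < v;
  hence all scalars vanish in the limit. Support, diagonal values, rationality and the limit can be
  read off from any single reduced word of v. Independence of the word matters for the recursion,
  where \<alpha> is an arbitrary left descent of v and the chosen word may begin with another
  letter. For the undeformed operators independence is immediate, since every reduced word yields
  the inverse of the same basis element; this supplies the braid relations that the Yang--Baxter
  computations use. The roots need not span the character lattice, so the invariant form is only
  semidefinite and a general lattice vector has no coordinates in simple roots; the arguments
  therefore go through heights and through cosets of rank two sublattices.\<close>

interpretation zmod: module zmul by (rule module_zmul)

lemma additive_zmul: "Modules.additive g \<Longrightarrow> g (zmul n x) = zmul n (g x)"
  by (simp add: zmul_def additive.diff additive.sum)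

lemma zmul_int: "zmul n (k::int) = n * k"
  by (cases "0 \<le> n") (simp_all add: zmul_def)

lemma zmul_real: "zmul n (k::real) = of_int n * k"
  by (cases "0 \<le> n") (simp_all add: zmul_def)

section \<open>Reflections and coroots\<close>

context based_root_datum
begin

abbreviation refl :: "'x \<Rightarrow> 'x \<Rightarrow> 'x" where "refl \<equiv> root_refl D"
abbreviation pair :: "'x \<Rightarrow> 'x \<Rightarrow> int" where "pair \<equiv> coroot D"

lemma pair_simps:
  assumes "\<alpha> \<in> roots D"
  shows "pair \<alpha> (x + y) = pair \<alpha> x + pair \<alpha> y" "pair \<alpha> (x - y) = pair \<alpha> x - pair \<alpha> y"
    "pair \<alpha> (- x) = - pair \<alpha> x" "pair \<alpha> 0 = 0" "pair \<alpha> (zmul n x) = n * pair \<alpha> x"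
  using coroot_additive[OF assms]
  by (simp_all add: additive.add additive.diff additive.minus additive.zero additive_zmul zmul_int)

lemma refl_additive:
  assumes "\<alpha> \<in> roots D"
  shows "Modules.additive (refl \<alpha>)"
  by unfold_locales (simp add: root_refl_def pair_simps[OF assms] zmod.scale_left_distrib)

lemma refl_simps:
  assumes "\<alpha> \<in> roots D"
  shows "refl \<alpha> (x + y) = refl \<alpha> x + refl \<alpha> y" "refl \<alpha> (x - y) = refl \<alpha> x - refl \<alpha> y"
    "refl \<alpha> (- x) = - refl \<alpha> x" "refl \<alpha> 0 = 0" "refl \<alpha> (zmul n x) = zmul n (refl \<alpha> x)"
  using refl_additive[OF assms]
  by (simp_all add: additive.add additive.diff additive.minus additive.zero additive_zmul)

lemma zmul_2: "zmul 2 x = x + x"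
  using zmod.scale_left_distrib[of 1 1 x] by simp

lemma refl_self: "\<alpha> \<in> roots D \<Longrightarrow> refl \<alpha> \<alpha> = - \<alpha>"
  by (simp add: root_refl_def coroot_self zmul_2)

lemma refl_refl: "\<alpha> \<in> roots D \<Longrightarrow> refl \<alpha> (refl \<alpha> x) = x"
  by (simp add: root_refl_def[of D \<alpha> x] refl_simps refl_self)

lemma refl_comp_refl: "\<alpha> \<in> roots D \<Longrightarrow> refl \<alpha> \<circ> refl \<alpha> = id"
  by (simp add: fun_eq_iff refl_refl)

text \<open>The lattice is free: expand x in the basis provided by \<open>lattice\<close> and
  compare coefficients. This permits cancelling integer factors in relations such as 2 \<beta> = 2
  \<alpha>.\<close>

lemma torsion_free:
  assumes "zmul n x = 0" "n \<noteq> 0"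
  shows "x = (0::'x)"
proof -
  obtain B where B: "finite B" "\<not> zmod.dependent B" "zmod.span B = (UNIV::'x set)"
    using lattice by blast
  have "x \<in> zmod.span B" using B(3) by simp
  then obtain t c where t: "finite t" "t \<subseteq> B" "x = (\<Sum>b\<in>t. zmul (c b) b)"
    unfolding zmod.span_explicit by auto
  have "(\<Sum>b\<in>t. zmul (n * c b) b) = 0"
    using assms(1) unfolding t(3) by (simp add: zmod.scale_sum_right)
  then have "n * c b = 0" if "b \<in> t" for b
    using zmod.independentD[OF B(2) t(1,2), of "\<lambda>b. n * c b" b] that by simp
  then have "c b = 0" if "b \<in> t" for b
    using assms(2) that by simp
  then show ?thesis using t(3) by simp
qed

text \<open>Precomposition with \<open>refl \<alpha>\<close> is the dual reflection on functionals,
  so this is \<open>refl_coroot\<close> in a form that can be iterated.\<close>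

lemma coroot_refl_mem:
  assumes "\<phi> \<in> coroot D ` roots D" "\<alpha> \<in> roots D"
  shows "\<phi> \<circ> refl \<alpha> \<in> coroot D ` roots D"
proof -
  obtain \<beta> where b: "\<beta> \<in> roots D" "\<phi> = coroot D \<beta>" using assms(1) by blast
  have "\<phi> \<circ> refl \<alpha> = (\<lambda>x. coroot D \<beta> x - coroot D \<beta> \<alpha> * coroot D \<alpha> x)"
    by (rule ext) (simp add: b root_refl_def pair_simps)
  then show ?thesis using refl_coroot[OF assms(2) b(1)] by simp
qed

text \<open>If the two sides differed by \<open>h\<close>, then the product of the two candidate reflections in
  \<open>refl \<alpha> \<beta>\<close> would be a nontrivial transvection, and composing a coroot with its powers would
  give infinitely many coroots.\<close>

lemma coroot_refl:
  assumes a: "\<alpha> \<in> roots D" and b: "\<beta> \<in> roots D"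
  shows "coroot D (refl \<alpha> \<beta>) x = coroot D \<beta> (refl \<alpha> x)"
proof -
  define c where "c = refl \<alpha> \<beta>"
  have c: "c \<in> roots D" using refl_root a b c_def by simp
  define h where "h = (\<lambda>x. pair \<beta> (refl \<alpha> x) - pair c x)"
  define t where "t = refl c \<circ> refl \<alpha> \<circ> refl \<beta> \<circ> refl \<alpha>"
  have "refl \<alpha> (refl \<beta> (refl \<alpha> x)) = x - zmul (pair \<beta> (refl \<alpha> x)) c" for x
    by (simp add: root_refl_def[of D \<beta>] refl_simps[OF a] refl_refl[OF a] c_def)
  then have t: "t x = x + zmul (h x) c" for x
    by (simp add: t_def refl_simps[OF c] refl_self[OF c] h_def zmod.scale_left_diff_distrib)
       (simp add: root_refl_def)
  have hc: "h c = 0"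
    by (simp add: h_def c_def refl_refl a)  (use c coroot_self b in \<open>simp add: c_def\<close>)
  define \<phi> where "\<phi> n x = pair c x + 2 * int n * h x" for n x
  have mem: "\<phi> n \<in> coroot D ` roots D" for n
  proof (induction n)
    case 0
    have "\<phi> 0 = pair c" by (simp add: \<phi>_def fun_eq_iff)
    then show ?case using c by simp
  next
    case (Suc n)
    then obtain d where d: "d \<in> roots D" "\<phi> n = pair d" by blast
    have "\<phi> n \<circ> t \<in> coroot D ` roots D"
      using Suc a b c unfolding t_def by (simp add: coroot_refl_mem o_assoc)
    moreover have "\<phi> n \<circ> t = \<phi> (Suc n)"
    proof
      fix x
      have "(\<phi> n \<circ> t) x = \<phi> n x + h x * \<phi> n c"
        unfolding d(2) by (simp add: t pair_simps d(1))
      also have "\<phi> n c = 2" by (simp add: \<phi>_def hc coroot_self c)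
      finally show "(\<phi> n \<circ> t) x = \<phi> (Suc n) x" by (simp add: \<phi>_def algebra_simps)
    qed
    ultimately show ?case by simp
  qed
  have "h x = 0"
  proof (rule ccontr)
    assume h: "h x \<noteq> 0"
    have "inj \<phi>"
    proof (rule injI)
      fix m n assume "\<phi> m = \<phi> n"
      then have "\<phi> m x = \<phi> n x" by simp
      then show "m = n" using h by (simp add: \<phi>_def)
    qed
    moreover have "finite (range \<phi>)"
      using mem finite_roots by (meson finite_imageI finite_subset image_subsetI)
    ultimately show False using finite_imageD by blast
  qed
  then show ?thesis by (simp add: h_def c_def)
qed

text \<open>Conjugation carries the vector \<beta> to \<open>refl \<alpha> \<beta>\<close> and the
  functional of \<beta> to its composition with \<open>refl \<alpha>\<close>; by
  \<open>coroot_refl\<close> the two again belong to one root.\<close>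

lemma refl_conj:
  assumes "\<alpha> \<in> roots D" "\<beta> \<in> roots D"
  shows "refl (refl \<alpha> \<beta>) = refl \<alpha> \<circ> refl \<beta> \<circ> refl \<alpha>"
proof
  fix x
  show "refl (refl \<alpha> \<beta>) x = (refl \<alpha> \<circ> refl \<beta> \<circ> refl \<alpha>) x"
    by (simp add: root_refl_def[of D \<beta>] refl_simps[OF assms(1)] refl_refl[OF assms(1)])
       (simp add: root_refl_def[of D "refl \<alpha> \<beta>"] coroot_refl assms)
qed

lemma uminus_root: "\<alpha> \<in> roots D \<Longrightarrow> - \<alpha> \<in> roots D"
  using refl_root refl_self by metis

lemma refl_uminus: "\<alpha> \<in> roots D \<Longrightarrow> refl (- \<alpha>) = refl \<alpha>"
  using refl_conj[of \<alpha> \<alpha>] by (simp add: refl_self comp_assoc refl_comp_refl)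

section \<open>The invariant form and the rank two bound\<close>

definition form :: "'x \<Rightarrow> 'x \<Rightarrow> int" where
  "form x y = (\<Sum>\<gamma>\<in>roots D. pair \<gamma> x * pair \<gamma> y)"

lemma form_sym: "form x y = form y x"
  by (simp add: form_def mult.commute)

lemma form_simps:
  shows "form (x + y) w = form x w + form y w" "form (x - y) w = form x w - form y w"
    and "form (- x) w = - form x w" "form (zmul n x) w = n * form x w"
    and "form w (x + y) = form w x + form w y" "form w (x - y) = form w x - form w y"
    and "form w (- x) = - form w x" "form w (zmul n x) = n * form w x"
proof -
  show add: "form (x + y) w = form x w + form y w" for x y w
    by (simp add: form_def pair_simps sum.distrib distrib_right)
  show diff: "form (x - y) w = form x w - form y w" for x y w
    by (simp add: form_def pair_simps sum_subtractf left_diff_distrib)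
  show minus: "form (- x) w = - form x w" for x w
    by (simp add: form_def pair_simps sum_negf)
  show zmul: "form (zmul n x) w = n * form x w" for n x w
    by (simp add: form_def pair_simps sum_distrib_left mult.assoc)
  show "form w (x + y) = form w x + form w y" "form w (x - y) = form w x - form w y"
    "form w (- x) = - form w x" "form w (zmul n x) = n * form w x"
    by (simp_all add: form_sym[of w] add diff minus zmul)
qed

text \<open>The reflection permutes the index set of the sum, and \<open>coroot_refl\<close> moves
  it from the index to the arguments.\<close>

lemma form_refl:
  assumes "\<alpha> \<in> roots D"
  shows "form (refl \<alpha> x) (refl \<alpha> y) = form x y"
proof -
  have "bij_betw (refl \<alpha>) (roots D) (roots D)"
    by (rule bij_betw_byWitness[where f' = "refl \<alpha>"]) (use refl_refl refl_root assms in auto)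
  then have "form x y = (\<Sum>\<gamma>\<in>roots D. pair (refl \<alpha> \<gamma>) x * pair (refl \<alpha> \<gamma>) y)"
    unfolding form_def by (rule sum.reindex_bij_betw[symmetric])
  also have "\<dots> = form (refl \<alpha> x) (refl \<alpha> y)"
    unfolding form_def by (rule sum.cong) (simp_all add: coroot_refl assms)
  finally show ?thesis by simp
qed

lemma form_nonneg: "form x x \<ge> 0"
  unfolding form_def by (rule sum_nonneg) simp

lemma form_root_pos:
  assumes "\<alpha> \<in> roots D"
  shows "form \<alpha> \<alpha> > 0"
  unfolding form_def
  by (rule sum_pos2[of _ \<alpha>]) (simp_all add: finite_roots assms coroot_self)

text \<open>The formula 2 (x, \<alpha>) / (\<alpha>, \<alpha>) without division: apply invariance
  under \<open>refl \<alpha>\<close>, which negates \<alpha>, and solve for the pairing.\<close>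

lemma pair_form:
  assumes "\<alpha> \<in> roots D"
  shows "pair \<alpha> x * form \<alpha> \<alpha> = 2 * form x \<alpha>"
proof -
  have "form x \<alpha> = form (refl \<alpha> x) (- \<alpha>)"
    using form_refl[OF assms, of x \<alpha>] by (simp add: refl_self assms)
  then show ?thesis by (simp add: root_refl_def form_simps)
qed

text \<open>A sum of squares vanishes only termwise. Null vectors can be nonzero, since the roots
  may span a sublattice of smaller rank.\<close>

lemma form_zero_pair:
  assumes "form x x = 0" "\<gamma> \<in> roots D"
  shows "pair \<gamma> x = 0"
proof -
  have "\<forall>\<gamma>\<in>roots D. pair \<gamma> x * pair \<gamma> x = 0"
    using assms(1) unfolding form_def by (subst (asm) sum_nonneg_eq_0_iff) (simp_all add: finite_roots)
  then show ?thesis using assms(2) by simp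
qed

lemma pair_sgn:
  assumes "\<alpha> \<in> roots D" "\<beta> \<in> roots D"
  shows "pair \<alpha> \<beta> > 0 \<longleftrightarrow> pair \<beta> \<alpha> > 0" "pair \<alpha> \<beta> = 0 \<longleftrightarrow> pair \<beta> \<alpha> = 0"
proof -
  have e: "pair \<alpha> \<beta> * form \<alpha> \<alpha> = pair \<beta> \<alpha> * form \<beta> \<beta>"
    using pair_form[OF assms(1), of \<beta>] pair_form[OF assms(2), of \<alpha>] form_sym[of \<alpha> \<beta>] by simp
  have p: "form \<alpha> \<alpha> > 0" "form \<beta> \<beta> > 0" using form_root_pos assms by auto
  show "pair \<alpha> \<beta> > 0 \<longleftrightarrow> pair \<beta> \<alpha> > 0"
    using e p by (metis zero_less_mult_pos2 mult_pos_pos)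
  show "pair \<alpha> \<beta> = 0 \<longleftrightarrow> pair \<beta> \<alpha> = 0"
    using e p by auto
qed

text \<open>Cauchy-Schwarz: \<open>d\<close> is twice the component of \<beta> orthogonal to
  \<alpha>, and its square length is that of \<beta> times 4 minus the product of the pairings. The
  value 4 makes \<open>d\<close> a null vector; finiteness of the root set then forces
  \<open>d = 0\<close>, and proportional roots of a reduced system agree up to sign.\<close>

lemma pair_mult_le:
  assumes a: "\<alpha> \<in> roots D" and b: "\<beta> \<in> roots D"
    and ne: "\<beta> \<noteq> \<alpha>" "\<beta> \<noteq> - \<alpha>"
  shows "pair \<alpha> \<beta> * pair \<beta> \<alpha> \<le> 3"
proof -
  define m n where "m = pair \<alpha> \<beta>" and "n = pair \<beta> \<alpha>"
  define d where "d = zmul 2 \<beta> - zmul m \<alpha>"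
  have e: "m * form \<alpha> \<alpha> = 2 * form \<alpha> \<beta>" "n * form \<beta> \<beta> = 2 * form \<alpha> \<beta>"
    using pair_form[OF a, of \<beta>] pair_form[OF b, of \<alpha>] form_sym[of \<alpha> \<beta>] by (simp_all add: m_def n_def)
  have "form d d = 4 * form \<beta> \<beta> - 4 * m * form \<alpha> \<beta> + m * (m * form \<alpha> \<alpha>)"
    by (simp add: d_def form_simps form_sym[of \<beta> \<alpha>] algebra_simps)
  also have "\<dots> = 4 * form \<beta> \<beta> - m * (2 * form \<alpha> \<beta>)" unfolding e by simp
  also have "\<dots> = (4 - m * n) * form \<beta> \<beta>" unfolding e(2)[symmetric] by (simp add: algebra_simps)
  finally have d: "form d d = (4 - m * n) * form \<beta> \<beta>" .
  have "m * n \<le> 4"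
    using form_nonneg[of d] form_root_pos[OF b] unfolding d
    by (simp add: zero_le_mult_iff)
  moreover have "m * n \<noteq> 4"
  proof
    assume mn: "m * n = 4"
    have pd: "pair \<gamma> d = 0" if "\<gamma> \<in> roots D" for \<gamma>
      using form_zero_pair[OF _ that] d mn by simp
    have rd: "refl \<gamma> d = d" if "\<gamma> \<in> roots D" for \<gamma>
      using pd[OF that] by (simp add: root_refl_def)
    \<comment> \<open>The coroot of \<beta> takes the value 2 - m n = -2 at
      \<open>refl \<alpha> \<beta>\<close>, so the second reflection adds 2 \<beta>.\<close>
    have tb: "refl \<beta> (refl \<alpha> \<beta>) = \<beta> + d"
    proof -
      have "refl \<alpha> \<beta> = \<beta> - zmul m \<alpha>" by (simp add: root_refl_def m_def)
      moreover have "pair \<beta> (\<beta> - zmul m \<alpha>) = -2"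
        using mn by (simp add: pair_simps b coroot_self n_def)
      ultimately show ?thesis by (simp add: root_refl_def[of D \<beta>] d_def)
    qed
    \<comment> \<open>Both reflections fix \<open>d\<close>, so every iteration of the composite
      shifts by \<open>d\<close>; this would give infinitely many roots unless
      \<open>d = 0\<close>.\<close>
    have "\<beta> + zmul (int k) d \<in> roots D" for k
    proof (induction k)
      case 0
      then show ?case using b by simp
    next
      case (Suc k)
      have "refl \<beta> (refl \<alpha> (\<beta> + zmul (int k) d)) = \<beta> + d + zmul (int k) d"
        by (simp add: refl_simps a b rd tb)
      also have "\<dots> = \<beta> + zmul (int (Suc k)) d"
        by (simp add: zmod.scale_left_distrib algebra_simps)
      finally show ?case using Suc refl_root a b by metis
    qed
    then have "finite (range (\<lambda>k. \<beta> + zmul (int k) d))"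
      using finite_roots by (meson finite_subset image_subsetI)
    then have "\<not> inj (\<lambda>k. \<beta> + zmul (int k) d)"
      using finite_imageD by blast
    then obtain k l where kl: "k \<noteq> l" "zmul (int k) d = zmul (int l) d"
      unfolding inj_def by auto
    then have "zmul (int k - int l) d = 0" by (simp add: zmod.scale_left_diff_distrib)
    then have "d = 0" using torsion_free kl(1) by fastforce
    then have d0: "zmul 2 \<beta> = zmul m \<alpha>" by (simp add: d_def)
    \<comment> \<open>With 2 \<beta> = m \<alpha> and m dividing 4, the possible ratios of \<beta>
      to \<alpha> are 1, 1/2 and 2 up to sign; the first is excluded by \<open>ne\<close>, the other
      two by \<open>reduced\<close>.\<close>
    have "m dvd 4" using mn by (metis dvd_triv_left)
    then have "\<bar>m\<bar> \<le> 4" using dvd_imp_le_int[of 4 m] by simp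
    then have "m \<in> {-4,-3,-2,-1,0,1,2,3,4}" by auto
    then have "m \<in> {-4,-2,-1,1,2,4}" using mn by auto presburger+
    then consider "m = 2" | "m = -2" | "m = 1" | "m = -1" | "m = 4" | "m = -4" by blast
    then show False
    proof cases
      case 1
      then have "zmul 2 (\<beta> - \<alpha>) = 0" using d0 by (simp add: zmod.scale_right_diff_distrib)
      then show False using torsion_free ne by fastforce
    next
      case 2
      then have "zmul 2 (\<beta> + \<alpha>) = 0" using d0 by (simp add: zmod.scale_right_distrib)
      then show False using torsion_free ne by (metis add_eq_0_iff2 zero_neq_numeral)
    next
      case 3
      then show False using d0 reduced[OF b] a by (simp add: zmul_2)
    next
      case 4
      then show False using d0 reduced[OF b] uminus_root[OF a] by (simp add: zmul_2)
    next
      case 5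
      then have "zmul 2 (\<beta> - (\<alpha> + \<alpha>)) = 0"
        using d0 zmod.scale_left_distrib[of 2 2 \<alpha>] by (simp add: zmod.scale_right_diff_distrib zmod.scale_right_distrib)
      then have "\<beta> = \<alpha> + \<alpha>" using torsion_free by fastforce
      then show False using reduced a b by auto
    next
      case 6
      then have "zmul 2 (\<beta> + (\<alpha> + \<alpha>)) = 0"
        using d0 zmod.scale_left_distrib[of 2 2 \<alpha>] by (simp add: zmod.scale_right_distrib)
      then have "\<beta> = - \<alpha> + - \<alpha>"
        using torsion_free[of 2 "\<beta> + (\<alpha> + \<alpha>)"] by (simp add: add_eq_0_iff2)
      then show False using reduced uminus_root a b by metis
    qed
  qed
  ultimately show ?thesis by (simp add: m_def n_def)
qed

end


section \<open>Positive and simple roots\<close>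

context based_root_datum
begin

text \<open>A functional cutting out the positive roots takes the place of the integral height and
  allows inductions that do not expand roots in simple roots.\<close>

definition height :: "'x \<Rightarrow> real" where
  "height = (SOME f. Modules.additive f \<and> (\<forall>\<alpha>\<in>roots D. f \<alpha> \<noteq> 0) \<and> pos D = {\<alpha> \<in> roots D. f \<alpha> > 0})"

lemma height:
  shows "Modules.additive height"
    and height_nonzero: "\<alpha> \<in> roots D \<Longrightarrow> height \<alpha> \<noteq> 0"
    and pos_iff: "\<alpha> \<in> pos D \<longleftrightarrow> \<alpha> \<in> roots D \<and> 0 < height \<alpha>"
proof -
  have *: "Modules.additive height \<and> (\<forall>\<alpha>\<in>roots D. height \<alpha> \<noteq> 0) \<and> pos D = {\<alpha> \<in> roots D. height \<alpha> > 0}"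
    unfolding height_def using someI_ex[OF positive] .
  then show "Modules.additive height" by blast
  show "\<alpha> \<in> roots D \<Longrightarrow> height \<alpha> \<noteq> 0" using * by blast
  show "\<alpha> \<in> pos D \<longleftrightarrow> \<alpha> \<in> roots D \<and> 0 < height \<alpha>" using * by blast
qed

lemma height_simps:
  "height (x + y) = height x + height y" "height (x - y) = height x - height y"
  "height (- x) = - height x" "height 0 = 0" "height (zmul n x) = of_int n * height x"
  using height(1)
  by (simp_all add: additive.add additive.diff additive.minus additive.zero additive_zmul zmul_real)

lemma pos_root: "\<alpha> \<in> pos D \<Longrightarrow> \<alpha> \<in> roots D"
  by (simp add: pos_iff)

lemma uminus_pos_iff: "\<alpha> \<in> roots D \<Longrightarrow> - \<alpha> \<in> pos D \<longleftrightarrow> \<alpha> \<notin> pos D"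
  using height_nonzero[of \<alpha>] uminus_root[of \<alpha>] by (auto simp: pos_iff height_simps)

lemma finite_pos: "finite (pos D)"
  by (rule finite_subset[OF _ finite_roots]) (auto simp: pos_iff)

text \<open>Heights are real numbers, so the induction runs over the number of positive roots of
  smaller height.\<close>

lemma pos_induct [consumes 1, case_names less]:
  assumes "\<beta> \<in> pos D"
    and step: "\<And>\<beta>. \<beta> \<in> pos D \<Longrightarrow> (\<And>\<gamma>. \<gamma> \<in> pos D \<Longrightarrow> height \<gamma> < height \<beta> \<Longrightarrow> P \<gamma>) \<Longrightarrow> P \<beta>"
  shows "P \<beta>"
  using assms(1)
proof (induction "card {\<gamma>\<in>pos D. height \<gamma> < height \<beta>}" arbitrary: \<beta> rule: less_induct)
  case less
  show ?case
  proof (rule step[OF less.prems])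
    fix \<gamma> assume g: "\<gamma> \<in> pos D" "height \<gamma> < height \<beta>"
    have "{\<delta>\<in>pos D. height \<delta> < height \<gamma>} \<subset> {\<delta>\<in>pos D. height \<delta> < height \<beta>}"
      using g by auto
    then have "card {\<delta>\<in>pos D. height \<delta> < height \<gamma>} < card {\<delta>\<in>pos D. height \<delta> < height \<beta>}"
      by (rule psubset_card_mono[rotated]) (simp add: finite_pos)
    then show "P \<gamma>" using less.hyps g(1) by blast
  qed
qed

lemma simple_pos: "\<alpha> \<in> simple_roots D \<Longrightarrow> \<alpha> \<in> pos D"
  by (simp add: simple_roots_def)

lemma simple_root: "\<alpha> \<in> simple_roots D \<Longrightarrow> \<alpha> \<in> roots D"
  by (simp add: simple_pos pos_root)

lemma simple_not_sum: "\<alpha> \<in> simple_roots D \<Longrightarrow> \<beta> \<in> pos D \<Longrightarrow> \<gamma> \<in> pos D \<Longrightarrow> \<alpha> \<noteq> \<beta> + \<gamma>"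
  by (auto simp: simple_roots_def)

text \<open>Two positive integers with product at most 3 cannot both exceed 1; whichever pairing
  equals 1 exhibits the difference, up to sign, as a reflected root.\<close>

lemma diff_root:
  assumes a: "\<alpha> \<in> roots D" and b: "\<beta> \<in> roots D" and "pair \<alpha> \<beta> > 0" "\<beta> \<noteq> \<alpha>"
  shows "\<beta> - \<alpha> \<in> roots D"
proof -
  have "\<beta> \<noteq> - \<alpha>" using assms(3) by (auto simp: pair_simps a coroot_self)
  then have le: "pair \<alpha> \<beta> * pair \<beta> \<alpha> \<le> 3" using pair_mult_le a b assms(4) by blast
  have pos: "pair \<beta> \<alpha> > 0" using pair_sgn(1)[OF a b] assms(3) by simp
  have "pair \<alpha> \<beta> = 1 \<or> pair \<beta> \<alpha> = 1"
  proof (rule ccontr)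
    assume "\<not> ?thesis"
    then have "2 \<le> pair \<alpha> \<beta>" "2 \<le> pair \<beta> \<alpha>" using pos assms(3) by auto
    then have "2 * 2 \<le> pair \<alpha> \<beta> * pair \<beta> \<alpha>" by (intro mult_mono) auto
    then show False using le by simp
  qed
  then show ?thesis
  proof
    assume "pair \<alpha> \<beta> = 1"
    then have "refl \<alpha> \<beta> = \<beta> - \<alpha>" by (simp add: root_refl_def)
    then show ?thesis using refl_root a b by metis
  next
    assume "pair \<beta> \<alpha> = 1"
    then have "refl \<beta> \<alpha> = \<alpha> - \<beta>" by (simp add: root_refl_def)
    then have "- (\<alpha> - \<beta>) \<in> roots D" using refl_root a b uminus_root by metis
    then show ?thesis by simp
  qed
qed

lemma pos_diff_simple:
  assumes "\<alpha> \<in> simple_roots D" "\<beta> \<in> pos D" "\<beta> - \<alpha> \<in> roots D"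
  shows "\<beta> - \<alpha> \<in> pos D"
proof (rule ccontr)
  assume "\<beta> - \<alpha> \<notin> pos D"
  then have "\<alpha> - \<beta> \<in> pos D" using uminus_pos_iff[OF assms(3)] by simp
  then show False using simple_not_sum[OF assms(1,2)] by fastforce
qed

lemma simple_pair_nonpos:
  assumes a: "\<alpha> \<in> simple_roots D" and b: "\<beta> \<in> simple_roots D" and ne: "\<alpha> \<noteq> \<beta>"
  shows "pair \<alpha> \<beta> \<le> 0"
proof (rule ccontr)
  assume "\<not> ?thesis"
  then have "\<beta> - \<alpha> \<in> roots D" using diff_root a b ne simple_root by simp
  then have "\<beta> - \<alpha> \<in> pos D" using pos_diff_simple a b simple_pos by blast
  then show False using simple_not_sum[OF b, of "\<beta> - \<alpha>" \<alpha>] a simple_pos by simp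
qed

text \<open>If the image were negative, \<delta> = n \<alpha> - \<beta> would be a positive root,
  where n is the pairing and at most 3. For n = 1 this decomposes \<alpha>. Otherwise
  \<open>diff_root\<close> allows subtracting \<alpha> from both \<beta> and \<delta>, which leaves
  positive roots that are opposite for n = 2 and that add up to \<alpha> for n = 3.\<close>

lemma refl_simple_pos:
  assumes a: "\<alpha> \<in> simple_roots D" and b: "\<beta> \<in> pos D" and ne: "\<beta> \<noteq> \<alpha>"
  shows "refl \<alpha> \<beta> \<in> pos D"
proof (rule ccontr)
  assume neg: "refl \<alpha> \<beta> \<notin> pos D"
  define n where "n = pair \<alpha> \<beta>"
  define \<delta> where "\<delta> = zmul n \<alpha> - \<beta>"
  have ar: "\<alpha> \<in> roots D" and br: "\<beta> \<in> roots D" using a b simple_root pos_root by auto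
  have r: "refl \<alpha> \<beta> = \<beta> - zmul n \<alpha>" by (simp add: root_refl_def n_def)
  have d: "\<delta> \<in> pos D"
    using uminus_pos_iff[OF refl_root[OF ar br]] neg by (simp add: r \<delta>_def)
  then have dr: "\<delta> \<in> roots D" by (rule pos_root)
  have hp: "height \<alpha> > 0" "height \<beta> > 0" "height \<delta> > 0"
    using simple_pos[OF a] b d by (simp_all add: pos_iff)
  then have "of_int n * height \<alpha> > 0" by (simp add: \<delta>_def height_simps)
  then have n0: "n > 0" using hp(1) by (simp add: zero_less_mult_iff)
  have "\<beta> \<noteq> - \<alpha>" using hp by (auto simp: height_simps)
  then have "n * pair \<beta> \<alpha> \<le> 3" using pair_mult_le ar br ne n_def by blast
  moreover have "pair \<beta> \<alpha> \<ge> 1" using pair_sgn(1)[OF ar br] n0 n_def by simp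
  ultimately have "n \<le> 3" using n0 mult_left_mono[of 1 "pair \<beta> \<alpha>" n] by linarith
  have sum: "\<beta> + \<delta> = zmul n \<alpha>" by (simp add: \<delta>_def)
  have "n \<noteq> 1" using sum simple_not_sum[OF a b d] by auto
  then consider "n = 2" | "n = 3" using \<open>n \<le> 3\<close> n0 by linarith
  then show False
  proof cases
    case 1
    have "\<beta> - \<alpha> \<in> pos D" using pos_diff_simple[OF a b] diff_root[OF ar br] n0 ne n_def by blast
    moreover have "pair \<alpha> \<delta> = n" by (simp add: \<delta>_def pair_simps ar coroot_self n_def)
    moreover have "\<delta> \<noteq> \<alpha>" using sum 1 ne by (auto simp: zmul_2)
    ultimately have "\<delta> - \<alpha> \<in> pos D" using pos_diff_simple[OF a d] diff_root[OF ar dr] n0 by simp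
    moreover have "\<delta> - \<alpha> = - (\<beta> - \<alpha>)" by (simp add: \<delta>_def 1 zmul_2)
    ultimately show False
      using \<open>\<beta> - \<alpha> \<in> pos D\<close> uminus_pos_iff[of "\<beta> - \<alpha>"] pos_root by metis
  next
    case 2
    have z3: "zmul 3 \<alpha> = \<alpha> + \<alpha> + \<alpha>" using zmod.scale_left_distrib[of 2 1 \<alpha>] by (simp add: zmul_2)
    have "\<beta> - \<alpha> \<in> pos D" using pos_diff_simple[OF a b] diff_root[OF ar br] n0 ne n_def by blast
    moreover have "pair \<alpha> \<delta> = n" by (simp add: \<delta>_def pair_simps ar coroot_self n_def)
    moreover have "\<delta> \<noteq> \<alpha>"
    proof
      assume "\<delta> = \<alpha>"
      then have "\<beta> = \<alpha> + \<alpha>" using sum 2 z3 by (simp add: algebra_simps)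
      then show False using reduced[OF ar] br by simp
    qed
    ultimately have "\<delta> - \<alpha> \<in> pos D" using pos_diff_simple[OF a d] diff_root[OF ar dr] n0 by simp
    moreover have "\<alpha> = (\<beta> - \<alpha>) + (\<delta> - \<alpha>)" by (simp add: \<delta>_def 2 z3)
    ultimately show False using simple_not_sum[OF a \<open>\<beta> - \<alpha> \<in> pos D\<close>] by blast
  qed
qed

text \<open>\<open>form\<close> is additive, so one summand of a decomposable \<beta> keeps a
  positive product with x, and the descent by height ends in a simple root. With x = \<beta> it
  yields a simple reflection that lowers \<beta>.\<close>

lemma exists_simple_form_pos:
  assumes "\<beta> \<in> pos D" "form \<beta> x > 0"
  shows "\<exists>\<alpha>\<in>simple_roots D. form \<alpha> x > 0"
  using assms
proof (induction \<beta> rule: pos_induct)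
  case (less \<beta>)
  show ?case
  proof (cases "\<beta> \<in> simple_roots D")
    case False
    then obtain \<gamma> \<delta> where gd: "\<gamma> \<in> pos D" "\<delta> \<in> pos D" "\<beta> = \<gamma> + \<delta>"
      using less.hyps by (auto simp: simple_roots_def)
    then have "height \<gamma> < height \<beta>" "height \<delta> < height \<beta>" by (auto simp: pos_iff height_simps)
    moreover have "form \<gamma> x > 0 \<or> form \<delta> x > 0" using less.prems gd(3) by (auto simp: form_simps)
    ultimately show ?thesis using less.IH gd by blast
  qed (use less.prems in blast)
qed

section \<open>Words, length and the exchange condition\<close>

definition word :: "'x list \<Rightarrow> 'x \<Rightarrow> 'x" where
  "word as = foldr (\<lambda>\<alpha> g. refl \<alpha> \<circ> g) as id"

lemma word_Nil [simp]: "word [] = id"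
  by (simp add: word_def)

lemma word_Cons [simp]: "word (a # as) = refl a \<circ> word as"
  by (simp add: word_def)

lemma word_append: "word (as @ bs) = word as \<circ> word bs"
  by (induction as) (simp_all add: o_assoc)

text \<open>Reflecting \<beta> in a simple root of positive pairing lowers its height and conjugates
  its reflection by a simple one; the descent ends when \<beta> is simple.\<close>

lemma refl_word:
  assumes "\<beta> \<in> pos D"
  shows "\<exists>as. set as \<subseteq> simple_roots D \<and> refl \<beta> = word as"
  using assms
proof (induction \<beta> rule: pos_induct)
  case (less \<beta>)
  show ?case
  proof (cases "\<beta> \<in> simple_roots D")
    case True
    then have "set [\<beta>] \<subseteq> simple_roots D \<and> refl \<beta> = word [\<beta>]" by simp
    then show ?thesis by blast
  next
    case False
    have br: "\<beta> \<in> roots D" using less.hyps by (rule pos_root)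
    obtain \<alpha> where a: "\<alpha> \<in> simple_roots D" "form \<alpha> \<beta> > 0"
      using exists_simple_form_pos[OF less.hyps form_root_pos[OF br]] by blast
    have ar: "\<alpha> \<in> roots D" using a(1) by (rule simple_root)
    have "pair \<alpha> \<beta> * form \<alpha> \<alpha> > 0" using pair_form[OF ar, of \<beta>] a(2) form_sym[of \<alpha> \<beta>] by simp
    then have "pair \<alpha> \<beta> > 0" using form_root_pos[OF ar] by (simp add: zero_less_mult_iff)
    have "refl \<alpha> \<beta> \<in> pos D" using refl_simple_pos a(1) less.hyps False by metis
    moreover have "height (refl \<alpha> \<beta>) < height \<beta>"
      using \<open>pair \<alpha> \<beta> > 0\<close> simple_pos[OF a(1)]
      by (simp add: root_refl_def height_simps pos_iff)
    ultimately obtain as where as: "set as \<subseteq> simple_roots D" "refl (refl \<alpha> \<beta>) = word as"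
      using less.IH by blast
    have "refl \<beta> = refl \<alpha> \<circ> refl (refl \<alpha> \<beta>) \<circ> refl \<alpha>"
      using refl_conj[OF ar refl_root[OF ar br]] by (simp add: refl_refl ar)
    also have "\<dots> = word (\<alpha> # as @ [\<alpha>])" by (simp add: as(2) word_append o_assoc)
    finally have "set (\<alpha> # as @ [\<alpha>]) \<subseteq> simple_roots D \<and> refl \<beta> = word (\<alpha> # as @ [\<alpha>])"
      using as(1) a(1) by simp
    then show ?thesis by blast
  qed
qed

lemma word_in_weyl: "set as \<subseteq> simple_roots D \<Longrightarrow> word as \<in> weyl D"
proof (induction as)
  case (Cons a as)
  then show ?case by (auto intro!: weyl_refl simple_root simp del: comp_apply)
qed (simp add: weyl_id)

lemma weyl_word:
  assumes "w \<in> weyl D"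
  shows "\<exists>as. set as \<subseteq> simple_roots D \<and> w = word as"
  using assms
proof induction
  case weyl_id
  show ?case by (rule exI[of _ "[]"]) simp
next
  case (weyl_refl \<alpha> w)
  then obtain as where as: "set as \<subseteq> simple_roots D" "w = word as" by blast
  have "\<exists>\<beta>\<in>pos D. refl \<alpha> = refl \<beta>"
    using weyl_refl(1) refl_uminus uminus_pos_iff by metis
  then obtain bs where "set bs \<subseteq> simple_roots D" "refl \<alpha> = word bs" using refl_word by metis
  then have "set (bs @ as) \<subseteq> simple_roots D \<and> refl \<alpha> \<circ> w = word (bs @ as)"
    using as by (simp add: word_append)
  then show ?case by blast
qed

lemma refl_weyl: "\<alpha> \<in> roots D \<Longrightarrow> refl \<alpha> \<in> weyl D"
  using weyl_refl[OF _ weyl_id] by simp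

lemma weyl_comp: "u \<in> weyl D \<Longrightarrow> w \<in> weyl D \<Longrightarrow> u \<circ> w \<in> weyl D"
  by (induction rule: weyl.induct) (simp_all add: weyl_refl comp_assoc)

lemma weyl_bij: "w \<in> weyl D \<Longrightarrow> bij w"
proof (induction rule: weyl.induct)
  case (weyl_refl \<alpha> w)
  have "bij (refl \<alpha>)" by (rule o_bij[of "refl \<alpha>"]) (simp_all add: refl_comp_refl weyl_refl(1))
  then show ?case using weyl_refl(3) by (simp add: bij_comp del: comp_apply)
qed (rule bij_id)

lemma refl_inv: "\<alpha> \<in> roots D \<Longrightarrow> inv (refl \<alpha>) = refl \<alpha>"
  by (rule inv_unique_comp) (simp_all add: refl_comp_refl)

lemma inv_refl_comp: "\<alpha> \<in> roots D \<Longrightarrow> w \<in> weyl D \<Longrightarrow> inv (refl \<alpha> \<circ> w) = inv w \<circ> refl \<alpha>"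
  using o_inv_distrib[of "refl \<alpha>" w] weyl_bij refl_weyl refl_inv by simp

lemma weyl_inv: "w \<in> weyl D \<Longrightarrow> inv w \<in> weyl D"
proof (induction rule: weyl.induct)
  case (weyl_refl \<alpha> w)
  then show ?case by (simp add: inv_refl_comp weyl_comp refl_weyl del: comp_apply)
next
  case weyl_id
  show ?case unfolding inv_id by (rule weyl.weyl_id)
qed

lemma weyl_inv_inv: "w \<in> weyl D \<Longrightarrow> inv (inv w) = w"
  by (simp add: weyl_bij inv_inv_eq)

lemma weyl_inv_apply: "w \<in> weyl D \<Longrightarrow> inv w (w x) = x" "w \<in> weyl D \<Longrightarrow> w (inv w x) = x"
  using weyl_bij by (simp_all add: bij_is_inj bij_is_surj surj_f_inv_f)

lemma weyl_inv_comp: "w \<in> weyl D \<Longrightarrow> inv w \<circ> w = id" "w \<in> weyl D \<Longrightarrow> w \<circ> inv w = id"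
  by (simp_all add: fun_eq_iff weyl_inv_apply)

lemma inv_comp: "u \<in> weyl D \<Longrightarrow> w \<in> weyl D \<Longrightarrow> inv (u \<circ> w) = inv w \<circ> inv u"
  by (simp add: o_inv_distrib weyl_bij)

lemma weyl_root: "w \<in> weyl D \<Longrightarrow> \<beta> \<in> roots D \<Longrightarrow> w \<beta> \<in> roots D"
  by (induction rule: weyl.induct) (simp_all add: refl_root)

lemma weyl_additive: "w \<in> weyl D \<Longrightarrow> Modules.additive w"
  by (induction rule: weyl.induct) (simp_all add: additive_def refl_simps)

lemma weyl_simps:
  assumes "w \<in> weyl D"
  shows "w (x + y) = w x + w y" "w (x - y) = w x - w y"
    "w (- x) = - w x" "w 0 = 0" "w (zmul n x) = zmul n (w x)"
  using weyl_additive[OF assms]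
  by (simp_all add: additive.add additive.diff additive.minus additive.zero additive_zmul)

abbreviation len :: "('x \<Rightarrow> 'x) \<Rightarrow> nat" where "len \<equiv> weyl_length D"

definition reduced_word :: "'x list \<Rightarrow> bool" where
  "reduced_word as \<longleftrightarrow> set as \<subseteq> simple_roots D \<and> len (word as) = length as"

lemma length_word_le: "set as \<subseteq> simple_roots D \<Longrightarrow> len (word as) \<le> length as"
  unfolding weyl_length_def word_def by (rule Least_le) blast

lemma exists_reduced_word:
  assumes "w \<in> weyl D"
  shows "\<exists>as. reduced_word as \<and> word as = w"
proof -
  have "\<exists>k as. length as = k \<and> set as \<subseteq> simple_roots D \<and> w = word as"
    using weyl_word[OF assms] by blast
  then have "\<exists>as. length as = len w \<and> set as \<subseteq> simple_roots D \<and> w = word as"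
    unfolding weyl_length_def word_def by (rule LeastI_ex)
  then show ?thesis unfolding reduced_word_def by metis
qed

lemma reduced_word_simple: "reduced_word as \<Longrightarrow> set as \<subseteq> simple_roots D"
  by (simp add: reduced_word_def)

lemma reduced_word_weyl: "reduced_word as \<Longrightarrow> word as \<in> weyl D"
  by (simp add: reduced_word_def word_in_weyl)

text \<open>Carry \<beta> through the word letter by letter. A positive root stays positive under a
  simple reflection unless it is that simple root, so it can become negative only by meeting a
  letter equal to itself, and that letter then cancels.\<close>

lemma exchange:
  assumes "set as \<subseteq> simple_roots D" "\<beta> \<in> pos D" "inv (word as) \<beta> \<notin> pos D"
  shows "\<exists>bs. set bs \<subseteq> simple_roots D \<and> Suc (length bs) = length as \<and> refl \<beta> \<circ> word as = word bs"
  using assms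
proof (induction as arbitrary: \<beta>)
  case (Cons a as)
  have a: "a \<in> simple_roots D" and as: "set as \<subseteq> simple_roots D" using Cons.prems by auto
  have ar: "a \<in> roots D" and br: "\<beta> \<in> roots D" using a simple_root Cons.prems pos_root by auto
  show ?case
  proof (cases "\<beta> = a")
    case True
    have "refl \<beta> \<circ> word (a # as) = word as"
      using True by (simp add: o_assoc refl_comp_refl ar)
    then show ?thesis using as by (auto simp del: comp_apply)
  next
    case False
    have "refl a \<beta> \<in> pos D" using refl_simple_pos a Cons.prems False by blast
    moreover have "inv (word as) (refl a \<beta>) \<notin> pos D"
      using Cons.prems(3) unfolding word_Cons inv_refl_comp[OF ar word_in_weyl[OF as]] by simp
    ultimately obtain bs where bs: "set bs \<subseteq> simple_roots D" "Suc (length bs) = length as"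
      "refl (refl a \<beta>) \<circ> word as = word bs" using Cons.IH as by blast
    have "refl \<beta> \<circ> refl a = refl a \<circ> refl (refl a \<beta>)"
      by (simp add: refl_conj ar br o_assoc refl_comp_refl)
    then have "refl \<beta> \<circ> word (a # as) = word (a # bs)"
      by (simp add: bs(3)[symmetric] o_assoc)
    then have "set (a # bs) \<subseteq> simple_roots D \<and> Suc (length (a # bs)) = length (a # as) \<and>
        refl \<beta> \<circ> word (a # as) = word (a # bs)" using bs a by simp
    then show ?thesis by blast
  qed
qed simp

lemma length_refl_less:
  assumes w: "w \<in> weyl D" and b: "\<beta> \<in> pos D" and "inv w \<beta> \<notin> pos D"
  shows "len (refl \<beta> \<circ> w) < len w"
proof -
  obtain as where as: "reduced_word as" "word as = w" using exists_reduced_word w by blast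
  then obtain bs where bs: "set bs \<subseteq> simple_roots D" "Suc (length bs) = length as"
    "refl \<beta> \<circ> w = word bs"
    using exchange[of as \<beta>] assms by (auto simp: reduced_word_def)
  have "len (refl \<beta> \<circ> w) \<le> length bs" using length_word_le[OF bs(1)] by (simp add: bs(3))
  also have "\<dots> < len w" using bs(2) as by (auto simp: reduced_word_def)
  finally show ?thesis .
qed

text \<open>Passing from w to \<open>refl \<beta> \<circ> w\<close> changes the sign of the image of
  \<beta>, so \<open>length_refl_less\<close> applies to the latter.\<close>

lemma length_refl_greater:
  assumes w: "w \<in> weyl D" and b: "\<beta> \<in> pos D" and p: "inv w \<beta> \<in> pos D"
  shows "len w < len (refl \<beta> \<circ> w)"
proof -
  have br: "\<beta> \<in> roots D" using b by (rule pos_root)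
  have w': "refl \<beta> \<circ> w \<in> weyl D" using w br by (simp add: weyl_refl)
  have "inv (refl \<beta> \<circ> w) \<beta> = - inv w \<beta>"
    by (simp add: inv_refl_comp br w refl_self weyl_simps[OF weyl_inv[OF w]])
  then have "inv (refl \<beta> \<circ> w) \<beta> \<notin> pos D"
    using uminus_pos_iff[OF pos_root[OF p]] p by simp
  then have "len (refl \<beta> \<circ> (refl \<beta> \<circ> w)) < len (refl \<beta> \<circ> w)"
    using length_refl_less w' b by blast
  then show ?thesis by (simp add: o_assoc refl_comp_refl br)
qed

lemma length_refl_less_iff:
  assumes "w \<in> weyl D" "\<beta> \<in> pos D"
  shows "len (refl \<beta> \<circ> w) < len w \<longleftrightarrow> inv w \<beta> \<notin> pos D"
  using length_refl_less length_refl_greater assms by (meson less_asym)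

lemma length_refl_greater_iff:
  assumes "w \<in> weyl D" "\<beta> \<in> pos D"
  shows "len w < len (refl \<beta> \<circ> w) \<longleftrightarrow> inv w \<beta> \<in> pos D"
  using length_refl_less length_refl_greater assms by (meson less_asym)

lemma length_simple_le:
  assumes "w \<in> weyl D" "\<alpha> \<in> simple_roots D"
  shows "len (refl \<alpha> \<circ> w) \<le> Suc (len w)"
proof -
  obtain as where as: "reduced_word as" "word as = w" using exists_reduced_word assms by blast
  then show ?thesis using length_word_le[of "\<alpha> # as"] assms(2) by (auto simp: reduced_word_def)
qed

lemma length_simple_up:
  assumes "w \<in> weyl D" "\<alpha> \<in> simple_roots D" "inv w \<alpha> \<in> pos D"
  shows "len (refl \<alpha> \<circ> w) = Suc (len w)"
  using length_refl_greater[of w \<alpha>] length_simple_le[of w \<alpha>] assms simple_pos by fastforce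

lemma length_simple_down:
  assumes "w \<in> weyl D" "\<alpha> \<in> simple_roots D" "inv w \<alpha> \<notin> pos D"
  shows "Suc (len (refl \<alpha> \<circ> w)) = len w"
proof -
  have ar: "\<alpha> \<in> roots D" using assms(2) by (rule simple_root)
  have "len (refl \<alpha> \<circ> w) < len w" using length_refl_less assms simple_pos by blast
  moreover have "len (refl \<alpha> \<circ> (refl \<alpha> \<circ> w)) \<le> Suc (len (refl \<alpha> \<circ> w))"
    using length_simple_le assms ar by (simp add: weyl_refl)
  ultimately show ?thesis by (simp add: o_assoc refl_comp_refl ar)
qed

lemma reduced_word_Nil: "reduced_word []"
  using length_word_le[of "[]"] by (simp add: reduced_word_def)

lemma length_id: "len id = 0"
  using reduced_word_Nil by (simp add: reduced_word_def)

text \<open>Reducedness can be tested one letter at a time, by the sign of a root. The roots that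
  occur in this test are the ones to which the scalars of the deformation are attached.\<close>

lemma reduced_word_Cons:
  "reduced_word (a # as) \<longleftrightarrow> a \<in> simple_roots D \<and> reduced_word as \<and> inv (word as) a \<in> pos D"
proof
  assume r: "reduced_word (a # as)"
  then have a: "a \<in> simple_roots D" and as: "set as \<subseteq> simple_roots D"
    and l: "len (refl a \<circ> word as) = Suc (length as)"
    by (auto simp: reduced_word_def)
  have w: "word as \<in> weyl D" using as by (rule word_in_weyl)
  have le: "len (word as) \<le> length as" using as by (rule length_word_le)
  have "len (word as) < len (refl a \<circ> word as)" using l le by simp
  then have p: "inv (word as) a \<in> pos D"
    using length_refl_greater_iff[OF w simple_pos[OF a]] by simp
  then have "len (word as) = length as" using length_simple_up[OF w a] l by simp
  then show "a \<in> simple_roots D \<and> reduced_word as \<and> inv (word as) a \<in> pos D"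
    using a as p by (simp add: reduced_word_def)
next
  assume *: "a \<in> simple_roots D \<and> reduced_word as \<and> inv (word as) a \<in> pos D"
  then have "len (refl a \<circ> word as) = Suc (len (word as))"
    using length_simple_up reduced_word_weyl by blast
  then show "reduced_word (a # as)" using * by (simp add: reduced_word_def)
qed

text \<open>A nontrivial w has a reduced word with a first letter, and the inverse of w sends that
  letter to a negative root.\<close>

lemma weyl_eq_id:
  assumes w: "w \<in> weyl D" and p: "\<And>\<alpha>. \<alpha> \<in> simple_roots D \<Longrightarrow> inv w \<alpha> \<in> pos D"
  shows "w = id"
proof -
  obtain as where as: "reduced_word as" "word as = w" using exists_reduced_word[OF w] by blast
  show ?thesis
  proof (cases as)
    case (Cons a bs)
    then have a: "a \<in> simple_roots D" and bs: "reduced_word bs" and pb: "inv (word bs) a \<in> pos D"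
      using as(1) by (auto simp: reduced_word_Cons)
    have ar: "a \<in> roots D" using a by (rule simple_root)
    have w': "inv (word bs) \<in> weyl D" using bs by (simp add: reduced_word_weyl weyl_inv)
    have "inv w a = - inv (word bs) a"
        unfolding as(2)[symmetric] Cons
      by (simp add: inv_refl_comp ar bs reduced_word_weyl refl_self weyl_simps[OF w'])
    then show ?thesis using p[OF a] uminus_pos_iff[OF pos_root[OF pb]] pb by simp
  qed (use as in simp)
qed

text \<open>The group acts faithfully on the finite root set although the roots need not span: two
  elements that agree on the roots differ by one that keeps all simple roots positive.\<close>

lemma finite_weyl: "finite (weyl D)"
proof -
  \<comment> \<open>The value 0 outside the roots is a default that places the restrictions in a
    finite set of functions.\<close>
  have "inj_on (\<lambda>w x. if x \<in> roots D then w x else 0) (weyl D)"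
  proof (rule inj_onI)
    fix u w assume u: "u \<in> weyl D" and w: "w \<in> weyl D"
      and eq: "(\<lambda>x. if x \<in> roots D then u x else 0) = (\<lambda>x. if x \<in> roots D then w x else 0)"
    have agree: "u x = w x" if "x \<in> roots D" for x using fun_cong[OF eq, of x] that by simp
    have "inv u \<circ> w = id"
    proof (rule weyl_eq_id)
      show "inv u \<circ> w \<in> weyl D" using u w by (simp add: weyl_comp weyl_inv)
      fix \<alpha> assume a: "\<alpha> \<in> simple_roots D"
      have ra: "inv w (u \<alpha>) = \<alpha>" using agree[OF simple_root[OF a]] w by (simp add: weyl_inv_apply)
      have "inv (inv u \<circ> w) \<alpha> = inv w (u \<alpha>)"
        using u w by (simp add: inv_comp weyl_inv weyl_inv_inv)
      then show "inv (inv u \<circ> w) \<alpha> \<in> pos D" using ra a simple_pos by simp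
    qed
    then have "u \<circ> (inv u \<circ> w) = u" by simp
    then show "u = w" using u by (simp add: o_assoc weyl_inv_comp)
  qed
  moreover have "finite ((\<lambda>w x. if x \<in> roots D then w x else 0) ` weyl D)"
    by (rule finite_subset[OF _ finite_set_of_finite_funs[OF finite_roots finite_roots, of 0]])
       (auto simp: weyl_root)
  ultimately show ?thesis using finite_imageD by blast
qed

lemma word_rev:
  assumes "set as \<subseteq> simple_roots D"
  shows "word (rev as) = inv (word as)"
  using assms
  by (induction as) (simp_all add: word_append inv_refl_comp word_in_weyl simple_root)

lemma length_inv:
  assumes "w \<in> weyl D"
  shows "len (inv w) = len w"
proof -
  have le: "len (inv w) \<le> len w" if w: "w \<in> weyl D" for w
  proof -
    obtain as where as: "reduced_word as" "word as = w" using exists_reduced_word[OF w] by blast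
    then show ?thesis
      using length_word_le[of "rev as"] word_rev[of as] by (auto simp: reduced_word_def)
  qed
  show ?thesis using le[OF assms] le[OF weyl_inv[OF assms]] weyl_inv_inv[OF assms] by simp
qed

lemma length_simple: "\<alpha> \<in> simple_roots D \<Longrightarrow> len (refl \<alpha>) = 1"
  using length_simple_up[OF weyl_id, of \<alpha>] simple_pos by (simp add: length_id)

section \<open>Bruhat order\<close>

abbreviation bruhat :: "('x \<Rightarrow> 'x) \<Rightarrow> ('x \<Rightarrow> 'x) \<Rightarrow> bool" where "bruhat \<equiv> bruhat_le D"

lemma bruhat_refl_step:
  "\<beta> \<in> roots D \<Longrightarrow> len u < len (refl \<beta> \<circ> u) \<Longrightarrow> bruhat u (refl \<beta> \<circ> u)"
  unfolding bruhat_le_def by (rule r_into_rtranclp) blast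

lemma bruhat_self: "bruhat u u"
  by (simp add: bruhat_le_def)

lemma bruhat_trans: "bruhat u v \<Longrightarrow> bruhat v w \<Longrightarrow> bruhat u w"
  unfolding bruhat_le_def by (rule rtranclp_trans)

text \<open>Opposite roots have the same reflection, so every step may be taken along a positive
  root.\<close>

lemma bruhat_induct [consumes 1, case_names refl step]:
  assumes "bruhat u v"
    and "P u"
    and "\<And>v \<beta>. bruhat u v \<Longrightarrow> \<beta> \<in> pos D \<Longrightarrow> len v < len (refl \<beta> \<circ> v) \<Longrightarrow> P v \<Longrightarrow> P (refl \<beta> \<circ> v)"
  shows "P v"
  using assms(1) unfolding bruhat_le_def
proof (induction rule: rtranclp_induct)
  case base
  then show ?case by (rule assms(2))
next
  case (step v w)
  then obtain \<alpha> where a: "\<alpha> \<in> roots D" "w = refl \<alpha> \<circ> v" "len v < len w" by blast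
  obtain \<beta> where "\<beta> \<in> pos D" "refl \<alpha> = refl \<beta>" using a(1) refl_uminus uminus_pos_iff by metis
  then show ?case using assms(3)[of v \<beta>] step a by (simp add: bruhat_le_def del: comp_apply)
qed

lemma bruhat_length:
  assumes "bruhat u v"
  shows "u = v \<or> len u < len v"
  using assms by (induction rule: bruhat_induct) (auto simp del: comp_apply)

lemma bruhat_weyl:
  assumes "bruhat u v" "u \<in> weyl D"
  shows "v \<in> weyl D"
  using assms by (induction rule: bruhat_induct) (auto simp: weyl_refl pos_root simp del: comp_apply)

text \<open>Follow a chain of reflections. After multiplication by \<open>refl \<alpha>\<close>, a
  step along \<beta> \<noteq> \<alpha> becomes a step along \<open>refl \<alpha> \<beta>\<close>,
  which is still positive and still increases the length; a step along \<alpha> itself turns the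
  first alternative into the second.\<close>

lemma bruhat_lift:
  assumes "bruhat x y" "x \<in> weyl D" and a: "\<alpha> \<in> simple_roots D"
  shows "bruhat (refl \<alpha> \<circ> x) (refl \<alpha> \<circ> y) \<or> bruhat (refl \<alpha> \<circ> x) y"
  using assms(1)
proof (induction rule: bruhat_induct)
  case refl
  show ?case by (simp add: bruhat_self)
next
  case (step v \<beta>)
  have ar: "\<alpha> \<in> roots D" and br: "\<beta> \<in> roots D" using a step simple_root pos_root by auto
  have v: "v \<in> weyl D" using step.hyps(1) assms(2) by (rule bruhat_weyl)
  have vb: "bruhat v (refl \<beta> \<circ> v)" using bruhat_refl_step step.hyps br by blast
  show ?case using step.IH
  proof
    assume "bruhat (refl \<alpha> \<circ> x) v"
    then show ?thesis using vb bruhat_trans by blast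
  next
    assume 1: "bruhat (refl \<alpha> \<circ> x) (refl \<alpha> \<circ> v)"
    show ?thesis
    proof (cases "\<beta> = \<alpha>")
      case True
      then show ?thesis using 1 by (simp del: comp_apply add: o_assoc refl_comp_refl ar)
    next
      case False
      have p: "refl \<alpha> \<beta> \<in> pos D" using refl_simple_pos a step.hyps False by blast
      have av: "refl \<alpha> \<circ> v \<in> weyl D" using v ar by (simp add: weyl_refl)
      have "inv v \<beta> \<in> pos D" using step.hyps length_refl_greater_iff[OF v] by simp
      then have "inv (refl \<alpha> \<circ> v) (refl \<alpha> \<beta>) \<in> pos D"
        by (simp add: inv_refl_comp ar v refl_refl)
      then have "len (refl \<alpha> \<circ> v) < len (refl (refl \<alpha> \<beta>) \<circ> (refl \<alpha> \<circ> v))"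
        using length_refl_greater av p by blast
      then have "bruhat (refl \<alpha> \<circ> v) (refl (refl \<alpha> \<beta>) \<circ> (refl \<alpha> \<circ> v))"
        using bruhat_refl_step p pos_root by blast
      moreover have "refl (refl \<alpha> \<beta>) \<circ> (refl \<alpha> \<circ> v) = refl \<alpha> \<circ> (refl \<beta> \<circ> v)"
        by (simp add: fun_eq_iff refl_conj ar br refl_refl)
      ultimately show ?thesis using 1 bruhat_trans by metis
    qed
  qed
qed

text \<open>A simple reflection is a single step of the order, and distinct comparable elements
  differ in length; so the order conditions of the recursion are conditions on lengths.\<close>

lemma bruhat_less_simple:
  assumes "v \<in> weyl D" and a: "\<alpha> \<in> simple_roots D"
  shows "bruhat_less D (refl \<alpha> \<circ> v) v \<longleftrightarrow> len (refl \<alpha> \<circ> v) < len v"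
    and "bruhat_less D v (refl \<alpha> \<circ> v) \<longleftrightarrow> len v < len (refl \<alpha> \<circ> v)"
proof -
  have ar: "\<alpha> \<in> roots D" using a by (rule simple_root)
  have "refl \<alpha> \<circ> (refl \<alpha> \<circ> v) = v" by (simp add: o_assoc refl_comp_refl ar)
  then show "bruhat_less D (refl \<alpha> \<circ> v) v \<longleftrightarrow> len (refl \<alpha> \<circ> v) < len v"
    using bruhat_length[of "refl \<alpha> \<circ> v" v] bruhat_refl_step[OF ar, of "refl \<alpha> \<circ> v"]
    unfolding bruhat_less_def by auto
  show "bruhat_less D v (refl \<alpha> \<circ> v) \<longleftrightarrow> len v < len (refl \<alpha> \<circ> v)"
    using bruhat_length[of v "refl \<alpha> \<circ> v"] bruhat_refl_step[OF ar, of v]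
    unfolding bruhat_less_def by auto
qed

end


section \<open>Alternating words and operators\<close>

primrec alt :: "'a \<Rightarrow> 'a \<Rightarrow> nat \<Rightarrow> 'a list" where
  "alt a b 0 = []"
| "alt a b (Suc k) = a # alt b a k"

lemma set_alt: "set (alt a b k) \<subseteq> {a, b}"
  by (induction k arbitrary: a b) (auto dest: subsetD)

primrec alt_op :: "('v \<Rightarrow> 'v) \<Rightarrow> ('v \<Rightarrow> 'v) \<Rightarrow> nat \<Rightarrow> 'v \<Rightarrow> 'v" where
  "alt_op S T 0 g = g"
| "alt_op S T (Suc k) g = S (alt_op T S k g)"

lemma alt_num:
  "alt a b 2 = [a, b]" "alt a b 3 = [a, b, a]" "alt a b 4 = [a, b, a, b]"
  "alt a b 6 = [a, b, a, b, a, b]"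
  by (simp_all add: eval_nat_numeral)

section \<open>The Yang--Baxter equation in rank two\<close>

text \<open>In the application p = 1 - q; keeping p and q as unrelated ring elements makes the
  coefficient identities generic. The quadratic relations are confined to V because the Hecke
  operators return 0 off the Weyl group.\<close>

locale quadratic_pair =
  fixes S T :: "('w \<Rightarrow> 'r::comm_ring_1) \<Rightarrow> 'w \<Rightarrow> 'r" and V :: "('w \<Rightarrow> 'r) set" and p q :: 'r
  assumes S_add: "S (\<lambda>u. g u + h u) = (\<lambda>u. S g u + S h u)"
    and S_scale: "S (\<lambda>u. c * g u) = (\<lambda>u. c * S g u)"
    and T_add: "T (\<lambda>u. g u + h u) = (\<lambda>u. T g u + T h u)"
    and T_scale: "T (\<lambda>u. c * g u) = (\<lambda>u. c * T g u)"
    and S_closed: "g \<in> V \<Longrightarrow> S g \<in> V" and T_closed: "g \<in> V \<Longrightarrow> T g \<in> V"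
    and S_quadratic: "g \<in> V \<Longrightarrow> S (S g) = (\<lambda>u. q * g u - p * S g u)"
    and T_quadratic: "g \<in> V \<Longrightarrow> T (T g) = (\<lambda>u. q * g u - p * T g u)"
begin

definition SA :: "'r \<Rightarrow> ('w \<Rightarrow> 'r) \<Rightarrow> 'w \<Rightarrow> 'r" where
  "SA a g = (\<lambda>u. S g u + a * g u)"

definition TA :: "'r \<Rightarrow> ('w \<Rightarrow> 'r) \<Rightarrow> 'w \<Rightarrow> 'r" where
  "TA a g = (\<lambda>u. T g u + a * g u)"

lemma alt_op_mem: "g \<in> V \<Longrightarrow> alt_op S T k g \<in> V \<and> alt_op T S k g \<in> V"
  by (induction k) (simp_all add: S_closed T_closed)

text \<open>\<open>c\<^sub>i\<close> and \<open>d\<^sub>i\<close> are the coefficients of the alternating words of length \<open>i\<close> that begin with \<open>S\<close>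
  and with \<open>T\<close>.\<close>

definition lin ::
    "('w \<Rightarrow> 'r) \<Rightarrow> 'r \<Rightarrow> 'r \<Rightarrow> 'r \<Rightarrow> 'r \<Rightarrow> 'r \<Rightarrow> 'r \<Rightarrow> 'r \<Rightarrow> 'r \<Rightarrow> 'r \<Rightarrow> 'r \<Rightarrow> 'r \<Rightarrow> 'r \<Rightarrow> 'r \<Rightarrow> 'w \<Rightarrow> 'r" where
  "lin f c0 c1 d1 c2 d2 c3 d3 c4 d4 c5 d5 c6 d6 = (\<lambda>u. c0 * f u
     + c1 * alt_op S T 1 f u + d1 * alt_op T S 1 f u
     + c2 * alt_op S T 2 f u + d2 * alt_op T S 2 f u
     + c3 * alt_op S T 3 f u + d3 * alt_op T S 3 f u
     + c4 * alt_op S T 4 f u + d4 * alt_op T S 4 f u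
     + c5 * alt_op S T 5 f u + d5 * alt_op T S 5 f u
     + c6 * alt_op S T 6 f u + d6 * alt_op T S 6 f u)"

text \<open>S lengthens a word that begins with T; a word that begins with S is rewritten by the
  quadratic relation. Length six, from type G2, is the longest that occurs, so the input has zero
  coefficients there.\<close>

lemma SA_lin:
  assumes "f \<in> V"
  shows "SA a (lin f c0 c1 d1 c2 d2 c3 d3 c4 d4 c5 d5 0 0) =
    lin f (a * c0 + q * c1) (c0 + (a - p) * c1) (a * d1 + q * c2) (d1 + (a - p) * c2)
      (a * d2 + q * c3) (d2 + (a - p) * c3) (a * d3 + q * c4) (d3 + (a - p) * c4)
      (a * d4 + q * c5) (d4 + (a - p) * c5) (a * d5) d5 0"
proof -
  have mem: "alt_op T S k f \<in> V" for k using alt_op_mem assms by blast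
  have sq: "S (alt_op S T (Suc k) f) = (\<lambda>u. q * alt_op T S k f u - p * alt_op S T (Suc k) f u)" for k
    using S_quadratic[OF mem[of k]] by simp
  have st: "S (alt_op T S k f) = alt_op S T (Suc k) f" for k by simp
  have n: "1 = Suc 0" "2 = Suc (Suc 0)" "3 = Suc (Suc (Suc 0))" "4 = Suc (Suc (Suc (Suc 0)))"
    "5 = Suc (Suc (Suc (Suc (Suc 0))))" "6 = Suc (Suc (Suc (Suc (Suc (Suc 0)))))"
    by simp_all
  show ?thesis
    unfolding SA_def lin_def S_add S_scale n
    unfolding sq st
    by (rule ext) (simp add: algebra_simps)
qed

end

lemma quadratic_pair_swap: "quadratic_pair S T V p q \<Longrightarrow> quadratic_pair T S V p q"
  unfolding quadratic_pair_def by blast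

context quadratic_pair
begin

lemma TA_lin:
  assumes "f \<in> V"
  shows "TA a (lin f c0 c1 d1 c2 d2 c3 d3 c4 d4 c5 d5 0 0) =
    lin f (a * c0 + q * d1) (a * c1 + q * d2) (c0 + (a - p) * d1) (a * c2 + q * d3) (c1 + (a - p) * d2)
      (a * c3 + q * d4) (c2 + (a - p) * d3) (a * c4 + q * d5) (c3 + (a - p) * d4)
      (a * c5) (c4 + (a - p) * d5) 0 c5"
proof -
  interpret swap: quadratic_pair T S V p q
    by (rule quadratic_pair_swap) (rule quadratic_pair_axioms)
  have "TA = swap.SA" by (simp add: fun_eq_iff TA_def swap.SA_def)
  moreover have "lin f c0 c1 d1 c2 d2 c3 d3 c4 d4 c5 d5 c6 d6 = swap.lin f c0 d1 c1 d2 c2 d3 c3 d4 c4 d5 c5 d6 c6"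
    for c0 c1 d1 c2 d2 c3 d3 c4 d4 c5 d5 c6 d6
    by (simp add: lin_def swap.lin_def algebra_simps)
  ultimately show ?thesis using swap.SA_lin[OF assms] by simp
qed

lemma lin_one: "f = lin f 1 0 0 0 0 0 0 0 0 0 0 0 0"
  by (simp add: lin_def)

lemma lin_eqI:
  assumes "c0 = c0'" "c1 = c1'" "d1 = d1'" "c2 = c2'" "d2 = d2'" "c3 = c3'" "d3 = d3'"
    "c4 = c4'" "d4 = d4'" "c5 = c5'" "d5 = d5'" "c6 = c6'" "d6 = d6'"
  shows "lin f c0 c1 d1 c2 d2 c3 d3 c4 d4 c5 d5 c6 d6 = lin f c0' c1' d1' c2' d2' c3' d3' c4' d4' c5' d5' c6' d6'"
  using assms by simp

lemma yang_baxter_2: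
  assumes "f \<in> V" and braid: "alt_op S T 2 f = alt_op T S 2 f"
  shows "SA a2 (TA a1 f) = TA a1 (SA a2 f)"
proof -
  have swap: "lin f c0 c1 d1 0 1 0 0 0 0 0 0 0 0 = lin f c0 c1 d1 1 0 0 0 0 0 0 0 0 0" for c0 c1 d1
    by (simp add: lin_def braid)
  have "SA a2 (TA a1 (lin f 1 0 0 0 0 0 0 0 0 0 0 0 0)) = TA a1 (SA a2 (lin f 1 0 0 0 0 0 0 0 0 0 0 0 0))"
    by (simp add: SA_lin TA_lin assms(1) swap mult.commute)
  then show ?thesis by (simp flip: lin_one)
qed

text \<open>Reversing the factors and exchanging S with T interchanges the two sides and fixes 1, ST
  and TS. So only the coefficients of S and T can differ, and they do so by the relation, with
  opposite signs.\<close>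

lemma yang_baxter_3:
  assumes "f \<in> V" and braid: "alt_op S T 3 f = alt_op T S 3 f"
    and rel: "a1 * a3 = a2 * (a1 + a3 - p)"
  shows "SA a3 (TA a2 (SA a1 f)) = TA a1 (SA a2 (TA a3 f))"
proof -
  have swap: "lin f c0 c1 d1 c2 d2 0 1 0 0 0 0 0 0 = lin f c0 c1 d1 c2 d2 1 0 0 0 0 0 0 0" for c0 c1 d1 c2 d2
    by (simp add: lin_def braid)
  have eqI: "x = y" if "x - y = e * (a1 * a3 - a2 * (a1 + a3 - p))" for x y e
    using that rel by simp
  have "SA a3 (TA a2 (SA a1 (lin f 1 0 0 0 0 0 0 0 0 0 0 0 0))) =
      TA a1 (SA a2 (TA a3 (lin f 1 0 0 0 0 0 0 0 0 0 0 0 0)))"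
    apply (simp add: SA_lin TA_lin assms(1) swap)
    apply (rule lin_eqI)
                apply (simp_all add: algebra_simps)
     apply (rule eqI[of _ _ "- 1"], simp add: algebra_simps)
    apply (rule eqI[of _ _ "1"], simp add: algebra_simps)
    done
  then show ?thesis by (simp flip: lin_one)
qed

text \<open>The two sides are reversals of each other, so the coefficients of palindromic words
  agree and only those of ST and TS remain. They differ by the sum of the two relations, one for
  each decomposable positive root of type B2.\<close>

lemma yang_baxter_4:
  assumes "f \<in> V" and braid: "alt_op S T 4 f = alt_op T S 4 f"
    and rel: "a1 * a4 = a3 * (a1 + a4 - p)" "a1 * a3 = a2 * (a1 + a3 - p)"
  shows "SA a4 (TA a3 (SA a2 (TA a1 f))) = TA a1 (SA a2 (TA a3 (SA a4 f)))"
proof -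
  have swap: "lin f c0 c1 d1 c2 d2 c3 d3 0 1 0 0 0 0 = lin f c0 c1 d1 c2 d2 c3 d3 1 0 0 0 0 0"
    for c0 c1 d1 c2 d2 c3 d3
    by (simp add: lin_def braid)
  have eqI: "x = y" if "x - y = e * (a1 * a4 - a3 * (a1 + a4 - p) + (a1 * a3 - a2 * (a1 + a3 - p)))" for x y e
    using that rel by simp
  have "SA a4 (TA a3 (SA a2 (TA a1 (lin f 1 0 0 0 0 0 0 0 0 0 0 0 0)))) =
      TA a1 (SA a2 (TA a3 (SA a4 (lin f 1 0 0 0 0 0 0 0 0 0 0 0 0))))"
    apply (simp add: SA_lin TA_lin assms(1) swap)
    apply (rule lin_eqI)
                apply (simp_all add: algebra_simps)
     apply (rule eqI[of _ _ "- 1"], simp add: algebra_simps)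
    apply (rule eqI[of _ _ "1"], simp add: algebra_simps)
    done
  then show ?thesis by (simp flip: lin_one)
qed

text \<open>By the same reversal only ST, TS, STST and TSTS remain. The relations are the five ways
  of writing a positive root of G2 as a sum of two positive roots, with \<open>a1\<close> to
  \<open>a6\<close> belonging to the roots in convex order.\<close>

lemma yang_baxter_6:
  assumes "f \<in> V" and braid: "alt_op S T 6 f = alt_op T S 6 f"
    and rel: "a1 * a6 = a5 * (a1 + a6 - p)" "a1 * a5 = a3 * (a1 + a5 - p)"
      "a1 * a3 = a2 * (a1 + a3 - p)" "a3 * a5 = a4 * (a3 + a5 - p)" "a2 * a6 = a4 * (a2 + a6 - p)"
  shows "SA a6 (TA a5 (SA a4 (TA a3 (SA a2 (TA a1 f))))) = TA a1 (SA a2 (TA a3 (SA a4 (TA a5 (SA a6 f)))))"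
proof -
  have swap: "lin f c0 c1 d1 c2 d2 c3 d3 c4 d4 c5 d5 0 1 = lin f c0 c1 d1 c2 d2 c3 d3 c4 d4 c5 d5 1 0"
    for c0 c1 d1 c2 d2 c3 d3 c4 d4 c5 d5
    by (simp add: lin_def braid)
  define r0 where "r0 = a1 * a6 - a5 * (a1 + a6 - p)"
  define r1 where "r1 = a1 * a5 - a3 * (a1 + a5 - p)"
  define r2 where "r2 = a1 * a3 - a2 * (a1 + a3 - p)"
  define r3 where "r3 = a3 * a5 - a4 * (a3 + a5 - p)"
  define r4 where "r4 = a2 * a6 - a4 * (a2 + a6 - p)"
  have r: "r0 = 0" "r1 = 0" "r2 = 0" "r3 = 0" "r4 = 0"
    using rel by (simp_all add: r0_def r1_def r2_def r3_def r4_def)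
  have eq4: "x = y" if "x - y = e * (r0 + r1 + r2 + r3)" for x y e
    using that r by simp
  \<comment> \<open>The cofactors come from solving the linear system for membership in the ideal of the relations.\<close>
  have eq2: "x = y" if "x - y = e * ((a3*p - a3*a4 + a2*p + a2*a4 - 2*a2*a3 + a1*a3 - a1*a2) * r0
      + (a4*p + a4*a6 - 2*a4*a5 + a3*a5 - a3*a4 - a1*a6 + a1*a5) * r2
      + (- (a2*a6) + a2*a3 + a1*a6 - a1*a3) * r3 - q * r1 - q * r4)" for x y e
    using that r by simp
  have "SA a6 (TA a5 (SA a4 (TA a3 (SA a2 (TA a1 (lin f 1 0 0 0 0 0 0 0 0 0 0 0 0)))))) =
      TA a1 (SA a2 (TA a3 (SA a4 (TA a5 (SA a6 (lin f 1 0 0 0 0 0 0 0 0 0 0 0 0))))))"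
    apply (simp add: SA_lin TA_lin assms(1) swap)
    apply (rule lin_eqI)
                apply (simp_all add: algebra_simps)
       apply (rule eq2[of _ _ 1], simp add: algebra_simps r0_def r1_def r2_def r3_def r4_def)
      apply (rule eq2[of _ _ "- 1"], simp add: algebra_simps r0_def r1_def r2_def r3_def r4_def)
     apply (rule eq4[of _ _ "- 1"], simp add: algebra_simps r0_def r1_def r2_def r3_def)
    apply (rule eq4[of _ _ 1], simp add: algebra_simps r0_def r1_def r2_def r3_def)
    done
  then show ?thesis by (simp flip: lin_one)
qed

end


section \<open>Operators on functions on the Weyl group\<close>

context based_root_datum
begin

text \<open>On the coordinates of \<open>hecke_elt\<close> below, this is left multiplication by \<open>T\<^sub>s\<^sup>-\<^sup>1\<close>.\<close>

definition hecke_op :: "'r \<Rightarrow> 'x \<Rightarrow> (('x \<Rightarrow> 'x) \<Rightarrow> 'r::comm_ring_1) \<Rightarrow> ('x \<Rightarrow> 'x) \<Rightarrow> 'r" where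
  "hecke_op q \<alpha> f u = (if u \<in> weyl D then
     if len (refl \<alpha> \<circ> u) < len u then f (refl \<alpha> \<circ> u) else (q - 1) * f u + q * f (refl \<alpha> \<circ> u)
   else 0)"

definition weyl_supported :: "(('x \<Rightarrow> 'x) \<Rightarrow> 'r::comm_ring_1) set" where
  "weyl_supported = {f. \<forall>u. u \<notin> weyl D \<longrightarrow> f u = 0}"

definition delta :: "('x \<Rightarrow> 'x) \<Rightarrow> ('x \<Rightarrow> 'x) \<Rightarrow> 'r::comm_ring_1" where
  "delta w u = (if u = w then 1 else 0)"

lemma delta_supported: "w \<in> weyl D \<Longrightarrow> delta w \<in> weyl_supported"
  by (auto simp: weyl_supported_def delta_def)

lemma hecke_op_supported: "hecke_op q \<alpha> f \<in> weyl_supported"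
  by (simp add: weyl_supported_def hecke_op_def)

lemma refl_comp_refl_comp: "\<alpha> \<in> roots D \<Longrightarrow> refl \<alpha> \<circ> (refl \<alpha> \<circ> u) = u"
  by (simp add: o_assoc refl_comp_refl)

lemma not_less_simple:
  assumes "u \<in> weyl D" "\<alpha> \<in> simple_roots D"
  shows "\<not> len (refl \<alpha> \<circ> u) < len u \<longleftrightarrow> len u < len (refl \<alpha> \<circ> u)"
  using length_refl_less_iff length_refl_greater_iff assms simple_pos by blast

lemma hecke_op_quadratic:
  assumes "f \<in> weyl_supported" and a: "\<alpha> \<in> simple_roots D"
  shows "hecke_op q \<alpha> (hecke_op q \<alpha> f) = (\<lambda>u. q * f u - (1 - q) * hecke_op q \<alpha> f u)"
proof
  fix u
  show "hecke_op q \<alpha> (hecke_op q \<alpha> f) u = q * f u - (1 - q) * hecke_op q \<alpha> f u"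
  proof (cases "u \<in> weyl D")
    case True
    have ar: "\<alpha> \<in> roots D" using a by (rule simple_root)
    have su: "refl \<alpha> \<circ> u \<in> weyl D" using True ar by (simp add: weyl_refl)
    consider "len (refl \<alpha> \<circ> u) < len u" | "len u < len (refl \<alpha> \<circ> u)"
      using not_less_simple[OF True a] by blast
    then show ?thesis
      by cases (simp_all add: hecke_op_def True su refl_comp_refl_comp ar algebra_simps del: comp_apply)
  next
    case False
    then show ?thesis using assms(1) by (simp add: hecke_op_def weyl_supported_def)
  qed
qed

lemma hecke_op_add: "hecke_op q \<alpha> (\<lambda>u. g u + h u) = (\<lambda>u. hecke_op q \<alpha> g u + hecke_op q \<alpha> h u)"
  by (rule ext) (simp add: hecke_op_def algebra_simps)

lemma hecke_op_scale: "hecke_op q \<alpha> (\<lambda>u. c * g u) = (\<lambda>u. c * hecke_op q \<alpha> g u)"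
  by (rule ext) (simp add: hecke_op_def algebra_simps)

lemma hecke_op_zero: "hecke_op q \<alpha> (\<lambda>u. 0) = (\<lambda>u. 0)"
  by (rule ext) (simp add: hecke_op_def)

lemma hecke_op_sum:
  assumes "finite A"
  shows "hecke_op q \<alpha> (\<lambda>u. \<Sum>w\<in>A. g w u) = (\<lambda>u. \<Sum>w\<in>A. hecke_op q \<alpha> (g w) u)"
  using assms by (induction A) (simp_all add: hecke_op_zero hecke_op_add)

lemma quadratic_pair_hecke_op:
  assumes "\<alpha> \<in> simple_roots D" "\<beta> \<in> simple_roots D"
  shows "quadratic_pair (hecke_op q \<alpha>) (hecke_op q \<beta>) weyl_supported (1 - q) q"
  by unfold_locales
     (simp_all add: hecke_op_add hecke_op_scale hecke_op_supported hecke_op_quadratic assms)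

definition hecke_ops :: "'r \<Rightarrow> 'x list \<Rightarrow> (('x \<Rightarrow> 'x) \<Rightarrow> 'r::comm_ring_1) \<Rightarrow> ('x \<Rightarrow> 'x) \<Rightarrow> 'r" where
  "hecke_ops q as f = foldr (hecke_op q) as f"

lemma hecke_ops_simps [simp]:
  "hecke_ops q [] f = f" "hecke_ops q (a # as) f = hecke_op q a (hecke_ops q as f)"
  by (simp_all add: hecke_ops_def)

lemma hecke_ops_supported: "f \<in> weyl_supported \<Longrightarrow> hecke_ops q as f \<in> weyl_supported"
  by (cases as) (simp_all add: hecke_op_supported)

lemma alt_op_hecke: "alt_op (hecke_op q a) (hecke_op q b) k f = hecke_ops q (alt a b k) f"
  by (induction k arbitrary: a b) simp_all

text \<open>Linearity over the finite basis \<open>delta w\<close>; it reduces identities of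
  operators to functions that are already defined over \<int>[q].\<close>

lemma hecke_ops_expand:
  assumes "f \<in> weyl_supported"
  shows "hecke_ops q as f = (\<lambda>u. \<Sum>w\<in>weyl D. f w * hecke_ops q as (delta w) u)"
proof (induction as)
  case Nil
  have "f u = (\<Sum>w\<in>weyl D. f w * delta w u)" for u
  proof (cases "u \<in> weyl D")
    case True
    have "(\<Sum>w\<in>weyl D. f w * delta w u) = (\<Sum>w\<in>weyl D. if w = u then f w else 0)"
      by (rule sum.cong) (auto simp: delta_def)
    also have "\<dots> = f u" using True finite_weyl by simp
    finally show ?thesis by simp
  next
    case False
    then have "(\<Sum>w\<in>weyl D. f w * delta w u) = 0"
      by (intro sum.neutral) (auto simp: delta_def)
    then show ?thesis using False assms by (simp add: weyl_supported_def)
  qed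
  then show ?case unfolding hecke_ops_simps by (rule ext)
next
  case (Cons a as)
  show ?case
    unfolding hecke_ops_simps by (subst Cons) (simp only: hecke_op_sum[OF finite_weyl] hecke_op_scale)
qed

text \<open>Change of coefficients: the operators use addition and multiplication by q and q - 1,
  and these are what \<phi> respects.\<close>

lemma hecke_ops_hom:
  assumes "\<phi> 0 = (0::'s::comm_ring_1)" "\<And>x y. \<phi> (x + y) = \<phi> x + \<phi> y"
    and "\<And>x. \<phi> (q * x) = q' * \<phi> x" "\<And>x. \<phi> ((q - 1) * x) = (q' - 1) * \<phi> x"
  shows "\<phi> (hecke_ops q as f u) = hecke_ops q' as (\<lambda>u. \<phi> (f u)) u"
proof (induction as arbitrary: u)
  case (Cons a as)
  then show ?case by (simp add: hecke_op_def assms del: comp_apply)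
qed simp

end

section \<open>The Hecke algebra\<close>

lemma qpow_add: "qpow m * qpow n = qpow (m + n)"
  by (simp add: qpow_def mult_single)

lemma qpow_0: "qpow 0 = 1"
  by (simp add: qpow_def)

lemma bar_bound: "degree p \<le> n \<Longrightarrow> bar p = (\<Sum>i\<le>n. of_int (coeff p i) * qpow (- int i))"
  unfolding bar_def by (rule sum.mono_neutral_left) (auto simp: coeff_eq_0)

lemma bar_add: "bar (p + r) = bar p + bar r"
proof -
  define n where "n = max (degree p) (degree r)"
  have "degree (p + r) \<le> n" by (simp add: n_def degree_add_le)
  then show ?thesis
    by (simp add: bar_bound[of _ n] n_def sum.distrib distrib_right)
qed

lemma bar_0: "bar 0 = 0"
  by (simp add: bar_def)

lemma bar_uminus: "bar (- p) = - bar p"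
  using bar_add[of p "- p"] by (simp add: bar_0 eq_neg_iff_add_eq_0 add.commute)

lemma bar_diff: "bar (p - r) = bar p - bar r"
  using bar_add[of p "- r"] by (simp add: bar_uminus)

lemma bar_1: "bar 1 = 1"
  by (simp add: bar_def qpow_0)

lemma bar_shift: "bar ([:0, 1:] * p) = qpow (- 1) * bar p"
proof -
  have "bar (pCons 0 p) = (\<Sum>i\<le>Suc (degree p). of_int (coeff (pCons 0 p) i) * qpow (- int i))"
    by (rule bar_bound) (rule degree_pCons_le)
  also have "\<dots> = (\<Sum>i\<le>degree p. of_int (coeff p i) * qpow (- 1 - int i))"
    by (subst sum.atMost_Suc_shift) (simp add: algebra_simps)
  also have "\<dots> = qpow (- 1) * bar p"
    unfolding bar_def sum_distrib_left
    by (rule sum.cong) (simp_all add: mult.left_commute qpow_add)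
  finally show ?thesis by simp
qed

lemma lookup_bar: "Poly_Mapping.lookup (bar p) (- int i) = coeff p i"
proof -
  have o: "of_int c * qpow k = Poly_Mapping.single k c" for c k
    by (simp add: qpow_def mult_single flip: single_of_int)
  have "Poly_Mapping.lookup (bar p) (- int i) = (\<Sum>j\<le>degree p. coeff p j when j = i)"
    unfolding bar_def o lookup_sum by (rule sum.cong) (auto simp: lookup_single when_def)
  also have "\<dots> = coeff p i"
    by (simp add: when_def sum.delta coeff_eq_0)
  finally show ?thesis .
qed

lemma bar_eq_0: "bar p = 0 \<Longrightarrow> p = 0"
  by (rule poly_eqI) (metis lookup_bar lookup_zero coeff_0)

context iwahori_hecke_algebra
begin

text \<open>Lengths add for \<open>id\<close> and any w, so left multiplication by
  \<open>T id\<close> fixes the basis and therefore the unit.\<close>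

lemma T_id: "T id = 1"
proof -
  have "T id * x = x" for x
  proof -
    have "x \<in> span (T ` weyl D)" using T_span by simp
    then show ?thesis
    proof (induction rule: span_induct_alt)
      case base
      then show ?case by simp
    next
      case (step c y z)
      then obtain w where w: "w \<in> weyl D" "y = T w" by blast
      have "T id * T w = T w" using T_mult[OF weyl_id w(1)] by (simp add: length_id)
      then show ?case using step w by (simp add: distrib_left scale_mult_right del: id_apply)
    qed
  qed
  from this[of 1] show ?thesis by simp
qed

text \<open>The inverse of T_s, obtained by solving the quadratic relation.\<close>

definition T_inv :: "'x \<Rightarrow> 'h" where
  "T_inv \<alpha> = scale (qpow (- 1)) (T (refl \<alpha>)) + scale (qpow (- 1) - 1) 1"

lemma T_inv:
  assumes "\<alpha> \<in> simple_roots D"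
  shows "T_inv \<alpha> * T (refl \<alpha>) = 1" "T (refl \<alpha>) * T_inv \<alpha> = 1"
proof -
  have "scale (qpow (- 1)) (T (refl \<alpha>) * T (refl \<alpha>)) + scale (qpow (- 1) - 1) (T (refl \<alpha>)) = 1"
    by (simp add: T_quadratic[OF assms] scale_right_distrib scale_left_diff_distrib right_diff_distrib
        scale_right_diff_distrib qpow_add qpow_0)
  then show "T_inv \<alpha> * T (refl \<alpha>) = 1" "T (refl \<alpha>) * T_inv \<alpha> = 1"
    unfolding T_inv_def by (simp_all add: distrib_left distrib_right scale_mult_left scale_mult_right)
qed

lemma T_simple_mult:
  assumes "u \<in> weyl D" "\<alpha> \<in> simple_roots D" "len u < len (refl \<alpha> \<circ> u)"
  shows "T (refl \<alpha>) * T u = T (refl \<alpha> \<circ> u)"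
proof (rule T_mult)
  have "inv u \<alpha> \<in> pos D" using assms length_refl_greater_iff simple_pos by blast
  then show "len (refl \<alpha> \<circ> u) = len (refl \<alpha>) + len u"
    using length_simple_up assms by (simp add: length_simple)
qed (use assms refl_weyl simple_root in auto)

text \<open>If su < u, then T_u is the product of T_s and T_su, and the first factor cancels;
  otherwise the inverse is expanded.\<close>

lemma T_inv_mult:
  assumes u: "u \<in> weyl D" and a: "\<alpha> \<in> simple_roots D"
  shows "T_inv \<alpha> * T u = (if len (refl \<alpha> \<circ> u) < len u then T (refl \<alpha> \<circ> u)
    else scale (qpow (- 1)) (T (refl \<alpha> \<circ> u)) + scale (qpow (- 1) - 1) (T u))"
proof (cases "len (refl \<alpha> \<circ> u) < len u")
  case True
  have ar: "\<alpha> \<in> roots D" using a by (rule simple_root)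
  have "T (refl \<alpha>) * T (refl \<alpha> \<circ> u) = T u"
    using T_simple_mult[of "refl \<alpha> \<circ> u" \<alpha>] u ar a True by (simp add: refl_comp_refl_comp weyl_refl)
  then have "T_inv \<alpha> * T u = (T_inv \<alpha> * T (refl \<alpha>)) * T (refl \<alpha> \<circ> u)" by (simp add: mult.assoc)
  then show ?thesis using True by (simp add: T_inv a)
next
  case False
  then have "len u < len (refl \<alpha> \<circ> u)" using not_less_simple u a by blast
  then have "T (refl \<alpha>) * T u = T (refl \<alpha> \<circ> u)" using T_simple_mult u a by blast
  then show ?thesis using False by (simp add: T_inv_def distrib_right scale_mult_left)
qed

text \<open>The bar and the factor q^(-l(u)) follow the defining expansion of the R-polynomials, so
  that R_{u,v} as a function of u is the coordinate function of the inverse of T_{v^{-1}}.\<close>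

definition hecke_elt :: "(('x \<Rightarrow> 'x) \<Rightarrow> int poly) \<Rightarrow> 'h" where
  "hecke_elt f = (\<Sum>u\<in>weyl D. scale (bar (f u) * qpow (- int (len u))) (T u))"

lemma bij_betw_refl_comp:
  assumes "\<alpha> \<in> roots D"
  shows "bij_betw (\<lambda>u. refl \<alpha> \<circ> u) (weyl D) (weyl D)"
  by (rule bij_betw_byWitness[where f' = "\<lambda>u. refl \<alpha> \<circ> u"])
     (use assms weyl_refl refl_comp_refl_comp in auto)

text \<open>Multiply each basis element by the inverse of T_s and reindex by u -> su, so that the
  two contributions to one T_u meet. The change of length in q^(-l(u)) together with the bar gives
  the coefficients of \<open>hecke_op\<close>.\<close>

lemma hecke_elt_op:
  assumes a: "\<alpha> \<in> simple_roots D"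
  shows "hecke_elt (hecke_op [:0, 1:] \<alpha> f) = T_inv \<alpha> * hecke_elt f"
proof -
  have ar: "\<alpha> \<in> roots D" using a by (rule simple_root)
  define c where "c u = bar (f u) * qpow (- int (len u))" for u
  \<comment> \<open>\<open>A u\<close> and \<open>B u\<close> are the coefficients of T_su and of
    T_u in the product with T_u.\<close>
  define A where "A u = (if len (refl \<alpha> \<circ> u) < len u then 1 else qpow (- 1))" for u
  define B where "B u = (if len (refl \<alpha> \<circ> u) < len u then 0 else qpow (- 1) - 1)" for u
  have "T_inv \<alpha> * hecke_elt f = (\<Sum>u\<in>weyl D. scale (c u) (T_inv \<alpha> * T u))"
    by (simp add: hecke_elt_def c_def sum_distrib_left scale_mult_right)
  also have "\<dots> = (\<Sum>u\<in>weyl D. scale (c u * A u) (T (refl \<alpha> \<circ> u)) + scale (c u * B u) (T u))"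
    by (rule sum.cong) (simp_all add: T_inv_mult a A_def B_def scale_right_distrib)
  also have "\<dots> = (\<Sum>u\<in>weyl D. scale (c u * A u) (T (refl \<alpha> \<circ> u))) + (\<Sum>u\<in>weyl D. scale (c u * B u) (T u))"
    by (rule sum.distrib)
  also have "(\<Sum>u\<in>weyl D. scale (c u * A u) (T (refl \<alpha> \<circ> u))) =
      (\<Sum>u\<in>weyl D. scale (c (refl \<alpha> \<circ> u) * A (refl \<alpha> \<circ> u)) (T (refl \<alpha> \<circ> (refl \<alpha> \<circ> u))))"
    by (rule sum.reindex_bij_betw[OF bij_betw_refl_comp[OF ar], symmetric])
  also have "\<dots> + (\<Sum>u\<in>weyl D. scale (c u * B u) (T u)) =
      (\<Sum>u\<in>weyl D. scale (c (refl \<alpha> \<circ> u) * A (refl \<alpha> \<circ> u) + c u * B u) (T u))"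
    by (simp add: refl_comp_refl_comp ar sum.distrib scale_left_distrib)
  also have "\<dots> = hecke_elt (hecke_op [:0, 1:] \<alpha> f)"
    unfolding hecke_elt_def
  proof (rule sum.cong[OF HOL.refl])
    fix u assume u: "u \<in> weyl D"
    have su: "refl \<alpha> \<circ> u \<in> weyl D" using u ar by (simp add: weyl_refl)
    have "c (refl \<alpha> \<circ> u) * A (refl \<alpha> \<circ> u) + c u * B u =
        bar (hecke_op [:0, 1:] \<alpha> f u) * qpow (- int (len u))"
    proof (cases "len (refl \<alpha> \<circ> u) < len u")
      case True
      then have "inv u \<alpha> \<notin> pos D" using length_refl_less_iff[OF u simple_pos[OF a]] by simp
      then have l: "len u = Suc (len (refl \<alpha> \<circ> u))" using length_simple_down[OF u a] by simp
      have "c (refl \<alpha> \<circ> u) * qpow (- 1) = bar (f (refl \<alpha> \<circ> u)) * qpow (- int (len u))"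
        by (simp add: c_def mult.assoc qpow_add l add.commute del: comp_apply)
      then show ?thesis
        using True u by (simp add: A_def B_def refl_comp_refl_comp ar hecke_op_def del: comp_apply)
    next
      case False
      then have lt: "len u < len (refl \<alpha> \<circ> u)" using not_less_simple u a by blast
      then have "inv u \<alpha> \<in> pos D" using length_refl_greater_iff[OF u simple_pos[OF a]] by simp
      then have l: "len (refl \<alpha> \<circ> u) = Suc (len u)" using length_simple_up[OF u a] by simp
      have c: "c (refl \<alpha> \<circ> u) = bar (f (refl \<alpha> \<circ> u)) * (qpow (- 1) * qpow (- int (len u)))"
        by (simp add: c_def qpow_add l del: comp_apply)
      have "bar (([:0, 1:] - 1) * f u + [:0, 1:] * f (refl \<alpha> \<circ> u)) =
          (qpow (- 1) - 1) * bar (f u) + qpow (- 1) * bar (f (refl \<alpha> \<circ> u))"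
        by (simp only: bar_add bar_diff left_diff_distrib bar_shift mult_1_left)
      then have "bar (hecke_op [:0, 1:] \<alpha> f u) =
          (qpow (- 1) - 1) * bar (f u) + qpow (- 1) * bar (f (refl \<alpha> \<circ> u))"
        using False u by (simp add: hecke_op_def del: comp_apply)
      then show ?thesis
        using lt by (simp only: A_def B_def refl_comp_refl_comp[OF ar] if_True False if_False c)
          (simp add: c_def algebra_simps)
    qed
    then show "scale (c (refl \<alpha> \<circ> u) * A (refl \<alpha> \<circ> u) + c u * B u) (T u) =
        scale (bar (hecke_op [:0, 1:] \<alpha> f u) * qpow (- int (len u))) (T u)" by simp
  qed
  finally show ?thesis by simp
qed

text \<open>The T_u are independent, powers of q are units in the Laurent polynomials, and
  \<open>bar\<close> is injective.\<close>

lemma hecke_elt_inj: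
  assumes "hecke_elt f = hecke_elt g" "u \<in> weyl D"
  shows "f u = g u"
proof -
  define c where "c u = bar (f u - g u) * qpow (- int (len u))" for u
  have "(\<Sum>u\<in>weyl D. scale (c u) (T u)) = hecke_elt f - hecke_elt g"
    unfolding hecke_elt_def c_def
    by (simp add: bar_diff left_diff_distrib scale_left_diff_distrib sum_subtractf)
  then have "(\<Sum>u\<in>weyl D. scale (c u) (T u)) = 0" using assms(1) by simp
  moreover have "(\<Sum>x\<in>T ` weyl D. scale (c (the_inv_into (weyl D) T x)) x) = (\<Sum>u\<in>weyl D. scale (c u) (T u))"
    by (subst sum.reindex[OF T_inj]) (simp add: the_inv_into_f_f[OF T_inj])
  ultimately have "c (the_inv_into (weyl D) T (T u)) = 0"
    using independentD[OF T_independent finite_imageI[OF finite_weyl] subset_refl, of "\<lambda>x. c (the_inv_into (weyl D) T x)" "T u"]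
      assms(2) by simp
  then have "c u = 0" using assms(2) by (simp add: the_inv_into_f_f[OF T_inj])
  then have "bar (f u - g u) * qpow (- int (len u)) * qpow (int (len u)) = 0" by (simp add: c_def)
  then have "bar (f u - g u) = 0" by (simp add: mult.assoc qpow_add qpow_0)
  then show ?thesis using bar_eq_0 by fastforce
qed

definition T_invs :: "'x list \<Rightarrow> 'h" where
  "T_invs as = foldr (\<lambda>a x. T_inv a * x) as 1"

lemma T_invs_simps [simp]: "T_invs [] = 1" "T_invs (a # as) = T_inv a * T_invs as"
  by (simp_all add: T_invs_def)

lemma hecke_elt_ops:
  "set as \<subseteq> simple_roots D \<Longrightarrow> hecke_elt (hecke_ops [:0, 1:] as f) = T_invs as * hecke_elt f"
  by (induction as) (simp_all add: hecke_elt_op mult.assoc)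

text \<open>Lengths add along a reduced word, so T of the inverse element is the product of the T_s
  in reverse order; the factors cancel from the inside outwards.\<close>

lemma T_invs_inverse:
  assumes "reduced_word as"
  shows "two_sided_inverse (T (inv (word as))) (T_invs as)"
  using assms
proof (induction as)
  case Nil
  then show ?case by (simp add: two_sided_inverse_def T_id del: id_apply)
next
  case (Cons a as)
  then have a: "a \<in> simple_roots D" and as: "reduced_word as" by (auto simp: reduced_word_Cons)
  then have IH: "T (inv (word as)) * T_invs as = 1" "T_invs as * T (inv (word as)) = 1"
    using Cons.IH by (auto simp: two_sided_inverse_def)
  have w: "word as \<in> weyl D" using as by (rule reduced_word_weyl)
  have ar: "a \<in> roots D" using a by (rule simple_root)
  have i: "inv (word (a # as)) = inv (word as) \<circ> refl a"
    using inv_refl_comp[OF ar w] by simp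
  have "len (inv (word (a # as))) = Suc (length as)"
    using length_inv[OF reduced_word_weyl[OF Cons.prems]] Cons.prems by (simp add: reduced_word_def)
  then have "T (inv (word as)) * T (refl a) = T (inv (word (a # as)))"
    unfolding i using as
    by (intro T_mult) (auto simp: weyl_inv w refl_weyl ar length_inv length_simple a reduced_word_def simp del: comp_apply)
  then have e: "T (inv (word (a # as))) = T (inv (word as)) * T (refl a)" by simp
  have "T (inv (word as)) * T (refl a) * (T_inv a * T_invs as) = T (inv (word as)) * (T (refl a) * T_inv a) * T_invs as"
    by (simp only: mult.assoc)
  moreover have "T_inv a * T_invs as * (T (inv (word as)) * T (refl a)) = T_inv a * (T_invs as * T (inv (word as))) * T (refl a)"
    by (simp only: mult.assoc)
  ultimately show ?case by (simp add: two_sided_inverse_def e IH T_inv a del: word_Cons)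
qed

lemma two_sided_inverse_unique: "two_sided_inverse x y \<Longrightarrow> two_sided_inverse x y' \<Longrightarrow> y = (y'::'h)"
  unfolding two_sided_inverse_def by (metis mult.assoc mult_1_left mult_1_right)

lemma hecke_elt_delta_id: "hecke_elt (delta id) = 1"
proof -
  have "hecke_elt (delta id) = (\<Sum>u\<in>weyl D. if u = id then 1 else 0)"
    unfolding hecke_elt_def
    by (rule sum.cong) (auto simp: delta_def bar_0 bar_1 length_id qpow_0 T_id)
  also have "\<dots> = 1" using finite_weyl weyl_id by simp
  finally show ?thesis .
qed

text \<open>Inverses and coordinates are unique, so the undeformed operators of any reduced word
  compute the R-polynomials.\<close>

lemma R_polynomials_hecke_ops:
  assumes R: "R_polynomials D scale T R" and as: "reduced_word as" and u: "u \<in> weyl D"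
  shows "R u (word as) = hecke_ops [:0, 1:] as (delta id) u"
proof -
  have w: "word as \<in> weyl D" using as by (rule reduced_word_weyl)
  have "hecke_elt (\<lambda>u. R u (word as)) =
      (\<Sum>u\<in>{u \<in> weyl D. bruhat u (word as)}. scale (bar (R u (word as)) * qpow (- int (len u))) (T u))"
    unfolding hecke_elt_def
    by (rule sum.mono_neutral_right) (use R w in \<open>auto simp: finite_weyl R_polynomials_def bar_0\<close>)
  then have "two_sided_inverse (T (inv (word as))) (hecke_elt (\<lambda>u. R u (word as)))"
    using R w by (simp add: R_polynomials_def)
  then have "hecke_elt (\<lambda>u. R u (word as)) = T_invs as"
    using T_invs_inverse[OF as] two_sided_inverse_unique by blast
  also have "\<dots> = hecke_elt (hecke_ops [:0, 1:] as (delta id))"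
    using hecke_elt_ops[OF reduced_word_simple[OF as]] by (simp add: hecke_elt_delta_id)
  finally show ?thesis by (rule hecke_elt_inj[of "\<lambda>u. R u (word as)", OF _ u])
qed

text \<open>This is the source of the braid relations: both products of inverses invert the same
  T_{v^{-1}}, hence they are equal.\<close>

lemma hecke_ops_int_cong:
  assumes "reduced_word as" "reduced_word bs" "word as = word bs" "u \<in> weyl D"
  shows "hecke_ops [:0, 1:] as f u = hecke_ops [:0, 1::int:] bs f u"
proof -
  have "T_invs as = T_invs bs"
    using T_invs_inverse[OF assms(1)] T_invs_inverse[OF assms(2)] assms(3) two_sided_inverse_unique by metis
  then have "hecke_elt (hecke_ops [:0, 1:] as f) = hecke_elt (hecke_ops [:0, 1:] bs f)"
    using hecke_elt_ops assms(1,2) reduced_word_simple by metis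
  then show ?thesis using hecke_elt_inj assms(4) by blast
qed

definition cpoly :: "int poly \<Rightarrow> complex poly" where
  "cpoly = map_poly of_int"

lemma coeff_cpoly: "coeff (cpoly p) i = of_int (coeff p i)"
  by (simp add: cpoly_def coeff_map_poly)

lemma cpoly_simps:
  "cpoly 0 = 0" "cpoly (p + r) = cpoly p + cpoly r"
  "cpoly ([:0, 1:] * p) = [:0, 1:] * cpoly p" "cpoly (([:0, 1:] - 1) * p) = ([:0, 1:] - 1) * cpoly p"
  by (rule poly_eqI; simp add: coeff_cpoly coeff_pCons left_diff_distrib split: nat.split)+

lemma cpoly_delta: "(\<lambda>u. cpoly (delta w u)) = delta w"
  by (auto simp: delta_def fun_eq_iff poly_eq_iff coeff_cpoly)

lemma cpoly_hecke_ops: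
  "cpoly (hecke_ops [:0, 1:] as (delta w) u) = hecke_ops [:0, 1:] as (delta w) u"
proof -
  have "cpoly (hecke_ops [:0, 1:] as (delta w) u) = hecke_ops [:0, 1:] as (\<lambda>u. cpoly (delta w u)) u"
    by (rule hecke_ops_hom) (rule cpoly_simps)+
  then show ?thesis unfolding cpoly_delta .
qed

text \<open>The Hecke algebra gives the braid relations over \<open>\<int>[q]\<close>; by linearity over the functions
  \<open>delta w\<close> they extend to \<open>\<complex>[q]\<close>.\<close>

lemma hecke_ops_braid:
  assumes "reduced_word as" "reduced_word bs" "word as = word bs" and f: "f \<in> weyl_supported"
  shows "hecke_ops [:0, 1:] as f = hecke_ops [:0, 1::complex:] bs f"
proof
  fix u
  show "hecke_ops [:0, 1:] as f u = hecke_ops [:0, 1:] bs f u"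
  proof (cases "u \<in> weyl D")
    case True
    have "hecke_ops [:0, 1:] as (delta w) u = hecke_ops [:0, 1::complex:] bs (delta w) u" for w
      unfolding cpoly_hecke_ops[symmetric] using hecke_ops_int_cong[OF assms(1-3) True] by metis
    then show ?thesis unfolding hecke_ops_expand[OF f] by simp
  next
    case False
    then show ?thesis using hecke_ops_supported[OF f] by (simp add: weyl_supported_def)
  qed
qed

end


section \<open>Braid relations of the Weyl group\<close>

context based_root_datum
begin

definition comb :: "'x \<Rightarrow> 'x \<Rightarrow> int \<Rightarrow> int \<Rightarrow> 'x" where
  "comb a b i j = zmul i a + zmul j b"

lemma comb_basis: "comb a b 1 0 = a" "comb a b 0 1 = b" "comb a b (- 1) 0 = - a" "comb a b 0 (- 1) = - b"
  by (simp_all add: comb_def zmod.scale_minus_left)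

text \<open>The base point x is carried along because a and b do not span the lattice: the
  reflections act on the coset of x modulo the sublattice of a and b, and a braid relation has to
  hold on every such coset.\<close>

lemma refl_shift_comb:
  assumes "a \<in> roots D" "b \<in> roots D"
  shows "refl a (x + comb a b i j) = x + comb a b (- i - pair a x - pair a b * j) j"
    and "refl b (x + comb a b i j) = x + comb a b i (- j - pair b x - pair b a * i)"
proof -
  have z: "zmul (- i - r - m * j) y = zmul i y - zmul (r + (i * 2 + j * m)) y" for i j m r and y :: 'x
    unfolding zmod.scale_left_diff_distrib[symmetric]
    by (rule arg_cong[where f = "\<lambda>k. zmul k y"]) (simp add: algebra_simps)
  show "refl a (x + comb a b i j) = x + comb a b (- i - pair a x - pair a b * j) j"
    unfolding root_refl_def comb_def z by (simp add: pair_simps coroot_self assms)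
  show "refl b (x + comb a b i j) = x + comb a b i (- j - pair b x - pair b a * i)"
    unfolding root_refl_def comb_def z by (simp add: pair_simps coroot_self assms add.commute[of "j * 2"])
qed

lemma refl_comb:
  assumes "a \<in> roots D" "b \<in> roots D"
  shows "refl a (comb a b i j) = comb a b (- i - pair a b * j) j"
    and "refl b (comb a b i j) = comb a b i (- j - pair b a * i)"
  using refl_shift_comb[OF assms, of 0 i j] assms by (simp_all add: pair_simps)

lemma inv_word_Cons:
  assumes "c \<in> roots D" "reduced_word as"
  shows "inv (word (c # as)) x = inv (word as) (refl c x)"
  using inv_refl_comp[OF assms(1) reduced_word_weyl[OF assms(2)]] by simp

text \<open>A nonzero combination of positive roots with nonnegative coefficients has positive
  height, so it is positive as soon as it is a root.\<close>

lemma reduced_word_Cons_comb: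
  assumes as: "reduced_word as" and c: "c \<in> simple_roots D"
    and e: "inv (word as) c = comb A B i j" and AB: "A \<in> pos D" "B \<in> pos D"
    and ij: "0 \<le> i" "0 \<le> j" "0 < i + j"
  shows "reduced_word (c # as)"
proof -
  have "comb A B i j \<in> roots D"
    unfolding e[symmetric] using weyl_root weyl_inv reduced_word_weyl as simple_root c by blast
  moreover have "height (comb A B i j) > 0"
  proof -
    have "0 < height A" "0 < height B" using AB by (auto simp: pos_iff)
    then have "0 \<le> of_int i * height A" "0 \<le> of_int j * height B" "0 < of_int i * height A \<or> 0 < of_int j * height B"
      using ij by (auto simp: zero_less_mult_iff)
    then show ?thesis by (auto simp: comb_def height_simps)
  qed
  ultimately have "comb A B i j \<in> pos D" by (simp add: pos_iff)
  then show ?thesis using as c e by (simp add: reduced_word_Cons)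
qed

text \<open>These are the reduced words of elements that are shortest in their coset under left
  multiplication by the dihedral group of a and b.\<close>

definition up_from :: "'x \<Rightarrow> 'x \<Rightarrow> 'x list \<Rightarrow> bool" where
  "up_from a b as \<longleftrightarrow> reduced_word as \<and> inv (word as) a \<in> pos D \<and> inv (word as) b \<in> pos D"

lemma up_from_comb:
  assumes "up_from a b as"
  shows "inv (word as) (comb a b i j) = comb (inv (word as) a) (inv (word as) b) i j"
proof -
  have "inv (word as) \<in> weyl D" using assms reduced_word_weyl weyl_inv by (simp add: up_from_def)
  then show ?thesis by (simp add: comb_def weyl_simps)
qed

lemma up_from_swap: "up_from a b as \<longleftrightarrow> up_from b a as"
  by (auto simp: up_from_def)

text \<open>The facts that an exchange of two first letters uses. In the last clause
  \<open>word (alt a b k)\<close> is the longest element of the dihedral group: it makes a and b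
  negative, so removing it from a v that descends along both leaves an element of the kind described
  by \<open>up_from\<close>.\<close>

definition braid_relation :: "'x \<Rightarrow> 'x \<Rightarrow> nat \<Rightarrow> bool" where
  "braid_relation a b k \<longleftrightarrow> 0 < k \<and> word (alt a b k) = word (alt b a k) \<and>
     (\<forall>as. up_from a b as \<longrightarrow> reduced_word (alt a b k @ as) \<and> reduced_word (alt b a k @ as)) \<and>
     (\<forall>v\<in>weyl D. inv v a \<notin> pos D \<longrightarrow> inv v b \<notin> pos D \<longrightarrow>
        inv v (word (alt a b k) a) \<in> pos D \<and> inv v (word (alt a b k) b) \<in> pos D)"

lemma braid_relation_swap:
  assumes "braid_relation a b k"
  shows "braid_relation b a k"
proof -
  have w: "word (alt b a k) = word (alt a b k)" using assms by (simp add: braid_relation_def)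
  show ?thesis using assms unfolding braid_relation_def up_from_swap[of b a] w by blast
qed

lemma neg_simple_pos: "v \<in> weyl D \<Longrightarrow> c \<in> simple_roots D \<Longrightarrow> inv v c \<notin> pos D \<Longrightarrow> inv v (- c) \<in> pos D"
  by (simp add: weyl_simps weyl_inv uminus_pos_iff weyl_root simple_root)

text \<open>The steps of the two alternating words over a common lower word: \<open>A\<close>, \<open>B\<close> are the images of
  \<open>a\<close>, \<open>b\<close>, and the pair \<open>(i, j)\<close> stands for the positive root \<open>i A + j B\<close>.\<close>

lemma chain_2:
  assumes a: "a \<in> simple_roots D" and b: "b \<in> simple_roots D" and p: "pair a b = 0" "pair b a = 0"
    and up: "up_from a b as"
  defines "A \<equiv> inv (word as) a" and "B \<equiv> inv (word as) b"
  shows "reduced_word (a # as)" "inv (word as) a = comb A B 1 0"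
    and "reduced_word (b # a # as)" "inv (word (a # as)) b = comb A B 0 1"
proof -
  have ab: "a \<in> roots D" "b \<in> roots D" using a b simple_root by auto
  have r0: "reduced_word as" and AB: "A \<in> pos D" "B \<in> pos D" using up by (auto simp: up_from_def A_def B_def)
  have e: "inv (word as) (comb a b i j) = comb A B i j" for i j
    using up_from_comb[OF up] by (simp add: A_def B_def)
  show e0: "inv (word as) a = comb A B 1 0" using e[of 1 0] by (simp add: comb_basis)
  show r1: "reduced_word (a # as)" by (rule reduced_word_Cons_comb[OF r0 a e0 AB]) simp_all
  have e: "inv (word (a # as)) (comb a b i j) = comb A B (- i) j" for i j
    unfolding inv_word_Cons[OF ab(1) r0] refl_comb[OF ab] e by (simp add: p)
  show e1: "inv (word (a # as)) b = comb A B 0 1" using e[of 0 1] by (simp add: comb_basis)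
  show r2: "reduced_word (b # a # as)" by (rule reduced_word_Cons_comb[OF r1 b e1 AB]) simp_all
qed

lemma chain_3:
  assumes a: "a \<in> simple_roots D" and b: "b \<in> simple_roots D" and p: "pair a b = - 1" "pair b a = - 1"
    and up: "up_from a b as"
  defines "A \<equiv> inv (word as) a" and "B \<equiv> inv (word as) b"
  shows "reduced_word (a # as)" "inv (word as) a = comb A B 1 0"
    and "reduced_word (b # a # as)" "inv (word (a # as)) b = comb A B 1 1"
    and "reduced_word (a # b # a # as)" "inv (word (b # a # as)) a = comb A B 0 1"
proof -
  have ab: "a \<in> roots D" "b \<in> roots D" using a b simple_root by auto
  have r0: "reduced_word as" and AB: "A \<in> pos D" "B \<in> pos D" using up by (auto simp: up_from_def A_def B_def)
  have e: "inv (word as) (comb a b i j) = comb A B i j" for i j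
    using up_from_comb[OF up] by (simp add: A_def B_def)
  show e0: "inv (word as) a = comb A B 1 0" using e[of 1 0] by (simp add: comb_basis)
  show r1: "reduced_word (a # as)" by (rule reduced_word_Cons_comb[OF r0 a e0 AB]) simp_all
  have e: "inv (word (a # as)) (comb a b i j) = comb A B (j - i) j" for i j
    unfolding inv_word_Cons[OF ab(1) r0] refl_comb[OF ab] e by (simp add: p)
  show e1: "inv (word (a # as)) b = comb A B 1 1" using e[of 0 1] by (simp add: comb_basis)
  show r2: "reduced_word (b # a # as)" by (rule reduced_word_Cons_comb[OF r1 b e1 AB]) simp_all
  have e: "inv (word (b # a # as)) (comb a b i j) = comb A B (- j) (i - j)" for i j
    unfolding inv_word_Cons[OF ab(2) r1] refl_comb[OF ab] e by (simp add: p)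
  show e2: "inv (word (b # a # as)) a = comb A B 0 1" using e[of 1 0] by (simp add: comb_basis)
  show r3: "reduced_word (a # b # a # as)" by (rule reduced_word_Cons_comb[OF r2 a e2 AB]) simp_all
qed

text \<open>Only m n = 2 is fixed, so that one computation serves the short and the long root as
  first letter; m \<ge> 0 rules out the negative factorizations.\<close>

lemma chain_4:
  assumes a: "a \<in> simple_roots D" and b: "b \<in> simple_roots D" and p: "pair a b = - m" "pair b a = - n"
    and mn: "m * n = 2" "0 \<le> m"
    and up: "up_from a b as"
  defines "A \<equiv> inv (word as) a" and "B \<equiv> inv (word as) b"
  shows "reduced_word (a # as)" "inv (word as) a = comb A B 1 0"
    and "reduced_word (b # a # as)" "inv (word (a # as)) b = comb A B m 1"
    and "reduced_word (a # b # a # as)" "inv (word (b # a # as)) a = comb A B 1 n"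
    and "reduced_word (b # a # b # a # as)" "inv (word (a # b # a # as)) b = comb A B 0 1"
proof -
  have ab: "a \<in> roots D" "b \<in> roots D" using a b simple_root by auto
  have "0 < m * n" using mn by simp
  then have mpos: "m > 0" "n > 0" using mn(2) by (auto simp: zero_less_mult_iff)
  have r0: "reduced_word as" and AB: "A \<in> pos D" "B \<in> pos D" using up by (auto simp: up_from_def A_def B_def)
  have e: "inv (word as) (comb a b i j) = comb A B i j" for i j
    using up_from_comb[OF up] by (simp add: A_def B_def)
  show e0: "inv (word as) a = comb A B 1 0" using e[of 1 0] by (simp add: comb_basis)
  show r1: "reduced_word (a # as)" by (rule reduced_word_Cons_comb[OF r0 a e0 AB]) simp_all
  have e: "inv (word (a # as)) (comb a b i j) = comb A B (m * j - i) j" for i j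
    unfolding inv_word_Cons[OF ab(1) r0] refl_comb[OF ab] e by (simp add: p)
  show e1: "inv (word (a # as)) b = comb A B m 1" using e[of 0 1] by (simp add: comb_basis)
  show r2: "reduced_word (b # a # as)" by (rule reduced_word_Cons_comb[OF r1 b e1 AB]) (use mpos in simp_all)
  have e: "inv (word (b # a # as)) (comb a b i j) = comb A B (i - m * j) (n * i - j)" for i j
    unfolding inv_word_Cons[OF ab(2) r1] refl_comb[OF ab] e
    using mn(1) by (simp add: p right_diff_distrib flip: mult.assoc)
  show e2: "inv (word (b # a # as)) a = comb A B 1 n" using e[of 1 0] by (simp add: comb_basis)
  show r3: "reduced_word (a # b # a # as)" by (rule reduced_word_Cons_comb[OF r2 a e2 AB]) (use mpos in simp_all)
  have e: "inv (word (a # b # a # as)) (comb a b i j) = comb A B (- i) (j - n * i)" for i j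
    unfolding inv_word_Cons[OF ab(1) r2] refl_comb[OF ab] e
    using mn(1) by (simp add: p right_diff_distrib distrib_left mult.commute[of n m] flip: mult.assoc)
  show e3: "inv (word (a # b # a # as)) b = comb A B 0 1" using e[of 0 1] by (simp add: comb_basis)
  show r4: "reduced_word (b # a # b # a # as)" by (rule reduced_word_Cons_comb[OF r3 b e3 AB]) simp_all
qed

text \<open>Type G2. Fixing only m n = 3 again covers both choices of the first letter.\<close>

lemma chain_6:
  assumes a: "a \<in> simple_roots D" and b: "b \<in> simple_roots D" and p: "pair a b = - m" "pair b a = - n"
    and mn: "m * n = 3" "0 \<le> m"
    and up: "up_from a b as"
  defines "A \<equiv> inv (word as) a" and "B \<equiv> inv (word as) b"
  shows "reduced_word (a # as)" "inv (word as) a = comb A B 1 0"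
    and "reduced_word (b # a # as)" "inv (word (a # as)) b = comb A B m 1"
    and "reduced_word (a # b # a # as)" "inv (word (b # a # as)) a = comb A B 2 n"
    and "reduced_word (b # a # b # a # as)" "inv (word (a # b # a # as)) b = comb A B m 2"
    and "reduced_word (a # b # a # b # a # as)" "inv (word (b # a # b # a # as)) a = comb A B 1 n"
    and "reduced_word (b # a # b # a # b # a # as)" "inv (word (a # b # a # b # a # as)) b = comb A B 0 1"
proof -
  have ab: "a \<in> roots D" "b \<in> roots D" using a b simple_root by auto
  have "0 < m * n" using mn by simp
  then have mpos: "m > 0" "n > 0" using mn(2) by (auto simp: zero_less_mult_iff)
  have mn': "m * (n * i) = 3 * i" "n * (m * i) = 3 * i" for i
    using mn(1) by (simp_all add: mult.commute[of n m] flip: mult.assoc)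
  have r0: "reduced_word as" and AB: "A \<in> pos D" "B \<in> pos D" using up by (auto simp: up_from_def A_def B_def)
  have e: "inv (word as) (comb a b i j) = comb A B i j" for i j
    using up_from_comb[OF up] by (simp add: A_def B_def)
  show e0: "inv (word as) a = comb A B 1 0" using e[of 1 0] by (simp add: comb_basis)
  show r1: "reduced_word (a # as)" by (rule reduced_word_Cons_comb[OF r0 a e0 AB]) simp_all
  have e: "inv (word (a # as)) (comb a b i j) = comb A B (m * j - i) j" for i j
    unfolding inv_word_Cons[OF ab(1) r0] refl_comb[OF ab] e by (simp add: p)
  show e1: "inv (word (a # as)) b = comb A B m 1" using e[of 0 1] by (simp add: comb_basis)
  show r2: "reduced_word (b # a # as)" by (rule reduced_word_Cons_comb[OF r1 b e1 AB]) (use mpos in simp_all)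
  have e: "inv (word (b # a # as)) (comb a b i j) = comb A B (2 * i - m * j) (n * i - j)" for i j
    unfolding inv_word_Cons[OF ab(2) r1] refl_comb[OF ab] e
    by (simp add: p right_diff_distrib distrib_left mn')
  show e2: "inv (word (b # a # as)) a = comb A B 2 n" using e[of 1 0] by (simp add: comb_basis)
  show r3: "reduced_word (a # b # a # as)" by (rule reduced_word_Cons_comb[OF r2 a e2 AB]) (use mpos in simp_all)
  have e: "inv (word (a # b # a # as)) (comb a b i j) = comb A B (m * j - 2 * i) (2 * j - n * i)" for i j
    unfolding inv_word_Cons[OF ab(1) r2] refl_comb[OF ab] e
    by (simp add: p right_diff_distrib distrib_left mn' mult.commute[of j m])
  show e3: "inv (word (a # b # a # as)) b = comb A B m 2" using e[of 0 1] by (simp add: comb_basis)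
  show r4: "reduced_word (b # a # b # a # as)" by (rule reduced_word_Cons_comb[OF r3 b e3 AB]) (use mpos in simp_all)
  have e: "inv (word (b # a # b # a # as)) (comb a b i j) = comb A B (i - m * j) (n * i - 2 * j)" for i j
    unfolding inv_word_Cons[OF ab(2) r3] refl_comb[OF ab] e
    by (simp add: p right_diff_distrib distrib_left mn' mult.commute[of i n])
  show e4: "inv (word (b # a # b # a # as)) a = comb A B 1 n" using e[of 1 0] by (simp add: comb_basis)
  show r5: "reduced_word (a # b # a # b # a # as)" by (rule reduced_word_Cons_comb[OF r4 a e4 AB]) (use mpos in simp_all)
  have e: "inv (word (a # b # a # b # a # as)) (comb a b i j) = comb A B (- i) (j - n * i)" for i j
    unfolding inv_word_Cons[OF ab(1) r4] refl_comb[OF ab] e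
    by (simp add: p right_diff_distrib distrib_left mn' mult.commute[of i n])
  show e5: "inv (word (a # b # a # b # a # as)) b = comb A B 0 1" using e[of 0 1] by (simp add: comb_basis)
  show r6: "reduced_word (b # a # b # a # b # a # as)" by (rule reduced_word_Cons_comb[OF r5 b e5 AB]) simp_all
qed

lemma comb_swap: "comb a b i j = comb b a j i"
  by (simp add: comb_def add.commute)

lemma braid_relation_2:
  assumes a: "a \<in> simple_roots D" and b: "b \<in> simple_roots D" and p: "pair a b = 0" "pair b a = 0"
  shows "braid_relation a b 2"
proof -
  have ab: "a \<in> roots D" "b \<in> roots D" using a b simple_root by auto
  \<comment> \<open>The zero combination brings x into the shape required by
    \<open>refl_shift_comb\<close>.\<close>
  have "word (alt a b 2) (x + comb a b 0 0) = word (alt b a 2) (x + comb a b 0 0)" for x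
    by (simp add: alt_num refl_shift_comb[OF ab] p)
  then have "word (alt a b 2) = word (alt b a 2)" by (simp add: comb_def fun_eq_iff)
  moreover have "word (alt a b 2) (comb a b i j) = comb a b (- i) (- j)" for i j
    by (simp add: alt_num refl_comb[OF ab] p)
  from this[of 1 0] this[of 0 1]
  have "word (alt a b 2) a = - a" "word (alt a b 2) b = - b" by (simp_all add: comb_basis)
  ultimately show ?thesis
    unfolding braid_relation_def
    using chain_2[OF a b p] chain_2[OF b a p(2,1)] up_from_swap[of a b] neg_simple_pos a b
    by (simp add: alt_num del: word_Cons)
qed

text \<open>Here the longest element exchanges a and b up to sign, while in the other three types it
  is -1 on their span; in either case it makes both negative.\<close>

lemma braid_relation_3:
  assumes a: "a \<in> simple_roots D" and b: "b \<in> simple_roots D" and p: "pair a b = - 1" "pair b a = - 1"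
  shows "braid_relation a b 3"
proof -
  have ab: "a \<in> roots D" "b \<in> roots D" using a b simple_root by auto
  have "word (alt a b 3) (x + comb a b 0 0) = word (alt b a 3) (x + comb a b 0 0)" for x
    by (simp add: alt_num refl_shift_comb[OF ab] p algebra_simps minus_diff_commute[of "pair b x" "pair a x"])
  then have "word (alt a b 3) = word (alt b a 3)" by (simp add: comb_def fun_eq_iff)
  moreover have "word (alt a b 3) (comb a b i j) = comb a b (- j) (- i)" for i j
    by (simp add: alt_num refl_comb[OF ab] p algebra_simps)
  from this[of 1 0] this[of 0 1]
  have "word (alt a b 3) a = - b" "word (alt a b 3) b = - a" by (simp_all add: comb_basis)
  ultimately show ?thesis
    unfolding braid_relation_def
    using chain_3[OF a b p] chain_3[OF b a p(2,1)] up_from_swap[of a b] neg_simple_pos a b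
    by (simp add: alt_num del: word_Cons)
qed

lemma braid_relation_4:
  assumes a: "a \<in> simple_roots D" and b: "b \<in> simple_roots D" and p: "pair a b = - 1" "pair b a = - 2"
  shows "braid_relation a b 4"
proof -
  have ab: "a \<in> roots D" "b \<in> roots D" using a b simple_root by auto
  have "word (alt a b 4) (x + comb a b 0 0) = word (alt b a 4) (x + comb a b 0 0)" for x
    by (simp add: alt_num refl_shift_comb[OF ab] p algebra_simps)
  then have "word (alt a b 4) = word (alt b a 4)" by (simp add: comb_def fun_eq_iff)
  moreover have "word (alt a b 4) (comb a b i j) = comb a b (- i) (- j)" for i j
    by (simp add: alt_num refl_comb[OF ab] p algebra_simps)
  from this[of 1 0] this[of 0 1]
  have "word (alt a b 4) a = - a" "word (alt a b 4) b = - b" by (simp_all add: comb_basis)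
  ultimately show ?thesis
    unfolding braid_relation_def
    using chain_4[OF a b p] chain_4[OF b a p(2,1)] up_from_swap[of a b] neg_simple_pos a b
    by (simp add: alt_num del: word_Cons)
qed

lemma braid_relation_6:
  assumes a: "a \<in> simple_roots D" and b: "b \<in> simple_roots D" and p: "pair a b = - 1" "pair b a = - 3"
  shows "braid_relation a b 6"
proof -
  have ab: "a \<in> roots D" "b \<in> roots D" using a b simple_root by auto
  have "word (alt a b 6) (x + comb a b 0 0) = word (alt b a 6) (x + comb a b 0 0)" for x
    by (simp add: alt_num refl_shift_comb[OF ab] p algebra_simps)
  then have "word (alt a b 6) = word (alt b a 6)" by (simp add: comb_def fun_eq_iff)
  moreover have "word (alt a b 6) (comb a b i j) = comb a b (- i) (- j)" for i j
    by (simp add: alt_num refl_comb[OF ab] p algebra_simps)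
  from this[of 1 0] this[of 0 1]
  have "word (alt a b 6) a = - a" "word (alt a b 6) b = - b" by (simp_all add: comb_basis)
  ultimately show ?thesis
    unfolding braid_relation_def
    using chain_6[OF a b p] chain_6[OF b a p(2,1)] up_from_swap[of a b] neg_simple_pos a b
    by (simp add: alt_num del: word_Cons)
qed

text \<open>The rank two Cartan matrices: both pairings are nonpositive, they vanish together, and
  their product is at most 3.\<close>

lemma simple_pair_cases:
  assumes a: "a \<in> simple_roots D" and b: "b \<in> simple_roots D" and ne: "a \<noteq> b"
  shows "(pair a b, pair b a) \<in> {(0, 0), (-1, -1), (-1, -2), (-2, -1), (-1, -3), (-3, -1)}"
proof -
  have ab: "a \<in> roots D" "b \<in> roots D" using a b simple_root by auto
  define m n where "m = - pair a b" and "n = - pair b a"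
  have "b \<noteq> - a" using simple_pos[OF a] simple_pos[OF b] by (auto simp: pos_iff height_simps)
  then have le: "m * n \<le> 3" using pair_mult_le ab ne by (auto simp: m_def n_def)
  have nn: "0 \<le> m" "0 \<le> n" using simple_pair_nonpos a b ne by (auto simp: m_def n_def)
  have z: "m = 0 \<longleftrightarrow> n = 0" using pair_sgn(2) ab by (simp add: m_def n_def)
  have "(m, n) \<in> {(0, 0), (1, 1), (1, 2), (2, 1), (1, 3), (3, 1)}"
  proof (cases "m = 0")
    case False
    then have pos: "1 \<le> m" "1 \<le> n" using nn z by auto
    have "m \<le> m * n" "n \<le> m * n" using pos mult_left_mono[of 1 n m] mult_right_mono[of 1 m n] by auto
    then have "m \<le> 3" "n \<le> 3" using le by linarith+
    then have "m = 1 \<or> m = 2 \<or> m = 3" "n = 1 \<or> n = 2 \<or> n = 3" using pos by presburger+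
    then show ?thesis using le by auto
  qed (use z in simp)
  then show ?thesis by (auto simp: m_def n_def)
qed

end


section \<open>Rational functions on the torus\<close>

lemma torus_0: "z \<in> torus \<Longrightarrow> z 0 = 1"
proof -
  assume "z \<in> torus"
  then have "z 0 \<noteq> 0" "z (0 + 0) = z 0 * z 0" unfolding torus_def by blast+
  then show "z 0 = 1" by simp
qed

lemma torus_eval_superset:
  assumes "finite A" "Poly_Mapping.keys P \<subseteq> A"
  shows "torus_eval P z = (\<Sum>x\<in>A. Poly_Mapping.lookup P x * z x)"
  unfolding torus_eval_def by (rule sum.mono_neutral_left) (use assms in \<open>auto simp: in_keys_iff\<close>)

lemma torus_eval_0: "torus_eval 0 z = 0"
  by (simp add: torus_eval_def)

lemma torus_eval_add: "torus_eval (P + Q) z = torus_eval P z + torus_eval Q z"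
proof -
  define A where "A = Poly_Mapping.keys P \<union> Poly_Mapping.keys Q"
  have "finite A" "Poly_Mapping.keys P \<subseteq> A" "Poly_Mapping.keys Q \<subseteq> A" "Poly_Mapping.keys (P + Q) \<subseteq> A"
    using keys_add[of P Q] by (auto simp: A_def)
  then show ?thesis
    by (simp add: torus_eval_superset[of A] lookup_add distrib_right sum.distrib)
qed

lemma torus_eval_sum: "finite A \<Longrightarrow> torus_eval (\<Sum>x\<in>A. f x) z = (\<Sum>x\<in>A. torus_eval (f x) z)"
  by (induction A rule: finite_induct) (simp_all add: torus_eval_0 torus_eval_add)

lemma torus_eval_single: "torus_eval (Poly_Mapping.single x c) z = c * z x"
  by (simp add: torus_eval_def)

lemma poly_mapping_sum_single:
  "P = (\<Sum>x\<in>Poly_Mapping.keys P. Poly_Mapping.single x (Poly_Mapping.lookup P x))"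
  by (rule poly_mapping_eqI) (simp add: lookup_sum lookup_single when_def in_keys_iff)

text \<open>A point of the torus is multiplicative on the lattice, so evaluation respects products
  of monomials; both factors are expanded into these.\<close>

lemma torus_eval_mult:
  assumes "z \<in> torus"
  shows "torus_eval (P * Q) z = torus_eval P z * torus_eval Q z"
proof -
  have "torus_eval (Poly_Mapping.single x c * Poly_Mapping.single y d) z = (c * z x) * (d * z y)" for x y c d
    using assms by (simp add: mult_single torus_eval_single torus_def)
  then have "torus_eval ((\<Sum>x\<in>Poly_Mapping.keys P. Poly_Mapping.single x (Poly_Mapping.lookup P x)) *
      (\<Sum>x\<in>Poly_Mapping.keys Q. Poly_Mapping.single x (Poly_Mapping.lookup Q x))) z =
      torus_eval P z * torus_eval Q z"
    by (simp add: sum_product torus_eval_sum torus_eval_def[of P] torus_eval_def[of Q])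
  then show ?thesis by (simp flip: poly_mapping_sum_single)
qed

lemma torus_reg_torus: "z \<in> torus_reg D \<Longrightarrow> z \<in> torus"
  by (simp add: torus_reg_def)

lemma rational_on_const: "rational_on D (\<lambda>z. c)"
  unfolding rational_on_def
  by (rule exI[of _ "Poly_Mapping.single 0 c"], rule exI[of _ "Poly_Mapping.single 0 1"])
     (simp add: torus_eval_single torus_0 torus_reg_torus del: single_one)

lemma rational_on_add:
  assumes "rational_on D f" "rational_on D g"
  shows "rational_on D (\<lambda>z. f z + g z)"
proof -
  obtain P Q P' Q' where
    "\<forall>z\<in>torus_reg D. torus_eval Q z \<noteq> 0 \<and> f z = torus_eval P z / torus_eval Q z"
    "\<forall>z\<in>torus_reg D. torus_eval Q' z \<noteq> 0 \<and> g z = torus_eval P' z / torus_eval Q' z"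
    using assms unfolding rational_on_def by blast
  then have "\<forall>z\<in>torus_reg D. torus_eval (Q * Q') z \<noteq> 0 \<and>
      f z + g z = torus_eval (P * Q' + P' * Q) z / torus_eval (Q * Q') z"
    by (simp add: torus_eval_mult torus_eval_add torus_reg_torus add_frac_eq)
  then show ?thesis unfolding rational_on_def by blast
qed

lemma rational_on_mult:
  assumes "rational_on D f" "rational_on D g"
  shows "rational_on D (\<lambda>z. f z * g z)"
proof -
  obtain P Q P' Q' where
    "\<forall>z\<in>torus_reg D. torus_eval Q z \<noteq> 0 \<and> f z = torus_eval P z / torus_eval Q z"
    "\<forall>z\<in>torus_reg D. torus_eval Q' z \<noteq> 0 \<and> g z = torus_eval P' z / torus_eval Q' z"
    using assms unfolding rational_on_def by blast
  then have "\<forall>z\<in>torus_reg D. torus_eval (Q * Q') z \<noteq> 0 \<and>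
      f z * g z = torus_eval (P * P') z / torus_eval (Q * Q') z"
    by (simp add: torus_eval_mult torus_reg_torus)
  then show ?thesis unfolding rational_on_def by blast
qed

lemma rational_on_sum:
  assumes "\<And>i. i \<in> I \<Longrightarrow> rational_on D (f i)"
  shows "rational_on D (\<lambda>z. \<Sum>i\<in>I. f i z)"
  using assms
  by (induction I rule: infinite_finite_induct) (simp_all add: rational_on_const rational_on_add)

lemma rational_on_root:
  assumes "\<beta> \<in> roots D"
  shows "rational_on D (\<lambda>z. 1 / (1 - z \<beta>))"
proof -
  have "torus_eval (Poly_Mapping.single 0 1) z = 1"
    "torus_eval (Poly_Mapping.single 0 1 + Poly_Mapping.single \<beta> (- 1)) z = 1 - z \<beta>"
    if "z \<in> torus_reg D" for z
    using that by (simp_all add: torus_eval_add torus_eval_single torus_0 torus_reg_torus del: single_one)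
  moreover have "1 - z \<beta> \<noteq> 0" if "z \<in> torus_reg D" for z
    using that assms by (auto simp: torus_reg_def)
  ultimately show ?thesis
    unfolding rational_on_def by metis
qed

lemma rational_poly_on_const: "rational_poly_on D (\<lambda>z. p)"
  unfolding rational_poly_on_def by (auto simp: rational_on_const)

lemma rational_poly_on_add:
  assumes "rational_poly_on D f" "rational_poly_on D g"
  shows "rational_poly_on D (\<lambda>z. f z + g z)"
proof -
  obtain M N where "\<forall>z\<in>torus_reg D. degree (f z) \<le> M" "\<forall>z\<in>torus_reg D. degree (g z) \<le> N"
    using assms unfolding rational_poly_on_def by blast
  then have "\<forall>z\<in>torus_reg D. degree (f z + g z) \<le> max M N"
    by (meson degree_add_le max.coboundedI1 max.coboundedI2)
  then show ?thesis
    using assms unfolding rational_poly_on_def by (auto simp: rational_on_add)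
qed

lemma rational_poly_on_mult_const:
  assumes "rational_poly_on D f"
  shows "rational_poly_on D (\<lambda>z. p * f z)"
proof -
  obtain M where M: "\<forall>z\<in>torus_reg D. degree (f z) \<le> M"
    using assms unfolding rational_poly_on_def by blast
  have "\<forall>z\<in>torus_reg D. degree (p * f z) \<le> degree p + M"
    using M by (meson add_left_mono degree_mult_le order_trans)
  moreover have "rational_on D (\<lambda>z. coeff (p * f z) i)" for i
    unfolding coeff_mult
    by (intro rational_on_sum rational_on_mult rational_on_const)
       (use assms in \<open>simp add: rational_poly_on_def\<close>)
  ultimately show ?thesis unfolding rational_poly_on_def by blast
qed

lemma rational_poly_on_smult:
  assumes "rational_on D g" "rational_poly_on D f"
  shows "rational_poly_on D (\<lambda>z. smult (g z) (f z))"
proof -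
  obtain M where M: "\<forall>z\<in>torus_reg D. degree (f z) \<le> M"
    using assms unfolding rational_poly_on_def by blast
  have "\<forall>z\<in>torus_reg D. degree (smult (g z) (f z)) \<le> M"
    using M by (meson degree_smult_le order_trans)
  then show ?thesis
    using assms unfolding rational_poly_on_def by (auto simp: rational_on_mult)
qed

section \<open>The deformed R-polynomials\<close>

definition weight :: "complex \<Rightarrow> complex poly" where
  "weight x = smult (1 / (1 - x)) (1 - [:0, 1:])"

text \<open>With a = 1 - x and b = 1 - y this is 1/a + 1/b - 1 = (1 - x y) / (a b), multiplied by (1
  - q)^2. The three hypotheses keep the denominators away from zero.\<close>

lemma weight_mult:
  assumes "x \<noteq> 1" "y \<noteq> 1" "x * y \<noteq> 1"
  shows "weight x * weight y = weight (x * y) * (weight x + weight y - (1 - [:0, 1:]))"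
proof -
  define g where "g x = 1 / (1 - x)" for x :: complex
  define p :: "complex poly" where "p = 1 - [:0, 1:]"
  have inv: "1 / a + 1 / b - 1 = (1 - (1 - a) * (1 - b)) * (1 / a * (1 / b))" if "a \<noteq> 0" "b \<noteq> 0" for a b :: complex
    using that by (simp add: field_simps)
  have "g x + g y - 1 = (1 - x * y) * (g x * g y)"
    using inv[of "1 - x" "1 - y"] assms by (simp add: g_def)
  then have g: "g x * g y = g (x * y) * (g x + g y - 1)"
    using assms by (simp add: g_def)
  have w: "weight x = smult (g x) p" for x by (simp add: weight_def g_def p_def)
  have "weight x * weight y = smult (g x * g y) (p * p)" by (simp add: w mult.commute)
  also have "\<dots> = smult (g (x * y)) p * (smult (g x) p + smult (g y) p - p)"
    unfolding g by (simp add: algebra_simps smult_add_left smult_diff_left smult_add_right smult_diff_right)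
  finally show ?thesis by (simp add: w p_def)
qed

context based_root_datum
begin

text \<open>For v = \<open>refl a \<circ> word as\<close> the root in the scalar is -v^{-1} a, as in
  the recursion; the extra q - 1 of the case su > u sits inside \<open>hecke_op\<close>.\<close>

primrec psi :: "('x \<Rightarrow> complex) \<Rightarrow> 'x list \<Rightarrow> ('x \<Rightarrow> 'x) \<Rightarrow> complex poly" where
  "psi z [] = delta id"
| "psi z (a # as) = (\<lambda>u. hecke_op [:0, 1:] a (psi z as) u + weight (z (inv (word as) a)) * psi z as u)"

lemma psi_supported: "psi z as \<in> weyl_supported"
proof (induction as)
  case Nil
  show ?case unfolding psi.simps by (rule delta_supported) (rule weyl_id)
next
  case (Cons a as)
  then show ?case
    using hecke_op_supported[of "[:0, 1:]" a "psi z as"] by (simp add: weyl_supported_def)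
qed

text \<open>Suppose u is not below sw, where sw > w. Then u is not below w, and by the lifting
  property neither is su; so both values that enter the operator vanish.\<close>

lemma psi_bruhat:
  assumes "reduced_word as" "u \<in> weyl D" "\<not> bruhat u (word as)"
  shows "psi z as u = 0"
  using assms
proof (induction as arbitrary: u)
  case Nil
  then have "u \<noteq> id" using bruhat_self[of id] by (metis word_Nil)
  then show ?case by (simp add: delta_def del: id_apply)
next
  case (Cons a as)
  then have a: "a \<in> simple_roots D" and as: "reduced_word as" and p: "inv (word as) a \<in> pos D"
    by (auto simp: reduced_word_Cons)
  have ar: "a \<in> roots D" using a by (rule simple_root)
  have w: "word as \<in> weyl D" using as by (rule reduced_word_weyl)
  have le: "bruhat (word as) (refl a \<circ> word as)"
    using bruhat_refl_step ar length_refl_greater[OF w simple_pos[OF a] p] by blast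
  have nle: "\<not> bruhat u (refl a \<circ> word as)" using Cons.prems(3) unfolding word_Cons .
  have au: "refl a \<circ> u \<in> weyl D" using ar Cons.prems(2) by (simp add: weyl_refl)
  have "\<not> bruhat u (word as)" using nle le bruhat_trans by blast
  moreover have "\<not> bruhat (refl a \<circ> u) (word as)"
  proof
    assume "bruhat (refl a \<circ> u) (word as)"
    from bruhat_lift[OF this au a] show False
      unfolding refl_comp_refl_comp[OF ar] using nle le bruhat_trans by blast
  qed
  ultimately have "psi z as u = 0" "psi z as (refl a \<circ> u) = 0"
    using Cons.IH as Cons.prems(2) au by blast+
  then show ?case by (simp add: hecke_op_def del: comp_apply)
qed

text \<open>The new element v = sw is longer than w, so the old function vanishes at v and the
  scalar contributes nothing; the operator carries the value 1 from w to v.\<close>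

lemma psi_diagonal:
  assumes "reduced_word as"
  shows "psi z as (word as) = 1"
  using assms
proof (induction as)
  case Nil
  then show ?case by (simp add: delta_def del: id_apply)
next
  case (Cons a as)
  then have a: "a \<in> simple_roots D" and as: "reduced_word as" and p: "inv (word as) a \<in> pos D"
    by (auto simp: reduced_word_Cons)
  have ar: "a \<in> roots D" using a by (rule simple_root)
  have w: "word as \<in> weyl D" using as by (rule reduced_word_weyl)
  define v where "v = refl a \<circ> word as"
  have v: "v \<in> weyl D" unfolding v_def using w ar by (simp add: weyl_refl)
  have av: "refl a \<circ> v = word as" unfolding v_def by (rule refl_comp_refl_comp[OF ar])
  have lt: "len (refl a \<circ> v) < len v"
    using length_refl_greater[OF w simple_pos[OF a] p] unfolding v_def[symmetric] av .
  then have "\<not> bruhat v (word as)" using bruhat_length[of v "word as"] av by auto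
  then have "psi z as v = 0" using psi_bruhat as v by blast
  then have "psi z (a # as) v = 1" using lt v Cons.IH[OF as] av by (simp add: hecke_op_def del: comp_apply)
  then show ?case unfolding v_def word_Cons .
qed

text \<open>Each scalar has denominator 1 - z^\<beta> for a root \<beta>, and this has no zero on
  \<open>torus_reg D\<close>.\<close>

lemma psi_rational:
  assumes "reduced_word as"
  shows "rational_poly_on D (\<lambda>z. psi z as u)"
  using assms
proof (induction as arbitrary: u)
  case Nil
  then show ?case by (simp add: rational_poly_on_const)
next
  case (Cons a as)
  then have a: "a \<in> simple_roots D" and as: "reduced_word as" by (auto simp: reduced_word_Cons)
  have IH: "rational_poly_on D (\<lambda>z. psi z as u)" for u using Cons.IH as by blast
  have "inv (word as) a \<in> roots D"
    using weyl_root weyl_inv reduced_word_weyl as simple_root a by blast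
  then have "rational_poly_on D (\<lambda>z. smult (1 / (1 - z (inv (word as) a))) ((1 - [:0, 1:]) * psi z as u))"
    by (intro rational_poly_on_smult rational_on_root rational_poly_on_mult_const IH)
  then have "rational_poly_on D (\<lambda>z. weight (z (inv (word as) a)) * psi z as u)"
    by (simp only: weight_def mult_smult_left)
  moreover have "rational_poly_on D (\<lambda>z. hecke_op [:0, 1:] a (psi z as) u)"
    unfolding hecke_op_def
    by (cases "u \<in> weyl D"; cases "len (refl a \<circ> u) < len u")
       (simp_all add: rational_poly_on_add rational_poly_on_mult_const rational_poly_on_const IH
         del: comp_apply mult_pCons_left)
  ultimately show ?case unfolding psi.simps by (rule rational_poly_on_add[rotated])
qed

lemma filterlim_root_at_infinity:
  assumes "\<beta> \<in> pos D"
  shows "filterlim (\<lambda>z. z \<beta>) at_infinity (torus_at_infinity D)"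
proof -
  have "torus_at_infinity D \<le> filtercomap (\<lambda>z. z \<beta>) at_infinity"
    unfolding torus_at_infinity_def by (rule le_infI2) (rule INF_lower[OF assms])
  then show ?thesis
    using filterlim_mono[OF filterlim_filtercomap order_refl] by blast
qed

lemma tendsto_weight:
  assumes "\<beta> \<in> pos D"
  shows "((\<lambda>z. 1 / (1 - z \<beta>)) \<longlongrightarrow> (0::complex)) (torus_at_infinity D)"
proof -
  have "filterlim (\<lambda>z. - 1 + z \<beta>) at_infinity (torus_at_infinity D)"
    by (rule tendsto_add_filterlim_at_infinity[OF tendsto_const filterlim_root_at_infinity[OF assms]])
  then have "((\<lambda>z. inverse (- 1 + z \<beta>)) \<longlongrightarrow> (0::complex)) (torus_at_infinity D)"
    by (rule filterlim_compose[OF tendsto_inverse_0])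
  then have "((\<lambda>z. - inverse (- 1 + z \<beta>)) \<longlongrightarrow> (- 0::complex)) (torus_at_infinity D)"
    by (rule tendsto_minus)
  moreover have "- inverse (- 1 + x) = 1 / (1 - x)" for x :: complex
  proof -
    have "1 - x = - (- 1 + x)" by simp
    then show ?thesis by (simp only: inverse_minus_eq divide_inverse mult_1_left)
  qed
  ultimately show ?thesis by simp
qed

lemma coeff_q_mult: "coeff ([:0, 1:] * p) i = (case i of 0 \<Rightarrow> 0 | Suc j \<Rightarrow> coeff (p::'r::comm_ring_1 poly) j)"
  by (simp add: coeff_pCons split: nat.split)

text \<open>Reducedness makes every root in the scalars positive, so by
  \<open>tendsto_weight\<close> each scalar term disappears coefficient by coefficient and the Hecke
  operators remain.\<close>

lemma psi_tendsto:
  assumes "reduced_word as"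
  shows "((\<lambda>z. coeff (psi z as u) i) \<longlongrightarrow> coeff (hecke_ops [:0, 1:] as (delta id) u) i) (torus_at_infinity D)"
  using assms
proof (induction as arbitrary: u i)
  case Nil
  show ?case unfolding psi.simps hecke_ops_simps by (rule tendsto_const)
next
  case (Cons a as)
  then have p: "inv (word as) a \<in> pos D" and as: "reduced_word as" by (auto simp: reduced_word_Cons)
  note IH = Cons.IH[OF as]
  have q: "((\<lambda>z. coeff ([:0, 1:] * psi z as u) i) \<longlongrightarrow>
      coeff ([:0, 1:] * hecke_ops [:0, 1:] as (delta id) u) i) (torus_at_infinity D)" for u i
    unfolding coeff_q_mult by (cases i) (simp_all add: IH)
  have h: "((\<lambda>z. coeff (hecke_op [:0, 1:] a (psi z as) u) i) \<longlongrightarrow>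
      coeff (hecke_op [:0, 1:] a (hecke_ops [:0, 1:] as (delta id)) u) i) (torus_at_infinity D)"
  proof (cases "u \<in> weyl D \<and> \<not> len (refl a \<circ> u) < len u")
    case True
    then have "coeff (hecke_op [:0, 1:] a f u) i = coeff ([:0, 1:] * f u) i - coeff (f u) i + coeff ([:0, 1:] * f (refl a \<circ> u)) i"
      for f :: "('x \<Rightarrow> 'x) \<Rightarrow> complex poly"
      unfolding hecke_op_def left_diff_distrib by (simp del: comp_apply mult_pCons_left)
    then show ?thesis by (simp only:) (intro tendsto_add tendsto_diff q IH)
  next
    case False
    then show ?thesis unfolding hecke_op_def by (auto simp: IH simp del: comp_apply)
  qed
  have "coeff (weight x * f) i = 1 / (1 - x) * (coeff f i - coeff ([:0, 1:] * f) i)" for x f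
    unfolding weight_def mult_smult_left coeff_smult left_diff_distrib coeff_diff by simp
  then have "((\<lambda>z. coeff (weight (z (inv (word as) a)) * psi z as u) i) \<longlongrightarrow>
      0 * (coeff (hecke_ops [:0, 1:] as (delta id) u) i - coeff ([:0, 1:] * hecke_ops [:0, 1:] as (delta id) u) i))
      (torus_at_infinity D)"
    by (simp only:) (intro tendsto_mult tendsto_weight[OF p] tendsto_diff IH q)
  from tendsto_add[OF h this] show ?case by (simp del: id_apply)
qed

end

section \<open>Independence of the reduced word\<close>

context iwahori_hecke_algebra
begin

text \<open>A sum of roots becomes a product of values of z, so \<open>weight_mult\<close> gives one
  relation for each decomposition of a root. That all three combinations are roots keeps the values
  away from 1.\<close>

lemma wt_comb:
  assumes z: "z \<in> torus_reg D"
    and "comb A B i j \<in> roots D" "comb A B i' j' \<in> roots D" "comb A B (i + i') (j + j') \<in> roots D"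
  shows "weight (z (comb A B i j)) * weight (z (comb A B i' j')) =
    weight (z (comb A B (i + i') (j + j'))) * (weight (z (comb A B i j)) + weight (z (comb A B i' j')) - (1 - [:0, 1:]))"
proof -
  have "comb A B (i + i') (j + j') = comb A B i j + comb A B i' j'"
    by (simp add: comb_def zmod.scale_left_distrib)
  then have e: "z (comb A B (i + i') (j + j')) = z (comb A B i j) * z (comb A B i' j')"
    using torus_reg_torus[OF z] by (simp add: torus_def)
  have "z \<beta> \<noteq> 1" if "\<beta> \<in> roots D" for \<beta> using z that by (simp add: torus_reg_def)
  then show ?thesis using assms(2-4) weight_mult e by metis
qed

lemma reduced_word_root: "reduced_word as \<Longrightarrow> c \<in> simple_roots D \<Longrightarrow> inv (word as) c \<in> roots D"
  using weyl_root weyl_inv reduced_word_weyl simple_root by blast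

text \<open>The empty word satisfies \<open>up_from\<close>, so the alternating words themselves are
  reduced words of one element and \<open>hecke_ops_braid\<close> relates them.\<close>

lemma alt_op_braid:
  assumes a: "a \<in> simple_roots D" and b: "b \<in> simple_roots D" and br: "braid_relation a b k"
    and f: "f \<in> weyl_supported"
  shows "alt_op (hecke_op [:0, 1::complex:] a) (hecke_op [:0, 1:] b) k f = alt_op (hecke_op [:0, 1:] b) (hecke_op [:0, 1:] a) k f"
proof -
  have "up_from a b []"
    using a b simple_pos reduced_word_Nil by (simp add: up_from_def)
  then have "reduced_word (alt a b k @ [])" "reduced_word (alt b a k @ [])"
    using br unfolding braid_relation_def by blast+
  then show ?thesis
    unfolding alt_op_hecke using hecke_ops_braid[of "alt a b k" "alt b a k" f] br f
    by (simp add: braid_relation_def)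
qed

definition psi_braid :: "'x \<Rightarrow> 'x \<Rightarrow> nat \<Rightarrow> bool" where
  "psi_braid a b k \<longleftrightarrow> braid_relation a b k \<and>
     (\<forall>z\<in>torus_reg D. \<forall>as. up_from a b as \<longrightarrow> psi z (alt a b k @ as) = psi z (alt b a k @ as))"

lemma psi_braid_swap: "psi_braid a b k \<Longrightarrow> psi_braid b a k"
  unfolding psi_braid_def up_from_swap[of b a] using braid_relation_swap by metis

lemma psi_braid_2:
  assumes a: "a \<in> simple_roots D" and b: "b \<in> simple_roots D" and p: "pair a b = 0" "pair b a = 0"
  shows "psi_braid a b 2"
  unfolding psi_braid_def
proof (intro conjI ballI allI impI)
  show br: "braid_relation a b 2" using braid_relation_2 a b p by blast
  fix z as assume z: "z \<in> torus_reg D" and up: "up_from a b as"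
  interpret quadratic_pair "hecke_op [:0, 1::complex:] a" "hecke_op [:0, 1:] b" weyl_supported "1 - [:0, 1:]" "[:0, 1:]"
    by (rule quadratic_pair_hecke_op[OF a b])
  define A B where "A = inv (word as) a" and "B = inv (word as) b"
  note c = chain_2[OF a b p up, folded A_def B_def]
  note d = chain_2[OF b a p(2,1) up[unfolded up_from_swap[of a b]], folded A_def B_def, unfolded comb_swap[of B]]
  have "SA (weight (z A)) (TA (weight (z B)) (psi z as)) = TA (weight (z B)) (SA (weight (z A)) (psi z as))"
    by (rule yang_baxter_2[OF psi_supported alt_op_braid[OF a b br psi_supported]])
  then show "psi z (alt a b 2 @ as) = psi z (alt b a 2 @ as)"
    by (simp add: alt_num c(4) d(4) comb_basis SA_def[abs_def] TA_def[abs_def] flip: A_def B_def del: word_Cons)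
qed

lemma psi_braid_3:
  assumes a: "a \<in> simple_roots D" and b: "b \<in> simple_roots D" and p: "pair a b = - 1" "pair b a = - 1"
  shows "psi_braid a b 3"
  unfolding psi_braid_def
proof (intro conjI ballI allI impI)
  show br: "braid_relation a b 3" using braid_relation_3 a b p by blast
  fix z as assume z: "z \<in> torus_reg D" and up: "up_from a b as"
  interpret quadratic_pair "hecke_op [:0, 1::complex:] a" "hecke_op [:0, 1:] b" weyl_supported "1 - [:0, 1:]" "[:0, 1:]"
    by (rule quadratic_pair_hecke_op[OF a b])
  define A B where "A = inv (word as) a" and "B = inv (word as) b"
  note c = chain_3[OF a b p up, folded A_def B_def]
  note d = chain_3[OF b a p(2,1) up[unfolded up_from_swap[of a b]], folded A_def B_def, unfolded comb_swap[of B]]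
  have as: "reduced_word as" using up by (simp add: up_from_def)
  have r: "comb A B 1 0 \<in> roots D" "comb A B 1 1 \<in> roots D" "comb A B 0 1 \<in> roots D"
    using reduced_word_root[OF as a] reduced_word_root[OF as b] reduced_word_root[OF c(1) b]
    by (simp_all add: c(4) comb_basis flip: A_def B_def del: word_Cons)
  note wt = wt_comb[OF z, of A B]
  have rel: "weight (z (comb A B 1 0)) * weight (z (comb A B 0 1)) =
      weight (z (comb A B 1 1)) * (weight (z (comb A B 1 0)) + weight (z (comb A B 0 1)) - (1 - [:0, 1:]))"
    using wt[of 1 0 0 1] r by simp
  have "SA (weight (z (comb A B 0 1))) (TA (weight (z (comb A B 1 1))) (SA (weight (z (comb A B 1 0))) (psi z as))) =
      TA (weight (z (comb A B 1 0))) (SA (weight (z (comb A B 1 1))) (TA (weight (z (comb A B 0 1))) (psi z as)))"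
    by (rule yang_baxter_3[OF psi_supported alt_op_braid[OF a b br psi_supported] rel])
  then show "psi z (alt a b 3 @ as) = psi z (alt b a 3 @ as)"
    by (simp add: alt_num c(4,6) d(4,6) comb_basis SA_def[abs_def] TA_def[abs_def] flip: A_def B_def del: word_Cons)
qed

lemma psi_braid_4:
  assumes a: "a \<in> simple_roots D" and b: "b \<in> simple_roots D" and p: "pair a b = - 1" "pair b a = - 2"
  shows "psi_braid a b 4"
  unfolding psi_braid_def
proof (intro conjI ballI allI impI)
  show br: "braid_relation a b 4" using braid_relation_4 a b p by blast
  fix z as assume z: "z \<in> torus_reg D" and up: "up_from a b as"
  interpret quadratic_pair "hecke_op [:0, 1::complex:] a" "hecke_op [:0, 1:] b" weyl_supported "1 - [:0, 1:]" "[:0, 1:]"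
    by (rule quadratic_pair_hecke_op[OF a b])
  define A B where "A = inv (word as) a" and "B = inv (word as) b"
  \<comment> \<open>The pair (m, n) is (1, 2) for the chain that starts with a and (2, 1) for the
    one that starts with b.\<close>
  have mn: "(1::int) * 2 = 2" "(0::int) \<le> 1" "(2::int) * 1 = 2" "(0::int) \<le> 2" by simp_all
  note c = chain_4[OF a b p mn(1,2) up, folded A_def B_def]
  note d = chain_4[OF b a p(2,1) mn(3,4) up[unfolded up_from_swap[of a b]], folded A_def B_def, unfolded comb_swap[of B]]
  have as: "reduced_word as" using up by (simp add: up_from_def)
  have r: "comb A B 1 0 \<in> roots D" "comb A B 1 1 \<in> roots D" "comb A B 1 2 \<in> roots D" "comb A B 0 1 \<in> roots D"
    using reduced_word_root[OF as a] reduced_word_root[OF c(1) b]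
      reduced_word_root[OF c(3) a] reduced_word_root[OF c(5) b]
    by (simp_all add: c(4,6,8) comb_basis flip: A_def B_def del: word_Cons)
  note wt = wt_comb[OF z, of A B]
  let ?w = "\<lambda>i j. weight (z (comb A B i j))"
  \<comment> \<open>The decomposable positive roots are A + B and A + 2 B = B + (A + B), each in one
    way.\<close>
  have rel: "?w 0 1 * ?w 1 0 = ?w 1 1 * (?w 0 1 + ?w 1 0 - (1 - [:0, 1:]))"
    "?w 0 1 * ?w 1 1 = ?w 1 2 * (?w 0 1 + ?w 1 1 - (1 - [:0, 1:]))"
    using wt[of 0 1 1 0] wt[of 0 1 1 1] r by simp_all
  have "SA (?w 1 0) (TA (?w 1 1) (SA (?w 1 2) (TA (?w 0 1) (psi z as)))) =
      TA (?w 0 1) (SA (?w 1 2) (TA (?w 1 1) (SA (?w 1 0) (psi z as))))"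
    by (rule yang_baxter_4[OF psi_supported alt_op_braid[OF a b br psi_supported] rel])
  then show "psi z (alt a b 4 @ as) = psi z (alt b a 4 @ as)"
    by (simp add: alt_num c(4,6,8) d(4,6,8) comb_basis SA_def[abs_def] TA_def[abs_def] flip: A_def B_def del: word_Cons)
qed

lemma psi_braid_6:
  assumes a: "a \<in> simple_roots D" and b: "b \<in> simple_roots D" and p: "pair a b = - 1" "pair b a = - 3"
  shows "psi_braid a b 6"
  unfolding psi_braid_def
proof (intro conjI ballI allI impI)
  show br: "braid_relation a b 6" using braid_relation_6 a b p by blast
  fix z as assume z: "z \<in> torus_reg D" and up: "up_from a b as"
  interpret quadratic_pair "hecke_op [:0, 1::complex:] a" "hecke_op [:0, 1:] b" weyl_supported "1 - [:0, 1:]" "[:0, 1:]"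
    by (rule quadratic_pair_hecke_op[OF a b])
  define A B where "A = inv (word as) a" and "B = inv (word as) b"
  have mn: "(1::int) * 3 = 3" "(0::int) \<le> 1" "(3::int) * 1 = 3" "(0::int) \<le> 3" by simp_all
  note c = chain_6[OF a b p mn(1,2) up, folded A_def B_def]
  note d = chain_6[OF b a p(2,1) mn(3,4) up[unfolded up_from_swap[of a b]], folded A_def B_def, unfolded comb_swap[of B]]
  have as: "reduced_word as" using up by (simp add: up_from_def)
  have r: "comb A B 1 0 \<in> roots D" "comb A B 1 1 \<in> roots D" "comb A B 2 3 \<in> roots D"
    "comb A B 1 2 \<in> roots D" "comb A B 1 3 \<in> roots D" "comb A B 0 1 \<in> roots D"
    using reduced_word_root[OF as a] reduced_word_root[OF c(1) b]
      reduced_word_root[OF c(3) a] reduced_word_root[OF c(5) b]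
      reduced_word_root[OF c(7) a] reduced_word_root[OF c(9) b]
    by (simp_all add: c(4,6,8,10,12) comb_basis flip: A_def B_def del: word_Cons)
  note wt = wt_comb[OF z, of A B]
  let ?w = "\<lambda>i j. weight (z (comb A B i j))"
  \<comment> \<open>One relation for each decomposition of a positive root; 2 A + 3 B has two of
    them.\<close>
  have rel: "?w 0 1 * ?w 1 0 = ?w 1 1 * (?w 0 1 + ?w 1 0 - (1 - [:0, 1:]))"
    "?w 0 1 * ?w 1 1 = ?w 1 2 * (?w 0 1 + ?w 1 1 - (1 - [:0, 1:]))"
    "?w 0 1 * ?w 1 2 = ?w 1 3 * (?w 0 1 + ?w 1 2 - (1 - [:0, 1:]))"
    "?w 1 2 * ?w 1 1 = ?w 2 3 * (?w 1 2 + ?w 1 1 - (1 - [:0, 1:]))"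
    "?w 1 3 * ?w 1 0 = ?w 2 3 * (?w 1 3 + ?w 1 0 - (1 - [:0, 1:]))"
    using wt[of 0 1 1 0] wt[of 0 1 1 1] wt[of 0 1 1 2] wt[of 1 2 1 1] wt[of 1 3 1 0] r by simp_all
  have "SA (?w 1 0) (TA (?w 1 1) (SA (?w 2 3) (TA (?w 1 2) (SA (?w 1 3) (TA (?w 0 1) (psi z as)))))) =
      TA (?w 0 1) (SA (?w 1 3) (TA (?w 1 2) (SA (?w 2 3) (TA (?w 1 1) (SA (?w 1 0) (psi z as))))))"
    by (rule yang_baxter_6[OF psi_supported alt_op_braid[OF a b br psi_supported] rel])
  then show "psi z (alt a b 6 @ as) = psi z (alt b a 6 @ as)"
    by (simp add: alt_num c(4,6,8,10,12) d(4,6,8,10,12) comb_basis SA_def[abs_def] TA_def[abs_def] flip: A_def B_def del: word_Cons)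
qed

lemma exists_psi_braid:
  assumes a: "a \<in> simple_roots D" and b: "b \<in> simple_roots D" and ne: "a \<noteq> b"
  shows "\<exists>k. psi_braid a b k"
proof -
  consider "pair a b = 0" "pair b a = 0" | "pair a b = -1" "pair b a = -1"
    | "pair a b = -1" "pair b a = -2" | "pair b a = -1" "pair a b = -2"
    | "pair a b = -1" "pair b a = -3" | "pair b a = -1" "pair a b = -3"
    using simple_pair_cases[OF a b ne] by blast
  then show ?thesis
    by cases (use psi_braid_2 psi_braid_3 psi_braid_4 psi_braid_6 psi_braid_swap a b in blast)+
qed

text \<open>Matsumoto's argument by induction on the length. Words with a common first letter reduce
  to their tails. If the first letters a and b differ, the element descends along both, so the
  longest element of their dihedral group splits off; its two alternating words in front of a common
  remainder \<open>js\<close> connect \<open>as\<close> with \<open>bs\<close>.\<close>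

lemma psi_unique:
  assumes "z \<in> torus_reg D" "reduced_word as" "reduced_word bs" "word as = word bs"
  shows "psi z as = psi z bs"
  using assms(2-)
proof (induction "length as" arbitrary: as bs rule: less_induct)
  case less
  have l: "length bs = length as" using less.prems unfolding reduced_word_def by metis
  show ?case
  proof (cases as)
    case Nil
    then show ?thesis using l by simp
  next
    case (Cons a ms)
    then obtain b ns where bs: "bs = b # ns" using l by (cases bs) auto
    have a: "a \<in> simple_roots D" and ms: "reduced_word ms" and pa: "inv (word ms) a \<in> pos D"
      using less.prems(1) by (auto simp: Cons reduced_word_Cons)
    have b: "b \<in> simple_roots D" and ns: "reduced_word ns" and pb: "inv (word ns) b \<in> pos D"
      using less.prems(2) by (auto simp: bs reduced_word_Cons)
    \<comment> \<open>Cancelling the common letter leaves words of equal elements, and equal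
      elements attach the same scalar to that letter.\<close>
    have tail: "psi z (c # xs) = psi z (c # ys)"
      if "reduced_word xs" "reduced_word (c # ys)" "word (c # xs) = word (c # ys)" "length xs < length as" "c \<in> simple_roots D"
      for c xs ys
    proof -
      have cr: "c \<in> roots D" using that(5) by (rule simple_root)
      have "refl c \<circ> word (c # xs) = refl c \<circ> word (c # ys)" using that(3) by simp
      then have w: "word xs = word ys" unfolding word_Cons refl_comp_refl_comp[OF cr] .
      have "reduced_word ys" using that(2) by (simp add: reduced_word_Cons)
      then have "psi z xs = psi z ys" by (rule less.hyps[OF that(4,1) _ w])
      then show ?thesis unfolding psi.simps w by simp
    qed
    show ?thesis
    proof (cases "a = b")
      case True
      have "psi z (a # ms) = psi z (a # ns)"
        by (rule tail[OF ms]) (use less.prems Cons bs True a in \<open>simp_all del: word_Cons\<close>)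
      then show ?thesis by (simp only: Cons bs True)
    next
      case False
      obtain k where k: "psi_braid a b k" using exists_psi_braid a b False by blast
      then have br: "braid_relation a b k" by (simp add: psi_braid_def)
      define v where "v = word as"
      have v: "v \<in> weyl D" unfolding v_def by (rule reduced_word_weyl[OF less.prems(1)])
      have neg: "inv (word (c # xs)) c \<notin> pos D" if c: "c \<in> simple_roots D" and xs: "reduced_word xs" and p: "inv (word xs) c \<in> pos D"
        for c xs
      proof -
        have cr: "c \<in> roots D" using c by (rule simple_root)
        have "inv (word (c # xs)) c = - inv (word xs) c"
          using weyl_inv[OF reduced_word_weyl[OF xs]]
          unfolding inv_word_Cons[OF cr xs] refl_self[OF cr] by (simp add: weyl_simps)
        then show ?thesis using uminus_pos_iff[OF pos_root[OF p]] p by simp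
      qed
      have va: "inv v a \<notin> pos D" unfolding v_def Cons by (rule neg[OF a ms pa])
      have vb: "inv v b \<notin> pos D" unfolding v_def less.prems(3) bs by (rule neg[OF b ns pb])
      define u where "u = word (alt a b k)"
      have "set (alt a b k) \<subseteq> simple_roots D" using set_alt[of a b k] a b by blast
      then have u: "u \<in> weyl D" unfolding u_def by (rule word_in_weyl)
      obtain js where js: "reduced_word js" "word js = inv u \<circ> v"
        using exists_reduced_word[of "inv u \<circ> v"] u v weyl_comp weyl_inv by blast
      have i: "inv (word js) = inv v \<circ> u"
        unfolding js(2) using u v by (simp add: inv_comp weyl_inv weyl_inv_inv)
      have up: "up_from a b js"
      proof -
        have "inv v (u a) \<in> pos D \<and> inv v (u b) \<in> pos D"
          using br v va vb unfolding u_def braid_relation_def by blast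
        then show ?thesis using js(1) unfolding up_from_def i comp_apply by blast
      qed
      have red: "reduced_word (alt a b k @ js)" "reduced_word (alt b a k @ js)"
        using br up unfolding braid_relation_def by blast+
      have uj: "u \<circ> word js = v" unfolding js(2) using u by (simp add: o_assoc weyl_inv_comp)
      have w: "word (alt a b k @ js) = v" "word (alt b a k @ js) = v"
        using br uj by (simp_all add: word_append braid_relation_def u_def)
      \<comment> \<open>The alternating words are nonempty, so each shares its first letter with one
        of the two given words, and \<open>tail\<close> applies at both ends of the
        connection.\<close>
      obtain k' where k': "k = Suc k'" using br unfolding braid_relation_def using gr0_implies_Suc by blast
      have "psi z (a # ms) = psi z (a # alt b a k' @ js)"
        by (rule tail[OF ms]) (use red(1) w(1) a in \<open>simp_all add: k' v_def Cons del: word_Cons\<close>)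
      then have "psi z as = psi z (alt a b k @ js)" by (simp only: Cons k' alt.simps append_Cons)
      also have "\<dots> = psi z (alt b a k @ js)"
        using k up assms(1) by (simp add: psi_braid_def)
      also have "psi z (alt b a k @ js) = psi z bs"
      proof -
        have "psi z (b # ns) = psi z (b # alt a b k' @ js)"
          by (rule tail[OF ns]) (use red(2) w(2) b l less.prems(3) in \<open>simp_all add: k' v_def bs del: word_Cons\<close>)
        then show ?thesis by (simp only: bs k' alt.simps append_Cons)
      qed
      finally show ?thesis .
    qed
  qed
qed

section \<open>The functions r and their recursion\<close>

definition some_reduced_word :: "('x \<Rightarrow> 'x) \<Rightarrow> 'x list" where
  "some_reduced_word w = (SOME as. reduced_word as \<and> word as = w)"

lemma some_reduced_word:
  assumes "w \<in> weyl D"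
  shows "reduced_word (some_reduced_word w)" "word (some_reduced_word w) = w"
  using someI_ex[OF exists_reduced_word[OF assms]] unfolding some_reduced_word_def by auto

definition r_poly :: "('x \<Rightarrow> 'x) \<Rightarrow> ('x \<Rightarrow> 'x) \<Rightarrow> ('x \<Rightarrow> complex) \<Rightarrow> complex poly" where
  "r_poly u v z = psi z (some_reduced_word v) u"

text \<open>Since sv < v, putting \<alpha> in front of the chosen word of sv gives a reduced word of
  v. It may differ from the chosen word of v, which is where \<open>psi_unique\<close>
  enters.\<close>

lemma r_poly_step:
  assumes z: "z \<in> torus_reg D" and v: "v \<in> weyl D" and a: "\<alpha> \<in> simple_roots D"
    and lt: "len (refl \<alpha> \<circ> v) < len v"
  shows "r_poly u v z = hecke_op [:0, 1:] \<alpha> (\<lambda>u. r_poly u (refl \<alpha> \<circ> v) z) u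
    + weight (z (- inv v \<alpha>)) * r_poly u (refl \<alpha> \<circ> v) z"
proof -
  have ar: "\<alpha> \<in> roots D" using a by (rule simple_root)
  define w where "w = refl \<alpha> \<circ> v"
  have w: "w \<in> weyl D" unfolding w_def using ar v by (rule weyl_refl)
  have aw: "refl \<alpha> \<circ> w = v" unfolding w_def by (rule refl_comp_refl_comp[OF ar])
  have i: "inv w \<alpha> = - inv v \<alpha>"
    unfolding w_def inv_refl_comp[OF ar v] using weyl_inv[OF v] by (simp add: refl_self ar weyl_simps)
  have "inv w \<alpha> \<in> pos D"
    unfolding i
    using lt length_refl_less_iff[OF v simple_pos[OF a]] uminus_pos_iff[OF weyl_root[OF weyl_inv[OF v] ar]]
    by blast
  then have "reduced_word (\<alpha> # some_reduced_word w)"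
    using some_reduced_word[OF w] a by (simp add: reduced_word_Cons)
  moreover have "word (\<alpha> # some_reduced_word w) = word (some_reduced_word v)"
    unfolding word_Cons some_reduced_word[OF w] some_reduced_word[OF v] by (rule aw)
  ultimately have "psi z (some_reduced_word v) = psi z (\<alpha> # some_reduced_word w)"
    using psi_unique[OF z] some_reduced_word(1)[OF v] by metis
  then show ?thesis
    unfolding r_poly_def w_def[symmetric] by (simp add: some_reduced_word[OF w] i)
qed

lemma r_poly_recursion:
  assumes z: "z \<in> torus_reg D" and u: "u \<in> weyl D" and v: "v \<in> weyl D" and a: "\<alpha> \<in> simple_roots D"
    and lt: "len (refl \<alpha> \<circ> v) < len v"
  defines "x \<equiv> z (- inv v \<alpha>)"
  shows "len (refl \<alpha> \<circ> u) < len u \<Longrightarrow> r_poly u v z =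
      smult (1 / (1 - x)) (1 - [:0, 1:]) * r_poly u (refl \<alpha> \<circ> v) z + r_poly (refl \<alpha> \<circ> u) (refl \<alpha> \<circ> v) z"
    and "len u < len (refl \<alpha> \<circ> u) \<Longrightarrow> r_poly u v z =
      smult (x / (1 - x)) (1 - [:0, 1:]) * r_poly u (refl \<alpha> \<circ> v) z + [:0, 1:] * r_poly (refl \<alpha> \<circ> u) (refl \<alpha> \<circ> v) z"
proof -
  note step = r_poly_step[OF z v a lt, of u, folded x_def, unfolded hecke_op_def weight_def]
  {
    assume "len (refl \<alpha> \<circ> u) < len u"
    then show "r_poly u v z =
      smult (1 / (1 - x)) (1 - [:0, 1:]) * r_poly u (refl \<alpha> \<circ> v) z + r_poly (refl \<alpha> \<circ> u) (refl \<alpha> \<circ> v) z"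
      unfolding step using u by (simp del: comp_apply)
  next
    assume up: "len u < len (refl \<alpha> \<circ> u)"
    have "- inv v \<alpha> \<in> roots D"
      using weyl_root[OF weyl_inv[OF v] simple_root[OF a]] by (rule uminus_root)
    then have "x \<noteq> 1" using z by (simp add: x_def torus_reg_def)
    \<comment> \<open>This identity absorbs the q - 1 of \<open>hecke_op\<close> into the scalar of
      the second case.\<close>
    then have "1 / (1 - x) - 1 = x / (1 - x)" by (simp add: field_simps)
    then have e: "smult (x / (1 - x)) (1 - [:0, 1:]) = ([:0, 1:] - 1) + smult (1 / (1 - x)) (1 - [:0, 1:])"
      by (simp flip: \<open>1 / (1 - x) - 1 = x / (1 - x)\<close> add: smult_diff_left)
    show "r_poly u v z =
      smult (x / (1 - x)) (1 - [:0, 1:]) * r_poly u (refl \<alpha> \<circ> v) z + [:0, 1:] * r_poly (refl \<alpha> \<circ> u) (refl \<alpha> \<circ> v) z"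
      unfolding step e distrib_right using u up by (simp del: comp_apply mult_pCons_left add: algebra_simps)
  }
qed

lemma r_poly_tendsto:
  assumes "R_polynomials D scale T R" and u: "u \<in> weyl D" and v: "v \<in> weyl D"
  shows "((\<lambda>z. coeff (r_poly u v z) i) \<longlongrightarrow> of_int (coeff (R u v) i)) (torus_at_infinity D)"
proof -
  let ?as = "some_reduced_word v"
  have "cpoly (R u v) = hecke_ops [:0, 1:] ?as (delta id) u"
    using R_polynomials_hecke_ops[OF assms(1) some_reduced_word(1)[OF v] u]
    by (simp only: some_reduced_word(2)[OF v] cpoly_hecke_ops)
  then have "of_int (coeff (R u v) i) = coeff (hecke_ops [:0, 1::complex:] ?as (delta id) u) i"
    using coeff_cpoly by metis
  then show ?thesis
    unfolding r_poly_def using psi_tendsto[OF some_reduced_word(1)[OF v]] by simp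
qed

end

theorem theorem2:
  fixes D :: "'x::ab_group_add root_datum"
    and scale :: "laurent \<Rightarrow> 'h::ring_1 \<Rightarrow> 'h"
    and T :: "('x \<Rightarrow> 'x) \<Rightarrow> 'h"
    and R :: "('x \<Rightarrow> 'x) \<Rightarrow> ('x \<Rightarrow> 'x) \<Rightarrow> int poly"
  assumes "based_root_datum D"
    and "iwahori_hecke_algebra D scale T"
    and "R_polynomials D scale T R"
  shows "\<exists>r :: ('x \<Rightarrow> 'x) \<Rightarrow> ('x \<Rightarrow> 'x) \<Rightarrow> ('x \<Rightarrow> complex) \<Rightarrow> complex poly.
    (\<forall>u\<in>weyl D. \<forall>v\<in>weyl D. rational_poly_on D (r u v)) \<and>
    (\<forall>u\<in>weyl D. \<forall>z\<in>torus_reg D. r u u z = 1) \<and>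
    (\<forall>u\<in>weyl D. \<forall>v\<in>weyl D. \<not> bruhat_le D u v \<longrightarrow> (\<forall>z\<in>torus_reg D. r u v z = 0)) \<and>
    (\<forall>u\<in>weyl D. \<forall>v\<in>weyl D. \<forall>i.
       ((\<lambda>z. coeff (r u v z) i) \<longlongrightarrow> of_int (coeff (R u v) i)) (torus_at_infinity D)) \<and>
    (\<forall>u\<in>weyl D. \<forall>v\<in>weyl D. \<forall>\<alpha>\<in>simple_roots D. \<forall>z\<in>torus_reg D.
       let q = [:0, 1:]; s = root_refl D \<alpha>; x = z (- inv v \<alpha>) in
       bruhat_less D (s \<circ> v) v \<longrightarrow>
         (bruhat_less D (s \<circ> u) u \<longrightarrow>
            r u v z = smult (1 / (1 - x)) (1 - q) * r u (s \<circ> v) z + r (s \<circ> u) (s \<circ> v) z) \<and>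
         (bruhat_less D u (s \<circ> u) \<longrightarrow>
            r u v z = smult (x / (1 - x)) (1 - q) * r u (s \<circ> v) z + q * r (s \<circ> u) (s \<circ> v) z))"
proof -
  interpret iwahori_hecke_algebra D scale T by (rule assms(2))
  show ?thesis
  proof (intro exI[of _ r_poly] conjI ballI allI impI)
    fix u v assume u: "u \<in> weyl D" and v: "v \<in> weyl D"
    show "rational_poly_on D (r_poly u v)"
      unfolding r_poly_def[abs_def] using psi_rational some_reduced_word(1)[OF v] by blast
  next
    fix u z assume u: "u \<in> weyl D"
    show "r_poly u u z = 1"
      using psi_diagonal[OF some_reduced_word(1)[OF u]] by (simp add: r_poly_def some_reduced_word[OF u])
  next
    fix u v z assume u: "u \<in> weyl D" and v: "v \<in> weyl D" and "\<not> bruhat_le D u v"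
    then show "r_poly u v z = 0"
      using psi_bruhat[OF some_reduced_word(1)[OF v] u] by (simp add: r_poly_def some_reduced_word[OF v])
  next
    fix u v i assume "u \<in> weyl D" "v \<in> weyl D"
    then show "((\<lambda>z. coeff (r_poly u v z) i) \<longlongrightarrow> of_int (coeff (R u v) i)) (torus_at_infinity D)"
      by (rule r_poly_tendsto[OF assms(3)])
  next
    fix u v \<alpha> z
    assume u: "u \<in> weyl D" and v: "v \<in> weyl D" and a: "\<alpha> \<in> simple_roots D" and z: "z \<in> torus_reg D"
    show "let q = [:0, 1:]; s = root_refl D \<alpha>; x = z (- inv v \<alpha>) in
       bruhat_less D (s \<circ> v) v \<longrightarrow>
         (bruhat_less D (s \<circ> u) u \<longrightarrow>
            r_poly u v z = smult (1 / (1 - x)) (1 - q) * r_poly u (s \<circ> v) z + r_poly (s \<circ> u) (s \<circ> v) z) \<and>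
         (bruhat_less D u (s \<circ> u) \<longrightarrow>
            r_poly u v z = smult (x / (1 - x)) (1 - q) * r_poly u (s \<circ> v) z + q * r_poly (s \<circ> u) (s \<circ> v) z)"
      \<comment> \<open>For a simple reflection the Bruhat conditions are length conditions, the
        form in which the recursion was proved.\<close>
      unfolding Let_def bruhat_less_simple[OF u a] bruhat_less_simple[OF v a]
      using r_poly_recursion[OF z u v a] by blast
  qed
qed

end
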